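(* Let $(B(t),\,t\ge 0)$ be a standard one-dimensional Brownian motion started at $0$, let $\ell(y,t)$ denote its (occupation density) local time at level $y\in\mathbb{R}$ up to time $t\ge 0$, and let $K(t) := \big(B(t),\,\ell(B(t),t)\big)$ for $t\ge 0$. Almost surely, for every $t\ge 0$, $$\big\{K(u)\colon u\in[0,t]\big\} = \big\{(y,s)\colon y\in\{B(u)\colon u\in[0,t]\},\ s\in[0,\ell(y,t)]\big\},$$ and the area (two-dimensional Lebesgue measure) of this set equals $\int_{-\infty}^{\infty}\ell(y,t)\,dy = t$. Moreover, for all real $c\neq 0$ and $d>0$, the process $\big(\big(cB(t),\,d\,\ell(B(t),t)\big),\ t\ge 0\big)$ is almost surely a continuous curve with range $\mathbb{R}\times[0,\infty)$, and, almost surely, for every $t\ge 0$ the area of the set it covers during $[0,t]$ equals $|c|\,d\,t$.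
   Context: The local time of the Brownian motion $B$ is defined by $$\ell(y,t) := \lim_{\epsilon\to 0}(2\epsilon)^{-1}\,\mathrm{Leb}\{u\in[0,t]\colon |B(u)-y|<\epsilon\},\qquad y\in\mathbb{R},\ t\ge 0,$$ where $\mathrm{Leb}$ is Lebesgue measure on $\mathbb{R}$. It is a standard fact (Trotter's theorem) that there is an event of probability one on which this limit exists simultaneously for all $(y,t)\in\mathbb{R}\times[0,\infty)$ and is jointly continuous in $(y,t)$; $\ell$ denotes this random field. The process $K$ is called the Brownian bricklayer. The area covered by a planar curve $\gamma$ during $[0,t]$ means the two-dimensional Lebesgue measure of $\{\gamma(u)\colon u\in[0,t]\}$. *)

theory Defs
  imports "HOL-Probability.Probability"
begin

text \<open>
  The time parameter is a real number of which only the values \<open>t \<ge> 0\<close> matter. The starting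
  point and the continuity of paths are only required almost surely, so versions in which they
  hold surely are covered as well. The second argument of \<^const>\<open>normal_density\<close> is the
  standard deviation, so \<open>B t - B s\<close> has variance \<open>t - s\<close>.
\<close>

locale standard_brownian_motion = prob_space M
  for M :: "'w measure" +
  fixes B :: "real \<Rightarrow> 'w \<Rightarrow> real"
  assumes measurable_B: "t \<ge> 0 \<Longrightarrow> B t \<in> borel_measurable M"
    and start_at_0: "AE \<omega> in M. B 0 \<omega> = 0"
    and indep_increments:
      "\<And>(\<tau> :: nat \<Rightarrow> real) n. 0 \<le> \<tau> 0 \<Longrightarrow> (\<And>i. i < n \<Longrightarrow> \<tau> i \<le> \<tau> (Suc i)) \<Longrightarrow>
        indep_vars (\<lambda>_. borel) (\<lambda>i \<omega>. B (\<tau> (Suc i)) \<omega> - B (\<tau> i) \<omega>) {..<n}"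
    and normal_increments:
      "0 \<le> s \<Longrightarrow> s < t \<Longrightarrow>
        distributed M lborel (\<lambda>\<omega>. B t \<omega> - B s \<omega>) (\<lambda>x. ennreal (normal_density 0 (sqrt (t - s)) x))"
    and continuous_paths: "AE \<omega> in M. continuous_on {0..} (\<lambda>t. B t \<omega>)"

text \<open>
  Local time is defined path by path, for a function \<open>b\<close> on the time axis. The value is
  unspecified at points where the limit does not exist.
\<close>

definition local_time :: "(real \<Rightarrow> real) \<Rightarrow> real \<Rightarrow> real \<Rightarrow> real" where
  "local_time b y t =
    Lim (at_right 0) (\<lambda>\<epsilon>. measure lebesgue {u \<in> {0..t}. \<bar>b u - y\<bar> < \<epsilon>} / (2 * \<epsilon>))"

definition bricklayer :: "(real \<Rightarrow> real) \<Rightarrow> real \<Rightarrow> real \<times> real" where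
  "bricklayer b t = (b t, local_time b (b t) t)"

end

theory Submission
  imports Defs
begin

text \<open>
  The moments of an additive functional \<open>\<integral>\<^sub>0\<^sup>t f (B u) du\<close> are iterated integrals against the heat kernel.
  When \<open>f\<close> is the difference of two neighbouring normalised tent functions, Hoelder continuity of
  the heat kernel makes them small, and sixteenth moments together with the Borel-Cantelli lemma show
  that almost surely neighbouring occupations differ by at most a geometric sequence. Along such a
  path the tent occupations converge uniformly to a jointly continuous field \<open>L\<close>, the local time,
  and the rest is deterministic: the function \<open>L y\<close> only grows while the path is at \<open>y\<close>, so by the
  intermediate value theorem every height between \<open>0\<close> and \<open>L y t\<close> is reached at a visit to \<open>y\<close>; the
  area follows by Fubini. For the range, \<open>L\<close> must be unbounded in time at every level. Decomposing
  \<open>1 - exp (- \<kappa> V\<^sub>t)\<close> by the Markov property bounds the Laplace transform of the occupation \<open>V\<^sub>t\<close> of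
  a neighbourhood of the origin, so that \<open>V\<^sub>t\<close> is of order \<open>sqrt t\<close> with high probability, and the
  same moment bounds show that the oscillation of \<open>L\<close> in space is of smaller order.
\<close>

section \<open>The heat kernel\<close>

text \<open>The obstacle is the singularity of the heat kernel at time 0. Its Lipschitz constant in
  space is of order \<open>1 / u\<close>, which is not integrable, so only half of the regularity is
  used: a displacement \<open>h\<close> contributes \<open>sqrt h\<close> at the price of
  \<open>u powr (- 3 / 4)\<close>. Moving an increment off \<open>f\<close> displaces the rest of
  the iterated integral as well, and balancing the two effects leaves a gain of
  \<open>h powr (1 / 4)\<close> per factor. Sixteen factors give \<open>h ^ 4\<close>, that is
  \<open>16 ^ -n\<close> for \<open>h = 2 ^ -n\<close>. With this method the eighth moment would
  give only \<open>4 ^ -n\<close>, which is exactly used up by a space-time grid of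
  \<open>4 ^ n\<close> points. Space is parametrised by fourth powers and time by eighth powers so
  that the roots in the estimates become monomials. The dependence on the time horizon is kept
  explicit for the divergence argument: at time \<open>q ^ 16\<close> the moment bounds make the
  increments of the occupations at most of order \<open>q ^ 6\<close>, against \<open>q ^ 8\<close>
  for the occupation itself, and the threshold \<open>q ^ 7\<close> lies between.\<close>

definition heat :: "real \<Rightarrow> real \<Rightarrow> real" where
  "heat u z = normal_density 0 (sqrt u) z"

lemma measurable_heat [measurable (raw)]:
  "f \<in> borel_measurable N \<Longrightarrow> g \<in> borel_measurable N \<Longrightarrow>
    (\<lambda>w. heat (f w) (g w)) \<in> borel_measurable N"
proof -
  assume [measurable]: "f \<in> borel_measurable N" "g \<in> borel_measurable N"
  have [measurable]: "(\<lambda>w. sqrt (f w)) \<in> borel_measurable N"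
    by (rule borel_measurable_continuous_on[OF continuous_on_real_sqrt[OF continuous_on_id]]) measurable
  show ?thesis
    unfolding heat_def normal_density_def by measurable
qed

lemma heat_nonneg [simp]: "0 \<le> heat u z"
  by (simp add: heat_def)

lemma heat_eq: "0 < u \<Longrightarrow> heat u z = exp (- ((z / sqrt u)\<^sup>2 / 2)) / (sqrt (2 * pi) * sqrt u)"
  by (simp add: heat_def normal_density_def real_sqrt_mult field_simps power_divide)

lemma heat_shift: "heat u (z - x) = normal_density x (sqrt u) z"
  by (simp add: heat_def normal_density_def)

lemma integrable_heat: "0 < u \<Longrightarrow> integrable lborel (\<lambda>z. heat u (z - x))"
  using integrable_normal_density[of "sqrt u" x]
  by (simp only: heat_shift real_sqrt_gt_zero)

lemma integral_heat: "0 < u \<Longrightarrow> (\<integral>z. heat u (z - x) \<partial>lborel) = 1"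
  using integral_normal_density[of "sqrt u" x]
  by (simp only: heat_shift real_sqrt_gt_zero)

lemma one_le_sqrt_two_pi: "1 \<le> sqrt (2 * pi)"
  using pi_gt3 by (intro real_le_rsqrt) simp

lemma heat_le:
  assumes "0 < u"
  shows "heat u z \<le> u powr (- 1 / 2)"
proof -
  have "exp (- ((z / sqrt u)\<^sup>2 / 2)) / (sqrt (2 * pi) * sqrt u) \<le> 1 / (1 * sqrt u)"
    using assms one_le_sqrt_two_pi by (intro frac_le mult_right_mono) auto
  moreover have "1 / sqrt u = u powr (- 1 / 2)"
    using assms by (simp add: powr_minus powr_half_sqrt field_simps)
  ultimately show ?thesis
    using assms by (simp add: heat_eq)
qed

text \<open>The derivative is at most 1 in absolute value, because \<open>\<bar>x\<bar> \<le> 1 +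
  x\<^sup>2 / 2 \<le> exp (x\<^sup>2 / 2)\<close>.\<close>

lemma gauss_lipschitz: "\<bar>exp (- (a\<^sup>2 / 2)) - exp (- (b\<^sup>2 / 2))\<bar> \<le> \<bar>a - b\<bar>" for a b :: real
proof -
  have d: "\<bar>- (x * exp (- (x\<^sup>2 / 2)))\<bar> \<le> 1" for x :: real
  proof -
    have "\<bar>x\<bar> \<le> 1 + x\<^sup>2 / 2"
      using zero_le_power2[of "\<bar>x\<bar> - 1"] by (simp add: power2_eq_square algebra_simps)
    also have "1 + x\<^sup>2 / 2 \<le> exp (x\<^sup>2 / 2)"
      by (rule exp_ge_add_one_self)
    finally show ?thesis
      by (simp add: abs_mult exp_minus field_simps)
  qed
  have "norm (exp (- (a\<^sup>2 / 2)) - exp (- (b\<^sup>2 / 2))) \<le> 1 * norm (a - b)"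
    by (rule field_differentiable_bound[of UNIV _ "\<lambda>x. - (x * exp (- (x\<^sup>2 / 2)))"])
      (use d in \<open>auto intro!: derivative_eq_intros simp: power2_eq_square\<close>)
  then show ?thesis by simp
qed

text \<open>Interpolation: the difference \<open>p\<close> of the exponentials is at most 1 and at
  most \<open>\<bar>a - b\<bar> / sqrt u\<close>, hence at most the square root of the latter. The
  resulting exponent \<open>- 3 / 4\<close> stays above \<open>- 1\<close>, so the bound is
  integrable in \<open>u\<close> at 0.\<close>

lemma heat_diff_le:
  assumes "0 < u"
  shows "\<bar>heat u a - heat u b\<bar> \<le> sqrt \<bar>a - b\<bar> * u powr (- 3 / 4)"
proof -
  define p where "p = exp (- ((a / sqrt u)\<^sup>2 / 2)) - exp (- ((b / sqrt u)\<^sup>2 / 2))"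
  have p1: "\<bar>p\<bar> \<le> \<bar>a - b\<bar> / sqrt u"
    using gauss_lipschitz[of "a / sqrt u" "b / sqrt u"] assms
    by (simp add: p_def diff_divide_distrib[symmetric])
  have "exp (- ((a / sqrt u)\<^sup>2 / 2)) \<le> 1" "exp (- ((b / sqrt u)\<^sup>2 / 2)) \<le> 1"
    "0 < exp (- ((a / sqrt u)\<^sup>2 / 2))" "0 < exp (- ((b / sqrt u)\<^sup>2 / 2))"
    by simp_all
  then have p2: "\<bar>p\<bar> \<le> 1"
    unfolding p_def by linarith
  have "\<bar>p\<bar>\<^sup>2 \<le> \<bar>p\<bar>"
    using p2 mult_left_le[of "\<bar>p\<bar>" "\<bar>p\<bar>"] by (simp add: power2_eq_square)
  then have p3: "\<bar>p\<bar> \<le> sqrt (\<bar>a - b\<bar> / sqrt u)"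
    using p1 by (intro real_le_rsqrt) linarith
  have s1: "sqrt u = u powr (1 / 2)"
    using assms by (simp add: powr_half_sqrt)
  have s2: "sqrt (sqrt u) = u powr (1 / 4)"
    using assms powr_half_sqrt[of "u powr (1 / 2)"] by (simp add: s1 powr_powr)
  have s3: "u powr (- 3 / 4) = 1 / (sqrt (sqrt u) * sqrt u)"
    using assms unfolding s2 unfolding s1 unfolding powr_add[symmetric]
    by (simp add: powr_minus_divide)
  have "\<bar>heat u a - heat u b\<bar> = \<bar>p\<bar> / (sqrt (2 * pi) * sqrt u)"
    using assms by (simp add: heat_eq p_def diff_divide_distrib[symmetric] abs_divide abs_mult)
  also have "\<dots> \<le> sqrt (\<bar>a - b\<bar> / sqrt u) / (1 * sqrt u)"
    using assms p3 one_le_sqrt_two_pi by (intro frac_le mult_right_mono) auto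
  also have "\<dots> = sqrt \<bar>a - b\<bar> * u powr (- 3 / 4)"
    unfolding s3 by (simp add: real_sqrt_divide)
  finally show ?thesis .
qed

text \<open>Domination yields the bound and the integrability together; the majorant comes with its
  value because the majorants below are explicit.\<close>

lemma abs_integral_le:
  fixes f g :: "'a \<Rightarrow> real"
  assumes "has_bochner_integral N g I" "f \<in> borel_measurable N" "\<And>x. \<bar>f x\<bar> \<le> g x"
  shows "\<bar>integral\<^sup>L N f\<bar> \<le> I" "integrable N f"
proof -
  have g: "integrable N g" "integral\<^sup>L N g = I"
    using assms(1) by (auto simp: has_bochner_integral_iff)
  show i: "integrable N f"
    using assms by (intro Bochner_Integration.integrable_bound[OF g(1)])
      (auto intro: order_trans[OF _ abs_ge_self])
  have "\<bar>integral\<^sup>L N f\<bar> \<le> (\<integral>x. \<bar>f x\<bar> \<partial>N)"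
    by (rule integral_abs_bound)
  also have "\<dots> \<le> integral\<^sup>L N g"
    using i g(1) assms(3) by (intro integral_mono) auto
  finally show "\<bar>integral\<^sup>L N f\<bar> \<le> I"
    using g(2) by simp
qed

lemma has_bochner_integral_powr_from_0:
  fixes a r :: real
  assumes "- 1 < a" "0 \<le> r"
  shows "has_bochner_integral lborel (\<lambda>u. indicator {0<..<r} u * u powr a) (r powr (a + 1) / (a + 1))"
proof -
  have "((\<lambda>u. if u \<in> {0..r} then u powr a else 0) has_integral (r powr (a + 1) / (a + 1))) UNIV"
    using has_integral_powr_from_0[OF assms] by (simp only: has_integral_restrict_UNIV)
  moreover have "(\<lambda>u::real. if u \<in> {0..r} then u powr a else 0)
      = (\<lambda>u. indicator {0..r} u * u powr a)"
    by (auto simp: indicator_def)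
  ultimately have "((\<lambda>u. indicator {0..r} u * u powr a) has_integral (r powr (a + 1) / (a + 1))) UNIV"
    by simp
  then have "(\<integral>\<^sup>+ u. ennreal (indicator {0..r} u * u powr a) \<partial>lborel) = ennreal (r powr (a + 1) / (a + 1))"
    by (intro nn_integral_has_integral_lborel) auto
  then have i: "has_bochner_integral lborel (\<lambda>u. indicator {0..r} u * u powr a) (r powr (a + 1) / (a + 1))"
    using assms by (intro has_bochner_integral_nn_integral) auto
  have "AE u in lborel. u \<noteq> r"
    by (rule AE_lborel_singleton)
  then have "AE u in lborel. indicator {0<..<r} u * u powr a = indicator {0..r} u * u powr a"
  proof eventually_elim
    case (elim u)
    \<comment> \<open>At the left endpoint both sides vanish, since \<open>0 powr a\<close> is 0 by
      convention; only \<open>r\<close> is exceptional.\<close>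
    then show ?case by (cases "u = 0") (auto simp: indicator_def)
  qed
  then show ?thesis
    using i by (subst has_bochner_integral_cong_AE[of _ _ "\<lambda>u. indicator {0..r} u * u powr a"]) auto
qed

section \<open>Iterated kernels\<close>

text \<open>One step of the Kac expansion: \<open>u\<close> is the first of the ordered times,
  \<open>z\<close> the position at that time, and \<open>Q\<close> takes over with the remaining
  time \<open>r - u\<close>.\<close>

definition kac_step :: "(real \<Rightarrow> real) \<Rightarrow> (real \<Rightarrow> real \<Rightarrow> real) \<Rightarrow> real \<Rightarrow> real \<Rightarrow> real" where
  "kac_step f Q r x = (\<integral>u. indicator {0<..<r} u *
      (\<integral>z. heat u (z - x) * f z * Q (r - u) z \<partial>lborel) \<partial>lborel)"

text \<open>
  \<open>n!\<close> times \<open>kac f n r x\<close> is the \<open>n\<close>-th moment of \<open>\<integral>\<^sub>0\<^sup>r f (B u) du\<close> for a Brownian motion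
  started at \<open>x\<close>.
\<close>

fun kac :: "(real \<Rightarrow> real) \<Rightarrow> nat \<Rightarrow> real \<Rightarrow> real \<Rightarrow> real" where
  "kac f 0 = (\<lambda>r x. 1)"
| "kac f (Suc n) = kac_step f (kac f n)"

lemma measurable_kac_step:
  assumes [measurable]: "f \<in> borel_measurable borel"
    and [measurable]: "case_prod Q \<in> borel_measurable (borel \<Otimes>\<^sub>M borel)"
  shows "case_prod (kac_step f Q) \<in> borel_measurable (borel \<Otimes>\<^sub>M borel)"
proof -
  have [measurable (raw)]: "(\<lambda>w. Q (a w) (b w)) \<in> borel_measurable N"
    if "a \<in> borel_measurable N" "b \<in> borel_measurable N" for N :: "'b measure" and a b
    using measurable_compose[OF measurable_Pair[OF that] assms(2)] by simp
  show ?thesis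
    unfolding kac_step_def indicator_def of_bool_def greaterThanLessThan_iff by measurable
qed

lemma measurable_kac:
  assumes "f \<in> borel_measurable borel"
  shows "case_prod (kac f n) \<in> borel_measurable (borel \<Otimes>\<^sub>M borel)"
  using assms by (induction n) (auto intro: measurable_kac_step)

lemma measurable_kac' [measurable (raw)]:
  assumes "f \<in> borel_measurable borel" "a \<in> borel_measurable N" "b \<in> borel_measurable N"
  shows "(\<lambda>w. kac f n (a w) (b w)) \<in> borel_measurable N"
  using measurable_compose[OF measurable_Pair[OF assms(2,3)] measurable_kac[OF assms(1)]] by simp

text \<open>The kernel is bounded by \<open>u powr (- 1 / 2)\<close> uniformly in space, so
  \<open>f\<close> enters only through the integral of its absolute value, however high it peaks.
  The factor \<open>2 * sqrt r\<close> is the time integral of the kernel bound.\<close>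

lemma kac_step_abs_le:
  assumes [measurable]: "f \<in> borel_measurable borel"
    and [measurable]: "case_prod Q \<in> borel_measurable (borel \<Otimes>\<^sub>M borel)"
    and f: "integrable lborel f" "(\<integral>z. \<bar>f z\<bar> \<partial>lborel) \<le> G"
    and Q: "\<And>s z. 0 \<le> s \<Longrightarrow> s \<le> r \<Longrightarrow> \<bar>Q s z\<bar> \<le> a" and "0 \<le> r" "0 \<le> a"
  shows "\<bar>kac_step f Q r x\<bar> \<le> 2 * G * sqrt r * a"
proof -
  have inner: "\<bar>\<integral>z. heat u (z - x) * f z * Q (r - u) z \<partial>lborel\<bar> \<le> u powr (- 1 / 2) * (G * a)"
    if u: "0 < u" "u < r" for u
  proof -
    have "\<bar>\<integral>z. heat u (z - x) * f z * Q (r - u) z \<partial>lborel\<bar>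
        \<le> (\<integral>z. u powr (- 1 / 2) * a * \<bar>f z\<bar> \<partial>lborel)"
    proof (rule abs_integral_le(1))
      show "has_bochner_integral lborel (\<lambda>z. u powr (- 1 / 2) * a * \<bar>f z\<bar>)
          (\<integral>z. u powr (- 1 / 2) * a * \<bar>f z\<bar> \<partial>lborel)"
        using f by (intro has_bochner_integral_integrable) auto
      show "\<bar>heat u (z - x) * f z * Q (r - u) z\<bar> \<le> u powr (- 1 / 2) * a * \<bar>f z\<bar>" for z
        using mult_mono[OF heat_le[of u "z - x"] Q[of "r - u" z]] u
          mult_right_mono[of "heat u (z - x) * \<bar>Q (r - u) z\<bar>" "u powr (- 1 / 2) * a" "\<bar>f z\<bar>"]
        by (simp add: abs_mult mult_ac)
    qed measurable
    also have "(\<integral>z. u powr (- 1 / 2) * a * \<bar>f z\<bar> \<partial>lborel) = u powr (- 1 / 2) * a * (\<integral>z. \<bar>f z\<bar> \<partial>lborel)"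
      by simp
    also have "\<dots> \<le> u powr (- 1 / 2) * a * G"
      using f \<open>0 \<le> a\<close> by (intro mult_left_mono) auto
    finally show ?thesis by (simp add: mult_ac)
  qed
  have "has_bochner_integral lborel (\<lambda>u. indicator {0<..<r} u * u powr (- 1 / 2) * (G * a))
      (r powr (- 1 / 2 + 1) / (- 1 / 2 + 1) * (G * a))"
    using \<open>0 \<le> r\<close> by (intro has_bochner_integral_mult_left has_bochner_integral_powr_from_0) auto
  then have "\<bar>kac_step f Q r x\<bar> \<le> r powr (- 1 / 2 + 1) / (- 1 / 2 + 1) * (G * a)"
    unfolding kac_step_def
    by (rule abs_integral_le(1)) (use inner in \<open>auto simp: indicator_def\<close>)
  also have "\<dots> = 2 * G * sqrt r * a"
    using \<open>0 \<le> r\<close> by (simp add: powr_half_sqrt)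
  finally show ?thesis .
qed

lemma kac_abs_le:
  assumes [measurable]: "f \<in> borel_measurable borel"
    and f: "integrable lborel f" "(\<integral>z. \<bar>f z\<bar> \<partial>lborel) \<le> G"
    and r: "0 \<le> r" "r \<le> T"
  shows "\<bar>kac f n r x\<bar> \<le> (2 * G * sqrt T) ^ n"
  using r
proof (induction n arbitrary: r x)
  case (Suc n)
  have G: "0 \<le> G"
    using f(2) by (rule order_trans[rotated]) (simp add: integral_nonneg)
  have "\<bar>kac f (Suc n) r x\<bar> \<le> 2 * G * sqrt r * (2 * G * sqrt T) ^ n"
    unfolding kac.simps using Suc G f
    by (intro kac_step_abs_le) (auto intro!: measurable_kac zero_le_power mult_nonneg_nonneg)
  also have "\<dots> \<le> 2 * G * sqrt T * (2 * G * sqrt T) ^ n"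
    using Suc G by (intro mult_right_mono mult_left_mono) (auto intro!: zero_le_power mult_nonneg_nonneg)
  finally show ?case by simp
qed simp

text \<open>Shifting one half of the inner integral moves the increment from \<open>f\<close> to the heat kernel and to \<open>Q\<close>.\<close>

lemma kac_step_difference_abs_le:
  assumes [measurable]: "g \<in> borel_measurable borel"
    and [measurable]: "case_prod Q \<in> borel_measurable (borel \<Otimes>\<^sub>M borel)"
    and g: "integrable lborel g" "(\<integral>z. \<bar>g z\<bar> \<partial>lborel) \<le> G"
    and Q: "\<And>s z. 0 \<le> s \<Longrightarrow> s \<le> r \<Longrightarrow> \<bar>Q s z\<bar> \<le> a"
    and Q': "\<And>s z. 0 \<le> s \<Longrightarrow> s \<le> r \<Longrightarrow> \<bar>Q s (z + h) - Q s z\<bar> \<le> b"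
    and "0 \<le> r" "0 \<le> a" "0 \<le> b" "0 \<le> h"
  shows "\<bar>kac_step (\<lambda>z. g z - g (z - h)) Q r x\<bar> \<le> G * (4 * sqrt h * r powr (1 / 4) * a + 2 * sqrt r * b)"
proof -
  have Qm [measurable (raw)]: "(\<lambda>w. Q (a w) (b w)) \<in> borel_measurable N"
    if "a \<in> borel_measurable N" "b \<in> borel_measurable N" for N :: "'b measure" and a b
    using measurable_compose[OF measurable_Pair[OF that] assms(2)] by simp
  have G: "0 \<le> G"
    using g(2) by (rule order_trans[rotated]) (simp add: integral_nonneg)
  have inner: "\<bar>\<integral>z. heat u (z - x) * (g z - g (z - h)) * Q (r - u) z \<partial>lborel\<bar>
      \<le> u powr (- 3 / 4) * (G * sqrt h * a) + u powr (- 1 / 2) * (G * b)"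
    if u: "0 < u" "u < r" for u
  proof -
    let ?A = "\<lambda>z. heat u (z - x) * g z * Q (r - u) z"
    let ?B = "\<lambda>z. heat u (z + h - x) * g z * Q (r - u) (z + h)"
    have hb: "\<bar>heat u v * Q (r - u) w\<bar> \<le> u powr (- 1 / 2) * a" for v w
      using mult_mono[OF heat_le[of u v] Q[of "r - u" w]] u by (simp add: abs_mult)
    have ig: "has_bochner_integral lborel (\<lambda>z. C * \<bar>g z\<bar>) (C * (\<integral>z. \<bar>g z\<bar> \<partial>lborel))" for C
      using g by (auto simp: has_bochner_integral_iff)
    have iA: "integrable lborel ?A"
      using mult_right_mono[OF hb abs_ge_zero]
      by (intro abs_integral_le(2)[OF ig[of "u powr (- 1 / 2) * a"]]) (auto simp: abs_mult mult_ac)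
    have iB: "integrable lborel ?B"
      using mult_right_mono[OF hb abs_ge_zero]
      by (intro abs_integral_le(2)[OF ig[of "u powr (- 1 / 2) * a"]]) (auto simp: abs_mult mult_ac)
    have B: "(\<lambda>z. ?B (z - h)) = (\<lambda>z. heat u (z - x) * g (z - h) * Q (r - u) z)"
      by simp
    have iB': "integrable lborel (\<lambda>z. ?B (z - h))"
      using lborel_integrable_real_affine[of ?B 1 "- h"] iB by (simp add: add.commute)
    have eB: "(\<integral>z. ?B (z - h) \<partial>lborel) = integral\<^sup>L lborel ?B"
      using lborel_integral_real_affine[of 1 ?B "- h"] by (simp add: add.commute)
    have "(\<integral>z. heat u (z - x) * (g z - g (z - h)) * Q (r - u) z \<partial>lborel)
        = (\<integral>z. ?A z - ?B (z - h) \<partial>lborel)"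
      by (intro Bochner_Integration.integral_cong) (auto simp: algebra_simps)
    also have "\<dots> = (\<integral>z. ?A z - ?B z \<partial>lborel)"
      using iA iB iB' eB by (simp only: Bochner_Integration.integral_diff)
    finally have e: "(\<integral>z. heat u (z - x) * (g z - g (z - h)) * Q (r - u) z \<partial>lborel)
        = (\<integral>z. ?A z - ?B z \<partial>lborel)" .
    have "\<bar>\<integral>z. ?A z - ?B z \<partial>lborel\<bar>
        \<le> (u powr (- 3 / 4) * (sqrt h * a) + u powr (- 1 / 2) * b) * (\<integral>z. \<bar>g z\<bar> \<partial>lborel)"
    proof (rule abs_integral_le(1)[OF ig])
      show "\<bar>?A z - ?B z\<bar> \<le> (u powr (- 3 / 4) * (sqrt h * a) + u powr (- 1 / 2) * b) * \<bar>g z\<bar>" for z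
      proof -
        have e0: "?A z - ?B z = ((heat u (z - x) - heat u (z + h - x)) * Q (r - u) z
            - heat u (z + h - x) * (Q (r - u) (z + h) - Q (r - u) z)) * g z"
          by (simp add: algebra_simps)
        have "\<bar>(heat u (z - x) - heat u (z + h - x)) * Q (r - u) z\<bar> \<le> sqrt h * u powr (- 3 / 4) * a"
          using heat_diff_le[of u "z - x" "z + h - x"] u \<open>0 \<le> h\<close> Q[of "r - u" z]
          unfolding abs_mult by (intro mult_mono) auto
        then have h1: "\<bar>(heat u (z - x) - heat u (z + h - x)) * Q (r - u) z\<bar> \<le> u powr (- 3 / 4) * (sqrt h * a)"
          by (simp only: mult_ac)
        have h2: "\<bar>heat u (z + h - x) * (Q (r - u) (z + h) - Q (r - u) z)\<bar> \<le> u powr (- 1 / 2) * b"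
          using heat_le[of u "z + h - x"] u Q'[of "r - u" z] unfolding abs_mult by (intro mult_mono) auto
        have tri: "\<bar>(P - R) * w\<bar> \<le> (p + q) * \<bar>w\<bar>" if "\<bar>P\<bar> \<le> p" "\<bar>R\<bar> \<le> q" for P R p q w :: real
          using that unfolding abs_mult by (intro mult_right_mono) auto
        show ?thesis
          unfolding e0 by (rule tri[OF h1 h2])
      qed
    qed measurable
    also have "\<dots> \<le> (u powr (- 3 / 4) * (sqrt h * a) + u powr (- 1 / 2) * b) * G"
      using g \<open>0 \<le> a\<close> \<open>0 \<le> b\<close> \<open>0 \<le> h\<close> by (intro mult_left_mono) auto
    finally show ?thesis
      unfolding e by (simp add: algebra_simps)
  qed
  have "has_bochner_integral lborel
      (\<lambda>u. indicator {0<..<r} u * u powr (- 3 / 4) * (G * sqrt h * a)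
         + indicator {0<..<r} u * u powr (- 1 / 2) * (G * b))
      (r powr (- 3 / 4 + 1) / (- 3 / 4 + 1) * (G * sqrt h * a)
         + r powr (- 1 / 2 + 1) / (- 1 / 2 + 1) * (G * b))"
    using \<open>0 \<le> r\<close>
    by (intro has_bochner_integral_add has_bochner_integral_mult_left has_bochner_integral_powr_from_0) auto
  then have "\<bar>kac_step (\<lambda>z. g z - g (z - h)) Q r x\<bar>
      \<le> r powr (- 3 / 4 + 1) / (- 3 / 4 + 1) * (G * sqrt h * a)
         + r powr (- 1 / 2 + 1) / (- 1 / 2 + 1) * (G * b)"
    unfolding kac_step_def
    by (rule abs_integral_le(1)) (use inner in \<open>auto simp: indicator_def\<close>)
  also have "\<dots> = G * (4 * sqrt h * r powr (1 / 4) * a + 2 * sqrt r * b)"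
    using \<open>0 \<le> r\<close> by (simp add: powr_half_sqrt algebra_simps)
  finally show ?thesis .
qed

text \<open>Only the heat kernel depends on the starting point, so its increment alone is estimated;
  \<open>4 * r powr (1 / 4)\<close> is the integral of \<open>u powr (- 3 / 4)\<close> over
  \<open>{0<..<r}\<close>.\<close>

lemma kac_step_shift_abs_le:
  assumes [measurable]: "f \<in> borel_measurable borel"
    and [measurable]: "case_prod Q \<in> borel_measurable (borel \<Otimes>\<^sub>M borel)"
    and f: "integrable lborel f" "(\<integral>z. \<bar>f z\<bar> \<partial>lborel) \<le> G"
    and Q: "\<And>s z. 0 \<le> s \<Longrightarrow> s \<le> r \<Longrightarrow> \<bar>Q s z\<bar> \<le> a"
    and "0 \<le> r" "0 \<le> a" "0 \<le> h"
  shows "\<bar>kac_step f Q r (x + h) - kac_step f Q r x\<bar> \<le> 4 * G * sqrt h * r powr (1 / 4) * a"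
proof -
  have Qm [measurable (raw)]: "(\<lambda>w. Q (a w) (b w)) \<in> borel_measurable N"
    if "a \<in> borel_measurable N" "b \<in> borel_measurable N" for N :: "'b measure" and a b
    using measurable_compose[OF measurable_Pair[OF that] assms(2)] by simp
  have G: "0 \<le> G"
    using f(2) by (rule order_trans[rotated]) (simp add: integral_nonneg)
  define J where "J = (\<lambda>x u. \<integral>z. heat u (z - x) * f z * Q (r - u) z \<partial>lborel)"
  have [measurable]: "J x \<in> borel_measurable borel" for x
    unfolding J_def by measurable
  have ig: "has_bochner_integral lborel (\<lambda>z. C * \<bar>f z\<bar>) (C * (\<integral>z. \<bar>f z\<bar> \<partial>lborel))" for C
    using f by (auto simp: has_bochner_integral_iff)
  have Jf: "\<bar>heat u (z - x) * f z * Q (r - u) z\<bar> \<le> (u powr (- 1 / 2) * a) * \<bar>f z\<bar>"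
    if u: "0 < u" "u < r" for u x z
    using mult_mono[OF heat_le[of u "z - x"] Q[of "r - u" z]] u
      mult_right_mono[of "heat u (z - x) * \<bar>Q (r - u) z\<bar>" "u powr (- 1 / 2) * a" "\<bar>f z\<bar>"]
    by (simp add: abs_mult mult_ac)
  have fm: "(\<lambda>z. heat u (z - x) * f z * Q (r - u) z) \<in> borel_measurable lborel" for u x
    by measurable
  note Ji = abs_integral_le(2)[OF ig fm Jf] and Jb = abs_integral_le(1)[OF ig fm Jf]
  have JI: "integrable lborel (\<lambda>u. indicator {0<..<r} u * J x u)" for x
  proof (rule abs_integral_le(2))
    show "has_bochner_integral lborel (\<lambda>u. indicator {0<..<r} u * u powr (- 1 / 2) * (a * (\<integral>z. \<bar>f z\<bar> \<partial>lborel)))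
        (r powr (- 1 / 2 + 1) / (- 1 / 2 + 1) * (a * (\<integral>z. \<bar>f z\<bar> \<partial>lborel)))"
      using \<open>0 \<le> r\<close> by (intro has_bochner_integral_mult_left has_bochner_integral_powr_from_0) auto
    show "\<bar>indicator {0<..<r} u * J x u\<bar> \<le> indicator {0<..<r} u * u powr (- 1 / 2) * (a * (\<integral>z. \<bar>f z\<bar> \<partial>lborel))" for u
      using Jb[of u x] by (auto simp: indicator_def J_def mult_ac)
  qed measurable
  have diff: "\<bar>J (x + h) u - J x u\<bar> \<le> u powr (- 3 / 4) * (G * sqrt h * a)" if u: "0 < u" "u < r" for u
  proof -
    have "J (x + h) u - J x u = (\<integral>z. heat u (z - (x + h)) * f z * Q (r - u) z - heat u (z - x) * f z * Q (r - u) z \<partial>lborel)"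
      unfolding J_def using Ji[OF u] by simp
    also have "\<bar>\<dots>\<bar> \<le> (sqrt h * u powr (- 3 / 4) * a) * (\<integral>z. \<bar>f z\<bar> \<partial>lborel)"
    proof (rule abs_integral_le(1)[OF ig])
      show "\<bar>heat u (z - (x + h)) * f z * Q (r - u) z - heat u (z - x) * f z * Q (r - u) z\<bar>
          \<le> sqrt h * u powr (- 3 / 4) * a * \<bar>f z\<bar>" for z
      proof -
        have "\<bar>(heat u (z - (x + h)) - heat u (z - x)) * Q (r - u) z\<bar> \<le> sqrt h * u powr (- 3 / 4) * a"
          using heat_diff_le[of u "z - (x + h)" "z - x"] u \<open>0 \<le> h\<close> Q[of "r - u" z]
          unfolding abs_mult by (intro mult_mono) auto
        from mult_right_mono[OF this abs_ge_zero[of "f z"]] show ?thesis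
          by (simp add: abs_mult[symmetric] algebra_simps)
      qed
    qed measurable
    also have "\<dots> \<le> (sqrt h * u powr (- 3 / 4) * a) * G"
      using f \<open>0 \<le> a\<close> \<open>0 \<le> h\<close> by (intro mult_left_mono) auto
    finally show ?thesis by (simp add: mult_ac)
  qed
  have "kac_step f Q r (x + h) - kac_step f Q r x
      = (\<integral>u. indicator {0<..<r} u * J (x + h) u - indicator {0<..<r} u * J x u \<partial>lborel)"
    unfolding kac_step_def using JI by (simp add: J_def)
  moreover have "\<bar>\<integral>u. indicator {0<..<r} u * J (x + h) u - indicator {0<..<r} u * J x u \<partial>lborel\<bar>
      \<le> r powr (- 3 / 4 + 1) / (- 3 / 4 + 1) * (G * sqrt h * a)"
  proof (rule abs_integral_le(1))
    show "has_bochner_integral lborel (\<lambda>u. indicator {0<..<r} u * u powr (- 3 / 4) * (G * sqrt h * a))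
        (r powr (- 3 / 4 + 1) / (- 3 / 4 + 1) * (G * sqrt h * a))"
      using \<open>0 \<le> r\<close> by (intro has_bochner_integral_mult_left has_bochner_integral_powr_from_0) auto
    show "\<bar>indicator {0<..<r} u * J (x + h) u - indicator {0<..<r} u * J x u\<bar>
        \<le> indicator {0<..<r} u * u powr (- 3 / 4) * (G * sqrt h * a)" for u
      using diff[of u] by (auto simp: indicator_def)
  qed measurable
  ultimately show ?thesis
    by (simp add: mult_ac)
qed

text \<open>The two estimates for \<open>kac_step\<close> feed each other: the size of the next
  iterate needs the spatial increment of the present one, and the increment of the next needs only
  the size of the present one. Hence both are carried through one induction.\<close>

lemma kac_difference_abs_le:
  assumes [measurable]: "g \<in> borel_measurable borel"
    and g: "integrable lborel g" "(\<integral>z. \<bar>g z\<bar> \<partial>lborel) \<le> 2"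
    and r: "0 \<le> r" "r \<le> \<theta> ^ 8" and \<eta>: "0 < \<eta>" "\<eta> \<le> \<theta>"
  shows "\<bar>kac (\<lambda>z. g z - g (z - \<eta> ^ 4)) n r x\<bar> \<le> (16 * \<eta> * \<theta> ^ 3) ^ n"
proof -
  define f where "f = (\<lambda>z. g z - g (z - \<eta> ^ 4))"
  \<comment> \<open>A step produces \<open>8 * \<eta>\<^sup>2 * \<theta>\<^sup>2 + 8 * \<eta> *
    \<theta> ^ 3\<close>, and each summand is at most \<open>8 * \<eta> * \<theta> ^ 3\<close>
    because \<open>\<eta> \<le> \<theta>\<close>.\<close>
  define c where "c = 16 * \<eta> * \<theta> ^ 3"
  have \<theta>: "0 < \<theta>" and c: "0 < c"
    using \<eta> by (auto simp: c_def)
  have [measurable]: "f \<in> borel_measurable borel"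
    unfolding f_def by measurable
  have ig': "integrable lborel (\<lambda>z. g (z - \<eta> ^ 4))"
    using lborel_integrable_real_affine[of g 1 "- (\<eta> ^ 4)"] g(1) by (simp add: add.commute)
  have f1: "integrable lborel f"
    using g(1) ig' unfolding f_def by (rule Bochner_Integration.integrable_diff)
  have eg': "(\<integral>z. \<bar>g (z - \<eta> ^ 4)\<bar> \<partial>lborel) = (\<integral>z. \<bar>g z\<bar> \<partial>lborel)"
    using lborel_integral_real_affine[of 1 "\<lambda>z. \<bar>g z\<bar>" "- (\<eta> ^ 4)"] by (simp add: add.commute)
  have "(\<integral>z. \<bar>f z\<bar> \<partial>lborel) \<le> (\<integral>z. \<bar>g z\<bar> + \<bar>g (z - \<eta> ^ 4)\<bar> \<partial>lborel)"
    using f1 g(1) ig' by (intro integral_mono) (auto simp: f_def)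
  also have "\<dots> \<le> 4"
    using g ig' eg' by simp
  finally have f2: "(\<integral>z. \<bar>f z\<bar> \<partial>lborel) \<le> 4" .
  have s1: "sqrt (\<eta> ^ 4) = \<eta>\<^sup>2"
    using \<eta> by (intro real_sqrt_unique) (auto simp: power_mult[symmetric])
  have s2: "sqrt (\<theta> ^ 8) = \<theta> ^ 4"
    using \<theta> by (intro real_sqrt_unique) (auto simp: power_mult[symmetric])
  have s3: "r powr (1 / 4) \<le> \<theta>\<^sup>2" if "0 \<le> r" "r \<le> \<theta> ^ 8" for r
  proof -
    have "r powr (1 / 4) \<le> (\<theta> ^ 8) powr (1 / 4)"
      using that by (intro powr_mono2) auto
    also have "\<dots> = \<theta>\<^sup>2"
      using \<theta> powr_powr[of \<theta> 8 "1 / 4"] by simp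
    finally show ?thesis .
  qed
  \<comment> \<open>The relative size \<open>2 * \<eta> / \<theta>\<close> of the increment is a
    fixed point with room to spare: a step yields
    \<open>16 * \<eta>\<^sup>2 * \<theta>\<^sup>2\<close>, half of what is allowed.\<close>
  have "(\<forall>r x. 0 \<le> r \<and> r \<le> \<theta> ^ 8 \<longrightarrow> \<bar>kac f n r x\<bar> \<le> c ^ n \<and>
      \<bar>kac f n r (x + \<eta> ^ 4) - kac f n r x\<bar> \<le> 2 * \<eta> / \<theta> * c ^ n)" for n
  proof (induction n)
    case 0
    then show ?case using \<eta> \<theta> by auto
  next
    case (Suc n)
    show ?case
    proof (intro allI impI, elim conjE)
      fix r x :: real assume r: "0 \<le> r" "r \<le> \<theta> ^ 8"
      have IH1: "\<bar>kac f n s z\<bar> \<le> c ^ n" if "0 \<le> s" "s \<le> r" for s z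
        using Suc that r by auto
      have IH2: "\<bar>kac f n s (z + \<eta> ^ 4) - kac f n s z\<bar> \<le> 2 * \<eta> / \<theta> * c ^ n" if "0 \<le> s" "s \<le> r" for s z
        using Suc that r by auto
      have r4: "sqrt r \<le> \<theta> ^ 4"
        using r s2 by (metis real_sqrt_le_mono)
      have "\<bar>kac f (Suc n) r x\<bar>
          \<le> 2 * (4 * sqrt (\<eta> ^ 4) * r powr (1 / 4) * c ^ n + 2 * sqrt r * (2 * \<eta> / \<theta> * c ^ n))"
        unfolding kac.simps
        by (subst f_def, rule kac_step_difference_abs_le[OF assms(1) measurable_kac g IH1 IH2])
          (use r \<eta> \<theta> c in auto)
      also have "\<dots> \<le> 2 * (4 * \<eta>\<^sup>2 * \<theta>\<^sup>2 * c ^ n + 2 * \<theta> ^ 4 * (2 * \<eta> / \<theta> * c ^ n))"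
        unfolding s1 using r4 s3[OF r] \<eta> \<theta> c
        by (intro mult_left_mono add_mono mult_right_mono) auto
      also have "\<dots> = (8 * \<eta> * (\<eta> * \<theta>\<^sup>2) + 8 * \<eta> * \<theta> ^ 3) * c ^ n"
        using \<theta> by (simp add: field_simps power_numeral_reduce)
      also have "\<dots> \<le> c * c ^ n"
      proof (rule mult_right_mono)
        have "\<eta> * \<theta>\<^sup>2 \<le> \<theta> * \<theta>\<^sup>2"
          using \<eta> by (intro mult_right_mono) auto
        then have "8 * \<eta> * (\<eta> * \<theta>\<^sup>2) \<le> 8 * \<eta> * (\<theta> * \<theta>\<^sup>2)"
          using \<eta> by (intro mult_left_mono) auto
        then show "8 * \<eta> * (\<eta> * \<theta>\<^sup>2) + 8 * \<eta> * \<theta> ^ 3 \<le> c"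
          by (simp add: c_def power_numeral_reduce)
      qed (use c in auto)
      finally have 1: "\<bar>kac f (Suc n) r x\<bar> \<le> c ^ Suc n" by simp
      have "\<bar>kac f (Suc n) r (x + \<eta> ^ 4) - kac f (Suc n) r x\<bar>
          \<le> 4 * 4 * sqrt (\<eta> ^ 4) * r powr (1 / 4) * c ^ n"
        unfolding kac.simps
        by (rule kac_step_shift_abs_le[OF _ measurable_kac f1 f2 IH1])
          (use r \<eta> \<theta> c in auto)
      also have "\<dots> \<le> 16 * \<eta>\<^sup>2 * \<theta>\<^sup>2 * c ^ n"
        unfolding s1 using s3[OF r] \<eta> \<theta> c by (intro mult_right_mono) (auto intro: mult_left_mono)
      also have "\<dots> \<le> 2 * \<eta> / \<theta> * c ^ Suc n"
        using \<theta> \<eta> c by (simp add: c_def field_simps power_numeral_reduce)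
      finally show "\<bar>kac f (Suc n) r x\<bar> \<le> c ^ Suc n \<and>
          \<bar>kac f (Suc n) r (x + \<eta> ^ 4) - kac f (Suc n) r x\<bar> \<le> 2 * \<eta> / \<theta> * c ^ Suc n"
        using 1 by blast
    qed
  qed
  then show ?thesis
    using r unfolding f_def[symmetric] c_def[symmetric] by auto
qed

section \<open>The Markov property and the moments of additive functionals\<close>

text \<open>Freezing an independent variable: the product form of the joint law turns the
  expectation into an iterated one, and both integrals are pulled back to \<open>M\<close>.\<close>

lemma (in prob_space) indep_var_integral:
  fixes g :: "_ \<Rightarrow> real"
  assumes ind: "indep_var S X T Y" and [measurable]: "g \<in> borel_measurable (S \<Otimes>\<^sub>M T)"
    and g: "\<And>p. \<bar>g p\<bar> \<le> K"
  shows "(\<integral>\<omega>. g (X \<omega>, Y \<omega>) \<partial>M) = (\<integral>\<omega>. (\<integral>\<omega>'. g (X \<omega>, Y \<omega>') \<partial>M) \<partial>M)"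
proof -
  have [measurable]: "X \<in> measurable M S" "Y \<in> measurable M T"
    and d: "distr M S X \<Otimes>\<^sub>M distr M T Y = distr M (S \<Otimes>\<^sub>M T) (\<lambda>x. (X x, Y x))"
    using ind unfolding indep_var_distribution_eq by auto
  interpret X: prob_space "distr M S X" by (rule prob_space_distr) simp
  interpret Y: prob_space "distr M T Y" by (rule prob_space_distr) simp
  interpret pair_prob_space "distr M S X" "distr M T Y" ..
  have "(\<integral>\<omega>. g (X \<omega>, Y \<omega>) \<partial>M) = (\<integral>p. g p \<partial>(distr M S X \<Otimes>\<^sub>M distr M T Y))"
    unfolding d by (subst integral_distr) simp_all
  also have "\<dots> = (\<integral>x. (\<integral>y. g (x, y) \<partial>distr M T Y) \<partial>distr M S X)"
    by (subst integral_fst') (auto intro!: P.integrable_const_bound[of _ K] simp: g)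
  also have "\<dots> = (\<integral>\<omega>. (\<integral>y. g (X \<omega>, y) \<partial>distr M T Y) \<partial>M)"
    by (subst integral_distr) simp_all
  also have "\<dots> = (\<integral>\<omega>. (\<integral>\<omega>'. g (X \<omega>, Y \<omega>') \<partial>M) \<partial>M)"
    by (intro Bochner_Integration.integral_cong refl) (subst integral_distr; simp)
  finally show ?thesis .
qed

lemma (in prob_space) integral_time_swap:
  fixes \<psi> :: "real \<Rightarrow> 'a \<Rightarrow> real"
  assumes [measurable]: "case_prod \<psi> \<in> borel_measurable (borel \<Otimes>\<^sub>M M)"
    and K: "\<And>u \<omega>. a < u \<Longrightarrow> u < b \<Longrightarrow> \<bar>\<psi> u \<omega>\<bar> \<le> K"
  shows "(\<integral>\<omega>. (\<integral>u. indicator {a<..<b} u * \<psi> u \<omega> \<partial>lborel) \<partial>M)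
    = (\<integral>u. indicator {a<..<b} u * (\<integral>\<omega>. \<psi> u \<omega> \<partial>M) \<partial>lborel)"
proof -
  interpret pair_sigma_finite lborel M ..
  have [measurable (raw)]: "(\<lambda>w. \<psi> (a w) (b w)) \<in> borel_measurable N"
    if "a \<in> borel_measurable N" "b \<in> measurable N M" for N :: "'b measure" and a b
    using measurable_compose[OF measurable_Pair[OF that] assms(1)] by simp
  have m: "(\<lambda>(u, \<omega>). indicator {a<..<b} u * \<psi> u \<omega>) \<in> borel_measurable (lborel \<Otimes>\<^sub>M M)"
    by measurable
  have i: "integrable lborel (\<lambda>u. indicator {a<..<b} u * K)"
    by (intro integrable_mult_left integrable_real_indicator emeasure_bounded_finite) auto
  have "integrable (lborel \<Otimes>\<^sub>M M) (\<lambda>(u, \<omega>). indicator {a<..<b} u * K)"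
    using integrable_abs[OF i] by (intro Fubini_integrable) (auto simp: prob_space)
  then have "integrable (lborel \<Otimes>\<^sub>M M) (\<lambda>(u, \<omega>). indicator {a<..<b} u * \<psi> u \<omega>)"
  proof (rule Bochner_Integration.integrable_bound[OF _ m], intro AE_I2)
    fix p
    show "norm (case p of (u, \<omega>) \<Rightarrow> indicator {a<..<b} u * \<psi> u \<omega>)
        \<le> norm (case p of (u, \<omega>) \<Rightarrow> indicator {a<..<b} u * K)"
      using K[of "fst p" "snd p"] by (auto simp: indicator_def split: prod.split)
  qed
  from Fubini_integral[OF this] show ?thesis by simp
qed

text \<open>Connects the gauge integral, for which the fundamental theorem of calculus is applied,
  with the Lebesgue integral, for which Fubini is applied. The open interval keeps the kernel at
  strictly positive times.\<close>

lemma integral_Icc_eq_lborel: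
  fixes h :: "real \<Rightarrow> real"
  assumes "continuous_on {a..b} h"
  shows "integral {a..b} h = (\<integral>u. indicator {a<..<b} u * h u \<partial>lborel)"
proof -
  have "integral {a..b} h = (LINT u:{a..b}|lborel. h u)"
    using assms by (intro set_borel_integral_eq_integral(2)[symmetric] borel_integrable_atLeastAtMost')
  also have "\<dots> = (\<integral>u. indicator {a<..<b} u * h u \<partial>lborel)"
    unfolding set_lebesgue_integral_def
  proof (rule integral_cong_AE)
    have "(\<lambda>u. indicator {a..b} u *\<^sub>R h u) \<in> borel_measurable borel"
      using borel_measurable_continuous_on_indicator[OF _ assms] by simp
    then show m: "(\<lambda>u. indicator {a..b} u *\<^sub>R h u) \<in> borel_measurable lborel"
      by simp
    have "(\<lambda>u. indicator {a<..<b} u *\<^sub>R h u) \<in> borel_measurable borel"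
      by (intro borel_measurable_continuous_on_indicator continuous_on_subset[OF assms]) auto
    then show "(\<lambda>u. indicator {a<..<b} u * h u) \<in> borel_measurable lborel"
      by simp
    show "AE u in lborel. indicator {a..b} u *\<^sub>R h u = indicator {a<..<b} u * h u"
      using AE_lborel_singleton[of a] AE_lborel_singleton[of b]
      by eventually_elim (auto simp: indicator_def)
  qed
  finally show ?thesis .
qed

text \<open>The lower limit is the variable: \<open>u \<mapsto> \<phi> (integral {u..b} h)\<close>
  has derivative \<open>- h u * \<phi>' (integral {u..b} h)\<close>. Powers give the moment
  recursion, an exponential gives the Laplace transform estimate.\<close>

lemma integral_chain_rule:
  fixes h \<phi> :: "real \<Rightarrow> real"
  assumes "a \<le> b" "continuous_on {a..b} h" "\<And>x. (\<phi> has_real_derivative \<phi>' x) (at x)"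
  shows "integral {a..b} (\<lambda>u. h u * \<phi>' (integral {u..b} h)) = \<phi> (integral {a..b} h) - \<phi> 0"
proof -
  have "((\<lambda>u. h u * \<phi>' (integral {u..b} h)) has_integral (- \<phi> (integral {b..b} h) - (- \<phi> (integral {a..b} h)))) {a..b}"
  proof (rule fundamental_theorem_of_calculus[OF assms(1)])
    fix x assume x: "x \<in> {a..b}"
    have "((\<lambda>u. - \<phi> (integral {u..b} h)) has_real_derivative - (\<phi>' (integral {x..b} h) * - h x)) (at x within {a..b})"
      by (intro DERIV_minus DERIV_chain2[OF assms(3) integral_has_real_derivative'[OF assms(2) x]])
    then show "((\<lambda>u. - \<phi> (integral {u..b} h)) has_vector_derivative h x * \<phi>' (integral {x..b} h)) (at x within {a..b})"
      by (simp add: has_real_derivative_iff_has_vector_derivative mult.commute)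
  qed
  then show ?thesis
    by (simp add: integral_unique)
qed

text \<open>Continuity and the starting point hold for every \<open>\<omega>\<close>, so path
  integrals and joint measurability need no exceptional set; \<open>B\<close> is kept because
  independence and normality are assumed for it.\<close>

locale continuous_brownian_motion = standard_brownian_motion M B
  for M :: "'w measure" and B :: "real \<Rightarrow> 'w \<Rightarrow> real" +
  fixes C :: "real \<Rightarrow> 'w \<Rightarrow> real"
  assumes C_eq: "AE \<omega> in M. \<forall>t\<ge>0. C t \<omega> = B t \<omega>"
    and measurable_C: "C t \<in> borel_measurable M"
    and continuous_C: "continuous_on UNIV (\<lambda>t. C t \<omega>)"
    and C_0: "C 0 \<omega> = 0"

lemma (in standard_brownian_motion) continuous_version:
  obtains C where "continuous_brownian_motion M B C"
proof -
  obtain N where N: "{\<omega> \<in> space M. \<not> (B 0 \<omega> = 0 \<and> continuous_on {0..} (\<lambda>t. B t \<omega>))} \<subseteq> N"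
    "N \<in> sets M" "emeasure M N = 0"
    using AE_conjI[OF start_at_0 continuous_paths] by (rule AE_E)
  \<comment> \<open>Paths in the null set are replaced by the zero path, and \<open>max 0 t\<close>
    extends the remaining ones continuously to negative times.\<close>
  define C where "C = (\<lambda>t \<omega>. if \<omega> \<in> space M - N then B (max 0 t) \<omega> else 0)"
  have "AE \<omega> in M. \<omega> \<notin> N"
    using N by (intro AE_not_in) (auto simp: null_sets_def)
  then have 1: "AE \<omega> in M. \<forall>t\<ge>0. C t \<omega> = B t \<omega>"
    using AE_space by eventually_elim (auto simp: C_def)
  have 2: "C t \<in> borel_measurable M" for t
    unfolding C_def using N(2) measurable_B[of "max 0 t"] by (intro measurable_If_set) auto
  have 3: "continuous_on UNIV (\<lambda>t. C t \<omega>)" for \<omega>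
  proof (cases "\<omega> \<in> space M - N")
    case True
    then have "continuous_on {0..} (\<lambda>t. B t \<omega>)" using N(1) by auto
    then have "continuous_on UNIV (\<lambda>t. B (max 0 t) \<omega>)"
      by (rule continuous_on_compose2) (auto intro!: continuous_intros)
    then show ?thesis using True by (simp add: C_def)
  next
    case False
    then show ?thesis unfolding C_def if_not_P[OF False] by simp
  qed
  have 4: "C 0 \<omega> = 0" for \<omega>
    using N(1) by (auto simp: C_def)
  show ?thesis
    by (rule that, unfold_locales) (fact 1 2 3 4)+
qed

section \<open>Joint measurability and the Markov property\<close>

context continuous_brownian_motion
begin

text \<open>Sampling the path at \<open>\<lfloor>real (Suc n) * t\<rfloor> / real (Suc n)\<close>
  involves only countably many times, so the sampled process is jointly measurable; continuity
  carries this to the limit.\<close>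

lemma measurable_C_joint: "(\<lambda>(t, \<omega>). C t \<omega>) \<in> borel_measurable (borel \<Otimes>\<^sub>M M)"
proof (rule borel_measurable_LIMSEQ_real)
  fix p :: "real \<times> 'w"
  obtain t \<omega> where p: "p = (t, \<omega>)" by force
  have "(\<lambda>n. real_of_int \<lfloor>real (Suc n) * t\<rfloor> / real (Suc n)) \<longlonglongrightarrow> t"
  proof (rule LIMSEQ_I)
    fix e :: real assume "0 < e"
    then obtain n0 where n0: "1 / real (Suc n0) < e"
      using nat_approx_posE by metis
    have "norm (real_of_int \<lfloor>real (Suc n) * t\<rfloor> / real (Suc n) - t) < e" if "n \<ge> n0" for n
    proof -
      have "\<bar>real_of_int \<lfloor>real (Suc n) * t\<rfloor> - real (Suc n) * t\<bar> \<le> 1" by linarith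
      then have "\<bar>real_of_int \<lfloor>real (Suc n) * t\<rfloor> - real (Suc n) * t\<bar> / real (Suc n) \<le> 1 / real (Suc n)"
        by (intro divide_right_mono) auto
      also have "\<dots> \<le> 1 / real (Suc n0)" using that by (intro divide_left_mono) auto
      finally show ?thesis
        using n0 abs_divide[of "real_of_int \<lfloor>real (Suc n) * t\<rfloor> - real (Suc n) * t" "real (Suc n)"]
        by (simp add: diff_divide_distrib del: of_nat_Suc)
    qed
    then show "\<exists>n0. \<forall>n\<ge>n0. norm (real_of_int \<lfloor>real (Suc n) * t\<rfloor> / real (Suc n) - t) < e" by blast
  qed
  moreover have "isCont (\<lambda>t. C t \<omega>) t"
    using continuous_C by (simp add: continuous_on_eq_continuous_at)
  ultimately show "(\<lambda>n. case p of (t, \<omega>) \<Rightarrow> C (real_of_int \<lfloor>real (Suc n) * t\<rfloor> / real (Suc n)) \<omega>) \<longlonglongrightarrow> (case p of (t, \<omega>) \<Rightarrow> C t \<omega>)"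
    unfolding p by (auto intro: isCont_tendsto_compose[of t "\<lambda>t. C t \<omega>"])
next
  fix n :: nat
  note measurable_C [measurable]
  show "(\<lambda>(t, \<omega>). C (real_of_int \<lfloor>real (Suc n) * t\<rfloor> / real (Suc n)) \<omega>) \<in> borel_measurable (borel \<Otimes>\<^sub>M M)"
    unfolding case_prod_beta
    by (rule measurable_compose_countable[of "\<lambda>i p. C (real_of_int i / real (Suc n)) (snd p)" _ _ "\<lambda>p. \<lfloor>real (Suc n) * fst p\<rfloor>"])
      measurable
qed

lemma measurable_C' [measurable (raw)]:
  "a \<in> borel_measurable N \<Longrightarrow> X \<in> measurable N M \<Longrightarrow> (\<lambda>w. C (a w) (X w)) \<in> borel_measurable N"
  using measurable_compose[OF measurable_Pair measurable_C_joint] by simp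

text \<open>Functions of finitely many increments suffice for iterating the Markov property, so no filtration is needed.\<close>

definition past :: "real \<Rightarrow> ('w \<Rightarrow> real) \<Rightarrow> bool" where
  "past s \<Phi> \<longleftrightarrow> \<Phi> \<in> borel_measurable M \<and> (\<exists>\<tau> m F K. (\<forall>\<omega>. \<bar>\<Phi> \<omega>\<bar> \<le> K) \<and> (\<forall>x. \<bar>F x\<bar> \<le> K) \<and>
    \<tau> 0 = 0 \<and> (\<forall>i<m. \<tau> i \<le> \<tau> (Suc i)) \<and> \<tau> m = s \<and>
    F \<in> borel_measurable (Pi\<^sub>M {..<m} (\<lambda>_. borel)) \<and>
    (AE \<omega> in M. \<Phi> \<omega> = F (\<lambda>i\<in>{..<m}. B (\<tau> (Suc i)) \<omega> - B (\<tau> i) \<omega>)))"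

lemma past_1: "past 0 (\<lambda>_. 1)"
  unfolding past_def
  by (intro conjI exI[of _ "\<lambda>_. 0"] exI[of _ "0::nat"] exI[of _ "\<lambda>_. 1"] exI[of _ "1::real"]) auto

lemma past_measurable: "past s \<Phi> \<Longrightarrow> \<Phi> \<in> borel_measurable M"
  by (auto simp: past_def)

lemma past_bounded: "past s \<Phi> \<Longrightarrow> \<exists>K. \<forall>\<omega>. \<bar>\<Phi> \<omega>\<bar> \<le> K"
  by (auto simp: past_def)

lemma pastE:
  assumes "past s \<Phi>"
  obtains \<tau> m F K where "\<And>\<omega>. \<bar>\<Phi> \<omega>\<bar> \<le> K" "\<And>x. \<bar>F x\<bar> \<le> K"
    "\<tau> 0 = 0" "\<And>i. i < m \<Longrightarrow> \<tau> i \<le> \<tau> (Suc i)" "\<tau> m = s"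
    "F \<in> borel_measurable (Pi\<^sub>M {..<m} (\<lambda>_. borel))"
    "AE \<omega> in M. \<Phi> \<omega> = F (\<lambda>i\<in>{..<m}. B (\<tau> (Suc i)) \<omega> - B (\<tau> i) \<omega>)"
    "\<And>i. i \<le> m \<Longrightarrow> 0 \<le> \<tau> i"
proof -
  obtain \<tau> m F K where K: "\<And>\<omega>. \<bar>\<Phi> \<omega>\<bar> \<le> K" "\<And>x. \<bar>F x\<bar> \<le> K"
    and \<tau>: "\<tau> 0 = 0" "\<And>i. i < m \<Longrightarrow> \<tau> i \<le> \<tau> (Suc i)" "\<tau> m = s"
    and F: "F \<in> borel_measurable (Pi\<^sub>M {..<m} (\<lambda>_. borel))"
    and e: "AE \<omega> in M. \<Phi> \<omega> = F (\<lambda>i\<in>{..<m}. B (\<tau> (Suc i)) \<omega> - B (\<tau> i) \<omega>)"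
    using assms unfolding past_def by blast
  have "0 \<le> \<tau> i" if "i \<le> m" for i
    using that
  proof (induction i)
    case (Suc i)
    then show ?case using \<tau>(2)[of i] by simp
  qed (simp add: \<tau>(1))
  with K \<tau> F e show ?thesis by (rule that)
qed

text \<open>The operation that the moment recursion performs on the past: one more observation at a
  later time. Since \<open>C u\<close> is the sum of all increments up to \<open>u\<close>, it
  suffices to append \<open>u\<close> to the grid.\<close>

lemma past_mult:
  assumes \<Phi>: "past s \<Phi>" and "s \<le> u" and [measurable]: "f \<in> borel_measurable borel" and f: "\<And>x. \<bar>f x\<bar> \<le> L"
  shows "past u (\<lambda>\<omega>. \<Phi> \<omega> * f (C u \<omega>))"
proof -
  obtain \<tau> m F K where K: "\<And>\<omega>. \<bar>\<Phi> \<omega>\<bar> \<le> K" "\<And>x. \<bar>F x\<bar> \<le> K"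
    and \<tau>: "\<tau> 0 = 0" "\<And>i. i < m \<Longrightarrow> \<tau> i \<le> \<tau> (Suc i)" "\<tau> m = s"
    and F [measurable]: "F \<in> borel_measurable (Pi\<^sub>M {..<m} (\<lambda>_. borel))"
    and e: "AE \<omega> in M. \<Phi> \<omega> = F (\<lambda>i\<in>{..<m}. B (\<tau> (Suc i)) \<omega> - B (\<tau> i) \<omega>)"
    and \<tau>0: "\<And>i. i \<le> m \<Longrightarrow> 0 \<le> \<tau> i"
    using \<Phi> by (rule pastE) blast
  note past_measurable[OF \<Phi>, measurable]
  have s: "0 \<le> s" using \<tau>0[of m] \<tau>(3) by simp
  have L: "0 \<le> L" "0 \<le> K" using f[of 0] K(2)[of undefined] by auto
  define \<tau>' where "\<tau>' = (\<lambda>i. if i \<le> m then \<tau> i else u)"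
  define F' where "F' = (\<lambda>x. F (restrict x {..<m}) * f (\<Sum>i<Suc m. x i))"
  have F' [measurable]: "F' \<in> borel_measurable (Pi\<^sub>M {..<Suc m} (\<lambda>_. borel))"
    unfolding F'_def by measurable
  have ae: "AE \<omega> in M. \<Phi> \<omega> * f (C u \<omega>) = F' (\<lambda>i\<in>{..<Suc m}. B (\<tau>' (Suc i)) \<omega> - B (\<tau>' i) \<omega>)"
    using e start_at_0 C_eq
  proof eventually_elim
    case (elim \<omega>)
    have 1: "restrict (\<lambda>i\<in>{..<Suc m}. B (\<tau>' (Suc i)) \<omega> - B (\<tau>' i) \<omega>) {..<m}
        = (\<lambda>i\<in>{..<m}. B (\<tau> (Suc i)) \<omega> - B (\<tau> i) \<omega>)"
      by (auto simp: restrict_def \<tau>'_def fun_eq_iff)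
    have "(\<Sum>i<Suc m. (\<lambda>i\<in>{..<Suc m}. B (\<tau>' (Suc i)) \<omega> - B (\<tau>' i) \<omega>) i)
        = (\<Sum>i<Suc m. B (\<tau>' (Suc i)) \<omega> - B (\<tau>' i) \<omega>)"
      by (intro sum.cong) auto
    also have "\<dots> = B (\<tau>' (Suc m)) \<omega> - B (\<tau>' 0) \<omega>"
      by (rule sum_lessThan_telescope)
    also have "\<dots> = C u \<omega>"
      using elim s \<open>s \<le> u\<close> \<tau> by (simp add: \<tau>'_def)
    finally show ?case
      unfolding F'_def 1 using elim(1) by simp
  qed
  show ?thesis
    unfolding past_def
  proof (intro conjI exI)
    show "\<forall>\<omega>. \<bar>\<Phi> \<omega> * f (C u \<omega>)\<bar> \<le> K * L"
      using K f L by (auto simp: abs_mult intro!: mult_mono)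
    show "\<forall>x. \<bar>F' x\<bar> \<le> K * L"
      unfolding F'_def using K f L by (auto simp: abs_mult intro!: mult_mono)
    show "\<tau>' 0 = 0" "\<tau>' (Suc m) = u" "\<forall>i<Suc m. \<tau>' i \<le> \<tau>' (Suc i)"
      using \<tau> \<open>s \<le> u\<close> by (auto simp: \<tau>'_def le_less_Suc_eq less_Suc_eq)
    show "F' \<in> borel_measurable (Pi\<^sub>M {..<Suc m} (\<lambda>_. borel))" by (fact F')
    show "AE \<omega> in M. \<Phi> \<omega> * f (C u \<omega>) = F' (\<lambda>i\<in>{..<Suc m}. B (\<tau>' (Suc i)) \<omega> - B (\<tau>' i) \<omega>)" by (fact ae)
  qed measurable
qed

text \<open>With \<open>u\<close> appended to the grid, the last increment is independent of the
  earlier ones and normal, while \<open>\<Phi>\<close> and \<open>C s\<close> are almost surely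
  functions of the earlier ones. Freezing those leaves an integral against the heat kernel centred
  at \<open>C s\<close>.\<close>

lemma markov:
  assumes \<Phi>: "past s \<Phi>" and "s < u" and [measurable]: "G \<in> borel_measurable borel" and G: "\<And>x. \<bar>G x\<bar> \<le> L"
  shows "(\<integral>\<omega>. \<Phi> \<omega> * G (C u \<omega>) \<partial>M)
    = (\<integral>\<omega>. \<Phi> \<omega> * (\<integral>z. heat (u - s) (z - C s \<omega>) * G z \<partial>lborel) \<partial>M)"
proof -
  obtain \<tau> m F K where K: "\<And>\<omega>. \<bar>\<Phi> \<omega>\<bar> \<le> K" "\<And>x. \<bar>F x\<bar> \<le> K"
    and \<tau>: "\<tau> 0 = 0" "\<And>i. i < m \<Longrightarrow> \<tau> i \<le> \<tau> (Suc i)" "\<tau> m = s"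
    and F [measurable]: "F \<in> borel_measurable (Pi\<^sub>M {..<m} (\<lambda>_. borel))"
    and e: "AE \<omega> in M. \<Phi> \<omega> = F (\<lambda>i\<in>{..<m}. B (\<tau> (Suc i)) \<omega> - B (\<tau> i) \<omega>)"
    and \<tau>0: "\<And>i. i \<le> m \<Longrightarrow> 0 \<le> \<tau> i"
    using \<Phi> by (rule pastE) blast
  note past_measurable[OF \<Phi>, measurable]
  have s: "0 \<le> s" using \<tau>0[of m] \<tau>(3) by simp
  have L: "0 \<le> L" "0 \<le> K" using G[of 0] K(2)[of undefined] by auto
  define \<tau>' where "\<tau>' = (\<lambda>i. if i \<le> m then \<tau> i else u)"
  define X where "X = (\<lambda>\<omega>. \<lambda>i\<in>{..<m}. B (\<tau>' (Suc i)) \<omega> - B (\<tau>' i) \<omega>)"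
  define Y where "Y = (\<lambda>\<omega>. B u \<omega> - B s \<omega>)"
  \<comment> \<open>Independence is available for restricted families of increments, so the last
    increment first appears as a function on the one-point index set \<open>{m}\<close>.\<close>
  let ?Y = "\<lambda>\<omega>. \<lambda>i\<in>{m}. B (\<tau>' (Suc i)) \<omega> - B (\<tau>' i) \<omega>"
  let ?S = "\<lambda>\<omega>. \<Sum>i<m. X \<omega> i"
  have X: "X = (\<lambda>\<omega>. \<lambda>i\<in>{..<m}. B (\<tau> (Suc i)) \<omega> - B (\<tau> i) \<omega>)"
    by (auto simp: X_def \<tau>'_def fun_eq_iff)
  have "indep_vars (\<lambda>_. borel) (\<lambda>i \<omega>. B (\<tau>' (Suc i)) \<omega> - B (\<tau>' i) \<omega>) {..<Suc m}"
    using \<tau> \<open>s < u\<close> by (intro indep_increments) (auto simp: \<tau>'_def le_less_Suc_eq less_Suc_eq)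
  then have ind: "indep_var (Pi\<^sub>M {..<m} (\<lambda>_. borel)) X (Pi\<^sub>M {m} (\<lambda>_. borel))
      ?Y"
    unfolding X_def by (rule indep_var_restrict) auto
  have Y: "?Y \<omega> m = Y \<omega>" for \<omega>
    using \<tau>(3) by (simp add: Y_def \<tau>'_def)
  have sumX: "AE \<omega> in M. ?S \<omega> = C s \<omega> \<and> ?S \<omega> + Y \<omega> = C u \<omega> \<and> F (X \<omega>) = \<Phi> \<omega>"
    using e start_at_0 C_eq
  proof eventually_elim
    case (elim \<omega>)
    have "?S \<omega> = (\<Sum>i<m. B (\<tau> (Suc i)) \<omega> - B (\<tau> i) \<omega>)"
      unfolding X by (intro sum.cong) auto
    also have "\<dots> = B (\<tau> m) \<omega> - B (\<tau> 0) \<omega>"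
      by (rule sum_lessThan_telescope)
    finally show ?case
      using elim s \<open>s < u\<close> \<tau> by (simp add: Y_def X)
  qed
  have [measurable]: "X \<in> measurable M (Pi\<^sub>M {..<m} (\<lambda>_. borel))"
    using ind unfolding indep_var_distribution_eq by auto
  have [measurable]: "Y \<in> borel_measurable M"
    unfolding Y_def using measurable_B[of s] measurable_B[of u] s \<open>s < u\<close> by simp
  have Ym: "distributed M lborel Y (\<lambda>x. ennreal (normal_density 0 (sqrt (u - s)) x))"
    unfolding Y_def using s \<open>s < u\<close> by (rule normal_increments)
  have inner: "(\<integral>\<omega>'. G (c + Y \<omega>') \<partial>M) = (\<integral>z. heat (u - s) (z - c) * G z \<partial>lborel)" for c
  proof -
    have "(\<integral>\<omega>'. G (c + Y \<omega>') \<partial>M) = (\<integral>y. normal_density 0 (sqrt (u - s)) y * G (c + y) \<partial>lborel)"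
      by (rule distributed_integral[OF Ym, symmetric]) auto
    also have "\<dots> = (\<integral>z. heat (u - s) (z - c) * G z \<partial>lborel)"
      using lborel_integral_real_affine[of 1 "\<lambda>z. heat (u - s) (z - c) * G z" c] by (simp add: heat_def)
    finally show ?thesis .
  qed
  have "(\<integral>\<omega>. \<Phi> \<omega> * G (C u \<omega>) \<partial>M) = (\<integral>\<omega>. F (X \<omega>) * G (?S \<omega> + Y \<omega>) \<partial>M)"
    by (rule integral_cong_AE, measurable) (use sumX in \<open>auto elim: eventually_mono\<close>)
  also have "\<dots> = (\<integral>\<omega>. (\<integral>\<omega>'. F (X \<omega>) * G (?S \<omega> + Y \<omega>') \<partial>M) \<partial>M)"
  proof -
    have "(\<lambda>p. F (fst p) * G ((\<Sum>i<m. fst p i) + snd p m))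
        \<in> borel_measurable (Pi\<^sub>M {..<m} (\<lambda>_. borel) \<Otimes>\<^sub>M Pi\<^sub>M {m} (\<lambda>_. borel))"
      by measurable
    moreover have "\<bar>F (fst p) * G ((\<Sum>i<m. fst p i) + snd p m)\<bar> \<le> K * L" for p
      using K G L by (auto simp: abs_mult intro!: mult_mono)
    ultimately show ?thesis
      using indep_var_integral[OF ind] unfolding Y[symmetric] by fastforce
  qed
  also have "\<dots> = (\<integral>\<omega>. F (X \<omega>) * (\<integral>z. heat (u - s) (z - ?S \<omega>) * G z \<partial>lborel) \<partial>M)"
    by (simp add: inner)
  also have "\<dots> = (\<integral>\<omega>. \<Phi> \<omega> * (\<integral>z. heat (u - s) (z - C s \<omega>) * G z \<partial>lborel) \<partial>M)"
    by (rule integral_cong_AE, measurable) (use sumX in \<open>auto elim: eventually_mono\<close>)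
  finally show ?thesis .
qed

end

lemma abs_integral_heat_le:
  assumes "0 < u" and [measurable]: "g \<in> borel_measurable borel" and g: "\<And>z. \<bar>g z\<bar> \<le> L"
  shows "\<bar>\<integral>z. heat u (z - x) * g z \<partial>lborel\<bar> \<le> L"
proof (rule abs_integral_le(1))
  show "has_bochner_integral lborel (\<lambda>z. L * heat u (z - x)) L"
    using integrable_heat[OF assms(1)] integral_heat[OF assms(1)]
    by (simp add: has_bochner_integral_iff)
  show "\<bar>heat u (z - x) * g z\<bar> \<le> L * heat u (z - x)" for z
    using mult_left_mono[OF g[of z] heat_nonneg[of u "z - x"]] by (simp add: abs_mult mult.commute)
qed measurable

section \<open>Moments of additive functionals\<close>

context continuous_brownian_motion
begin

definition occupation :: "(real \<Rightarrow> real) \<Rightarrow> real \<Rightarrow> real \<Rightarrow> 'w \<Rightarrow> real" where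
  "occupation f s t \<omega> = integral {s..t} (\<lambda>u. f (C u \<omega>))"

lemma continuous_f_C:
  assumes "continuous_on UNIV f"
  shows "continuous_on S (\<lambda>u. f (C u \<omega>))"
  by (rule continuous_on_compose2[OF assms continuous_on_subset[OF continuous_C]]) auto

lemma occupation_eq_lborel:
  "continuous_on UNIV f \<Longrightarrow> occupation f s t \<omega> = (\<integral>v. (if s < v \<and> v < t then f (C v \<omega>) else 0) \<partial>lborel)"
  unfolding occupation_def
  by (subst integral_Icc_eq_lborel[OF continuous_f_C]) (auto simp: indicator_def intro!: Bochner_Integration.integral_cong)

lemma measurable_occupation [measurable (raw)]:
  assumes f: "continuous_on UNIV f"
    and [measurable]: "a \<in> borel_measurable N" "b \<in> borel_measurable N" "X \<in> measurable N M"
  shows "(\<lambda>w. occupation f (a w) (b w) (X w)) \<in> borel_measurable N"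
proof -
  have [measurable]: "f \<in> borel_measurable borel"
    by (rule borel_measurable_continuous_onI[OF f])
  show ?thesis
    unfolding occupation_eq_lborel[OF f] by measurable
qed

lemma occupation_abs_le:
  assumes "continuous_on UNIV f" "\<And>x. \<bar>f x\<bar> \<le> L" "s \<le> t"
  shows "\<bar>occupation f s t \<omega>\<bar> \<le> L * (t - s)"
  using integral_bound[OF assms(3) continuous_f_C[OF assms(1)], of \<omega> L] assms(2)
  by (simp add: occupation_def)

text \<open>Induction on \<open>n\<close> by separating the earliest time:
  \<open>occupation f s t \<omega> ^ Suc n\<close> is \<open>Suc n\<close> times the integral over
  \<open>u\<close> of \<open>f (C u \<omega>) * occupation f u t \<omega> ^ n\<close>. The factor
  \<open>f (C u \<omega>)\<close> is absorbed into the past up to \<open>u\<close>, which is why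
  \<open>s\<close> and \<open>\<Phi>\<close> vary in the induction; \<open>markov\<close> then
  returns from time \<open>u\<close> to time \<open>s\<close>.\<close>

lemma moment_formula:
  assumes f: "continuous_on UNIV f" "\<And>x. \<bar>f x\<bar> \<le> L" "integrable lborel f"
    and "past s \<Phi>" "s \<le> t"
  shows "(\<integral>\<omega>. \<Phi> \<omega> * occupation f s t \<omega> ^ n \<partial>M) = fact n * (\<integral>\<omega>. \<Phi> \<omega> * kac f n (t - s) (C s \<omega>) \<partial>M)"
  using assms(4,5)
proof (induction n arbitrary: s \<Phi>)
  case 0
  then show ?case by simp
next
  case (Suc n)
  note \<Phi> = \<open>past s \<Phi>\<close>
  note past_measurable[OF \<Phi>, measurable]
  obtain K where K: "\<And>\<omega>. \<bar>\<Phi> \<omega>\<bar> \<le> K" using past_bounded[OF \<Phi>] by blast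
  have [measurable]: "f \<in> borel_measurable borel"
    by (rule borel_measurable_continuous_onI[OF f(1)])
  let ?P = "\<lambda>u \<omega>. \<integral>z. heat (u - s) (z - C s \<omega>) * f z * kac f n (t - u) z \<partial>lborel"
  let ?Q = "\<lambda>u \<omega>. \<Phi> \<omega> * f (C u \<omega>) * occupation f u t \<omega> ^ n"
  have L: "0 \<le> L" "0 \<le> K" using f(2)[of 0] K[of undefined] by auto
  define G where "G = (\<integral>z. \<bar>f z\<bar> \<partial>lborel)"
  define H where "H = (2 * G * sqrt (t - s)) ^ n"
  have kacb: "\<bar>kac f n r x\<bar> \<le> H" if "0 \<le> r" "r \<le> t - s" for r x
    unfolding H_def by (rule kac_abs_le) (use f(3) that in \<open>auto simp: G_def\<close>)
  have G: "0 \<le> G" by (simp add: G_def)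
  have H: "0 \<le> H" unfolding H_def using Suc.prems(2) G by (intro zero_le_power) auto
  have kacG: "\<bar>f z * (if 0 \<le> r then kac f n r z else 0)\<bar> \<le> L * H" if "r \<le> t - s" for r z
    using f(2)[of z] kacb[of r z] that L H by (auto simp: abs_mult intro!: mult_mono)
  have occ: "\<bar>occupation f u t \<omega>\<bar> \<le> L * (t - s)" if "s < u" "u < t" for u \<omega>
    using occupation_abs_le[OF f(1,2), of u t \<omega>] mult_left_mono[of "t - u" "t - s" L] that L by auto
  have step: "occupation f s t \<omega> ^ Suc n
      = real (Suc n) * (\<integral>u. indicator {s<..<t} u * (f (C u \<omega>) * occupation f u t \<omega> ^ n) \<partial>lborel)" for \<omega>
  proof -
    have "((\<lambda>x. x ^ Suc n) has_real_derivative real (Suc n) * x ^ n) (at x)" for x :: real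
      using DERIV_pow[of "Suc n" x] by simp
    from integral_chain_rule[OF Suc.prems(2) continuous_f_C[OF f(1)] this, of \<omega>]
    have "occupation f s t \<omega> ^ Suc n = integral {s..t} (\<lambda>u. f (C u \<omega>) * (real (Suc n) * occupation f u t \<omega> ^ n))"
      by (simp add: occupation_def)
    also have "\<dots> = (\<integral>u. indicator {s<..<t} u * (f (C u \<omega>) * (real (Suc n) * occupation f u t \<omega> ^ n)) \<partial>lborel)"
    proof (rule integral_Icc_eq_lborel)
      have "continuous_on {s..t} (\<lambda>u. occupation f u t \<omega>)"
        unfolding occupation_def
        by (rule DERIV_continuous_on[OF integral_has_real_derivative'[OF continuous_f_C[OF f(1)]]])
      then show "continuous_on {s..t} (\<lambda>u. f (C u \<omega>) * (real (Suc n) * occupation f u t \<omega> ^ n))"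
        by (intro continuous_intros continuous_f_C[OF f(1)])
    qed
    also have "\<dots> = (\<integral>u. real (Suc n) * (indicator {s<..<t} u * (f (C u \<omega>) * occupation f u t \<omega> ^ n)) \<partial>lborel)"
      by (intro Bochner_Integration.integral_cong) (auto simp: mult_ac)
    finally show ?thesis by simp
  qed
  have e1: "(\<integral>\<omega>. \<Phi> \<omega> * occupation f s t \<omega> ^ Suc n \<partial>M)
      = real (Suc n) * (\<integral>\<omega>. (\<integral>u. indicator {s<..<t} u * (?Q u \<omega>) \<partial>lborel) \<partial>M)"
  proof -
    have "\<Phi> \<omega> * occupation f s t \<omega> ^ Suc n
        = real (Suc n) * (\<integral>u. indicator {s<..<t} u * (?Q u \<omega>) \<partial>lborel)" for \<omega>
    proof -
      have "(\<integral>u. indicator {s<..<t} u * (?Q u \<omega>) \<partial>lborel)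
          = (\<integral>u. \<Phi> \<omega> * (indicator {s<..<t} u * (f (C u \<omega>) * occupation f u t \<omega> ^ n)) \<partial>lborel)"
        by (intro Bochner_Integration.integral_cong) (auto simp: mult_ac)
      then show ?thesis unfolding step by simp
    qed
    then show ?thesis by simp
  qed
  have e2: "(\<integral>\<omega>. (\<integral>u. indicator {s<..<t} u * (?Q u \<omega>) \<partial>lborel) \<partial>M)
      = (\<integral>u. indicator {s<..<t} u * (\<integral>\<omega>. ?Q u \<omega> \<partial>M) \<partial>lborel)"
  proof (rule integral_time_swap)
    show "(\<lambda>(u, \<omega>). ?Q u \<omega>) \<in> borel_measurable (borel \<Otimes>\<^sub>M M)"
      using f(1) by measurable
    show "\<bar>?Q u \<omega>\<bar> \<le> K * L * (L * (t - s)) ^ n" if "s < u" "u < t" for u \<omega>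
      using K f(2) occ[OF that] L by (auto simp: abs_mult power_abs intro!: mult_mono power_mono)
  qed
  have e3: "(\<integral>\<omega>. ?Q u \<omega> \<partial>M)
      = fact n * (\<integral>\<omega>. \<Phi> \<omega> * ?P u \<omega> \<partial>M)"
    if u: "s < u" "u < t" for u
  proof -
    have "past u (\<lambda>\<omega>. \<Phi> \<omega> * f (C u \<omega>))"
      using u f(2) by (intro past_mult[OF \<Phi>]) auto
    from Suc.IH[OF this] u
    have "(\<integral>\<omega>. ?Q u \<omega> \<partial>M)
        = fact n * (\<integral>\<omega>. \<Phi> \<omega> * f (C u \<omega>) * kac f n (t - u) (C u \<omega>) \<partial>M)" by simp
    also have "(\<integral>\<omega>. \<Phi> \<omega> * f (C u \<omega>) * kac f n (t - u) (C u \<omega>) \<partial>M)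
        = (\<integral>\<omega>. \<Phi> \<omega> * (f (C u \<omega>) * kac f n (t - u) (C u \<omega>)) \<partial>M)"
      by (simp add: mult.assoc)
    also have "\<dots> = (\<integral>\<omega>. \<Phi> \<omega> * (\<integral>z. heat (u - s) (z - C s \<omega>) * (f z * kac f n (t - u) z) \<partial>lborel) \<partial>M)"
      by (rule markov[OF \<Phi> u(1), of _ "L * H"]) (measurable, use kacG[of "t - u"] u in simp)
    finally show ?thesis by (simp add: mult.assoc)
  qed
  have "(\<integral>u. indicator {s<..<t} u * (\<integral>\<omega>. ?Q u \<omega> \<partial>M) \<partial>lborel)
      = (\<integral>u. fact n * (indicator {s<..<t} u * (\<integral>\<omega>. \<Phi> \<omega> * ?P u \<omega> \<partial>M)) \<partial>lborel)"
    by (intro Bochner_Integration.integral_cong) (auto simp: indicator_def e3)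
  also have "\<dots> = fact n * (\<integral>u. indicator {s<..<t} u * (\<integral>\<omega>. \<Phi> \<omega> * ?P u \<omega> \<partial>M) \<partial>lborel)"
    by simp
  also have "(\<integral>u. indicator {s<..<t} u * (\<integral>\<omega>. \<Phi> \<omega> * ?P u \<omega> \<partial>M) \<partial>lborel)
      = (\<integral>\<omega>. (\<integral>u. indicator {s<..<t} u * (\<Phi> \<omega> * ?P u \<omega>) \<partial>lborel) \<partial>M)"
  proof (rule integral_time_swap[symmetric])
    show "(\<lambda>(u, \<omega>). \<Phi> \<omega> * ?P u \<omega>) \<in> borel_measurable (borel \<Otimes>\<^sub>M M)"
      by measurable
    show "\<bar>\<Phi> \<omega> * ?P u \<omega>\<bar> \<le> K * (L * H)" if "s < u" "u < t" for u \<omega>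
    proof -
      have "\<bar>\<integral>z. heat (u - s) (z - C s \<omega>) * (f z * kac f n (t - u) z) \<partial>lborel\<bar> \<le> L * H"
        using that kacG[of "t - u"] by (intro abs_integral_heat_le) auto
      then show ?thesis
        using K L unfolding abs_mult mult.assoc by (intro mult_mono) auto
    qed
  qed
  also have "\<dots> = (\<integral>\<omega>. \<Phi> \<omega> * kac f (Suc n) (t - s) (C s \<omega>) \<partial>M)"
  proof (rule Bochner_Integration.integral_cong[OF refl])
    fix \<omega>
    let ?J = "\<lambda>u. \<integral>z. heat (u - s) (z - C s \<omega>) * f z * kac f n (t - u) z \<partial>lborel"
    have "(\<integral>u. indicator {s<..<t} u * (\<Phi> \<omega> * ?J u) \<partial>lborel) = (\<integral>u. \<Phi> \<omega> * (indicator {s<..<t} u * ?J u) \<partial>lborel)"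
      by (intro Bochner_Integration.integral_cong) (auto simp: mult_ac)
    also have "\<dots> = \<Phi> \<omega> * (\<integral>u. indicator {s<..<t} u * ?J u \<partial>lborel)"
      by simp
    \<comment> \<open>Time elapsed since \<open>s\<close> replaces absolute time, as in
      \<open>kac_step\<close>.\<close>
    also have "(\<integral>u. indicator {s<..<t} u * ?J u \<partial>lborel)
        = (\<integral>u. indicator {s<..<t} (s + u) * ?J (s + u) \<partial>lborel)"
      using lborel_integral_real_affine[of 1 "\<lambda>u. indicator {s<..<t} u * ?J u" s] by simp
    also have "\<dots> = kac f (Suc n) (t - s) (C s \<omega>)"
      unfolding kac.simps kac_step_def
      by (intro Bochner_Integration.integral_cong) (auto simp: indicator_def diff_diff_eq)
    finally show "(\<integral>u. indicator {s<..<t} u * (\<Phi> \<omega> * ?J u) \<partial>lborel) = \<Phi> \<omega> * kac f (Suc n) (t - s) (C s \<omega>)" .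
  qed
  finally show ?case
    unfolding e1 e2 by (simp add: algebra_simps)
qed

end

section \<open>Occupation of dyadic tents\<close>

definition tent :: "nat \<Rightarrow> int \<Rightarrow> real \<Rightarrow> real" where
  "tent n k z = 2 ^ n * max 0 (1 - \<bar>2 ^ n * z - of_int k\<bar>)"

lemma continuous_tent: "continuous_on S (tent n k)"
  unfolding tent_def by (intro continuous_intros)

lemma measurable_tent [measurable]: "tent n k \<in> borel_measurable borel"
  by (rule borel_measurable_continuous_onI[OF continuous_tent])

lemma tent_nonneg [simp]: "0 \<le> tent n k z"
  by (simp add: tent_def)

lemma tent_le: "tent n k z \<le> 2 ^ n"
  by (simp add: tent_def)

lemma tent_Suc_int: "tent n (k + 1) z = tent n k (z - (1 / 2) ^ n)"
  by (simp add: tent_def algebra_simps power_divide)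

text \<open>The two-scale relation of hat functions. Tents of every level have the same integral, so
  the weights form an average; this links occupations of consecutive levels.\<close>

lemma tent_refine:
  "tent n k z = 1 / 4 * tent (Suc n) (2 * k - 1) z + 1 / 2 * tent (Suc n) (2 * k) z + 1 / 4 * tent (Suc n) (2 * k + 1) z"
proof -
  define y where "y = 2 ^ n * z - of_int k"
  have 1: "2 ^ Suc n * z - of_int (2 * k - 1) = 2 * y + 1" "2 ^ Suc n * z - of_int (2 * k) = 2 * y"
    "2 ^ Suc n * z - of_int (2 * k + 1) = 2 * y - 1"
    by (simp_all add: y_def algebra_simps)
  have 2: "max 0 (1 - \<bar>y\<bar>) = 1 / 2 * max 0 (1 - \<bar>2 * y + 1\<bar>) + max 0 (1 - \<bar>2 * y\<bar>) + 1 / 2 * max 0 (1 - \<bar>2 * y - 1\<bar>)"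
    unfolding max_def abs_if by (simp split: if_split) linarith?
  show ?thesis
    unfolding tent_def 1 y_def[symmetric] 2 by (simp add: algebra_simps)
qed

lemma has_bochner_integral_tent_bound:
  fixes k :: int
  shows "has_bochner_integral lborel
    (\<lambda>z. 2 ^ n * indicator {(real_of_int k - 1) / 2 ^ n..(real_of_int k + 1) / 2 ^ n} z) (2 :: real)"
proof -
  define S where "S = {(real_of_int k - 1) / 2 ^ n..(real_of_int k + 1) / 2 ^ n}"
  have S: "2 ^ n * measure lborel S = 2"
    unfolding S_def by (subst measure_lborel_Icc) (auto simp: field_simps)
  have "has_bochner_integral lborel (indicator S) (measure lborel S)"
    unfolding S_def by (rule has_bochner_integral_real_indicator) (auto simp: emeasure_lborel_Icc_eq)
  then have "has_bochner_integral lborel (\<lambda>z. 2 ^ n * indicator S z) (2 ^ n * measure lborel S)"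
    by (rule has_bochner_integral_mult_right)
  then show ?thesis
    unfolding S unfolding S_def .
qed

lemma tent_le_indicator:
  "\<bar>tent n k z\<bar> \<le> 2 ^ n * indicator {(real_of_int k - 1) / 2 ^ n..(real_of_int k + 1) / 2 ^ n} z"
proof (cases "\<bar>2 ^ n * z - of_int k\<bar> \<le> 1")
  case True
  then have "z \<in> {(real_of_int k - 1) / 2 ^ n..(real_of_int k + 1) / 2 ^ n}"
    by (auto simp: field_simps abs_le_iff)
  then show ?thesis using tent_le[of n k z] by simp
next
  case False
  then show ?thesis by (simp add: tent_def)
qed

text \<open>The rectangle around a tent has area 2 at every level, which makes all kernel estimates
  uniform in \<open>n\<close> and \<open>k\<close>.\<close>

lemma integrable_tent: "integrable lborel (tent n k)"
  and integral_tent_le: "(\<integral>z. \<bar>tent n k z\<bar> \<partial>lborel) \<le> 2"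
proof -
  show "integrable lborel (tent n k)"
    by (rule abs_integral_le(2)[OF has_bochner_integral_tent_bound _ tent_le_indicator]) simp
  show "(\<integral>z. \<bar>tent n k z\<bar> \<partial>lborel) \<le> 2"
    using abs_integral_le(1)[OF has_bochner_integral_tent_bound[of n k], of "\<lambda>z. \<bar>tent n k z\<bar>"] tent_le_indicator
    by simp
qed

definition tent_occupation :: "(real \<Rightarrow> real) \<Rightarrow> nat \<Rightarrow> int \<Rightarrow> real \<Rightarrow> real" where
  "tent_occupation c n k t = integral {0..t} (\<lambda>u. tent n k (c u))"

text \<open>
  The sixteenth moments of the increments at level \<open>n\<close> are of order \<open>16 ^ -n\<close>, so an increment
  exceeds \<open>tent_ratio ^ n\<close> with probability of order \<open>8 ^ -n\<close>; this beats the number \<open>4 ^ n\<close> of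
  grid points in space and time.
\<close>

definition tent_ratio :: real where
  "tent_ratio = root 16 (1 / 2)"

lemma tent_ratio: "0 < tent_ratio" "tent_ratio < 1" "tent_ratio ^ 16 = 1 / 2"
  by (simp_all add: tent_ratio_def)

lemma tent_ratio_power: "(tent_ratio ^ n) ^ 16 = (1 / 2) ^ n"
  using tent_ratio(3) by (metis mult.commute power_mult)

text \<open>\<open>fact 16\<close> stems from \<open>moment_formula\<close>, the power from
  \<open>kac_difference_abs_le\<close>. The parameter is an eighth root of the time horizon.\<close>

definition moment_constant :: "real \<Rightarrow> real" where
  "moment_constant \<theta> = fact 16 * (16 * \<theta> ^ 3) ^ 16"

section \<open>Moment and tail bounds for dyadic occupations\<close>

context continuous_brownian_motion
begin

abbreviation X :: "nat \<Rightarrow> int \<Rightarrow> real \<Rightarrow> 'w \<Rightarrow> real" where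
  "X n k t \<omega> \<equiv> tent_occupation (\<lambda>u. C u \<omega>) n k t"

lemma X_eq: "X n k t \<omega> = occupation (tent n k) 0 t \<omega>"
  by (simp add: tent_occupation_def occupation_def)

lemma measurable_X [measurable]: "X n k t \<in> borel_measurable M"
  unfolding X_eq[abs_def] using continuous_tent by measurable

lemma past_const: "0 \<le> s \<Longrightarrow> past s (\<lambda>_. 1)"
  using past_mult[OF past_1, of s "\<lambda>_. 1" 1] by simp

text \<open>Neighbouring tents are translates of each other by the mesh, so the difference of their
  occupations is the functional treated in \<open>kac_difference_abs_le\<close>.\<close>

lemma X_space_moment:
  assumes "1 \<le> \<theta>" "0 \<le> t" "t \<le> \<theta> ^ 8"
  shows "(\<integral>\<omega>. (X n k t \<omega> - X n (k + 1) t \<omega>) ^ 16 \<partial>M) \<le> moment_constant \<theta> * (1 / 16) ^ n"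
proof -
  define f where "f = (\<lambda>z. tent n k z - tent n (k + 1) z)"
  \<comment> \<open>With \<open>\<eta> = tent_ratio ^ (4 * n)\<close> the mesh is
    \<open>\<eta> ^ 4\<close>, and the bound carries
    \<open>\<eta> ^ 16 = (1 / 16) ^ n\<close>.\<close>
  have p: "(1 / 2 :: real) ^ n = (tent_ratio ^ (4 * n)) ^ 4"
    unfolding tent_ratio_power[symmetric] power_mult[symmetric] by (simp add: mult.commute)
  have f2: "f = (\<lambda>z. tent n k z - tent n k (z - (tent_ratio ^ (4 * n)) ^ 4))"
    by (simp add: f_def tent_Suc_int p[symmetric])
  have fb: "\<bar>f z\<bar> \<le> 2 ^ n" for z
    using tent_le[of n k z] tent_le[of n "k + 1" z] tent_nonneg[of n k z] tent_nonneg[of n "k + 1" z]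
    unfolding f_def by linarith
  have X: "X n k t \<omega> - X n (k + 1) t \<omega> = occupation f 0 t \<omega>" for \<omega>
    unfolding X_eq occupation_def f_def
    by (intro integral_diff[symmetric] integrable_continuous_interval continuous_f_C continuous_tent)
  have "(\<integral>\<omega>. (X n k t \<omega> - X n (k + 1) t \<omega>) ^ 16 \<partial>M) = fact 16 * (\<integral>\<omega>. kac f 16 t (C 0 \<omega>) \<partial>M)"
    unfolding X using moment_formula[where f = f and t = t and n = 16, OF _ fb _ past_1] assms(2) integrable_tent continuous_tent
    by (simp add: f_def continuous_on_diff)
  also have "(\<integral>\<omega>. kac f 16 t (C 0 \<omega>) \<partial>M) = kac f 16 t 0"
    by (simp add: C_0 prob_space)
  also have "\<dots> \<le> (16 * tent_ratio ^ (4 * n) * \<theta> ^ 3) ^ 16"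
    using kac_difference_abs_le[OF measurable_tent integrable_tent integral_tent_le assms(2,3), of "tent_ratio ^ (4 * n)" n k 16 0]
      tent_ratio assms(1) power_le_one[of tent_ratio "4 * n"]
    unfolding f2 by auto
  also have "\<dots> = (16 * \<theta> ^ 3) ^ 16 * (tent_ratio ^ (4 * n)) ^ 16"
    by (simp only: power_mult_distrib mult_ac)
  also have "(tent_ratio ^ (4 * n)) ^ 16 = (1 / 16) ^ n"
    unfolding tent_ratio_power unfolding power_mult by (simp add: power_divide)
  finally show ?thesis
    by (simp add: moment_constant_def mult.assoc)
qed

lemma X_time_moment:
  assumes "0 \<le> s" "s \<le> t"
  shows "(\<integral>\<omega>. (X n k t \<omega> - X n k s \<omega>) ^ 16 \<partial>M) \<le> moment_constant 1 * (t - s) ^ 8"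
proof -
  have X: "X n k t \<omega> - X n k s \<omega> = occupation (tent n k) s t \<omega>" for \<omega>
    unfolding X_eq occupation_def
    using Henstock_Kurzweil_Integration.integral_combine[OF assms, of "\<lambda>u. tent n k (C u \<omega>)"]
    by (simp add: integrable_continuous_interval continuous_f_C continuous_tent)
  have "(\<integral>\<omega>. (X n k t \<omega> - X n k s \<omega>) ^ 16 \<partial>M) = fact 16 * (\<integral>\<omega>. kac (tent n k) 16 (t - s) (C s \<omega>) \<partial>M)"
    unfolding X using moment_formula[where t = t and n = 16 and L = "2 ^ n", OF continuous_tent _ integrable_tent past_const, of n k s] assms
      tent_le[of n k] by simp
  also have "(\<integral>\<omega>. kac (tent n k) 16 (t - s) (C s \<omega>) \<partial>M) \<le> (2 * 2 * sqrt (t - s)) ^ 16"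
  proof -
    have b: "\<bar>kac (tent n k) 16 (t - s) x\<bar> \<le> (2 * 2 * sqrt (t - s)) ^ 16" for x
      by (rule kac_abs_le[OF measurable_tent integrable_tent integral_tent_le]) (use assms in auto)
    have "integrable M (\<lambda>\<omega>. kac (tent n k) 16 (t - s) (C s \<omega>))"
      by (rule integrable_const_bound[of _ "(2 * 2 * sqrt (t - s)) ^ 16"]) (use b in auto)
    then show ?thesis
      using b by (intro integral_le_const) (auto simp: abs_le_iff)
  qed
  also have "(2 * 2 * sqrt (t - s)) ^ 16 = 4 ^ 16 * (t - s) ^ 8"
    using assms power_mult[of "sqrt (t - s)" 2 8] by (simp add: power_mult_distrib)
  \<comment> \<open>The constant is enlarged so that space and time share
    \<open>moment_constant\<close>.\<close>
  also have "\<dots> \<le> 16 ^ 16 * (t - s) ^ 8"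
    using assms by (intro mult_right_mono) auto
  finally show ?thesis
    by (simp add: moment_constant_def)
qed

lemma sixteenth_moment_tail:
  assumes [measurable]: "Z \<in> borel_measurable M" and Z: "\<And>\<omega>. \<bar>Z \<omega>\<bar> \<le> L"
    and "(\<integral>\<omega>. Z \<omega> ^ 16 \<partial>M) \<le> K" "0 < \<kappa>"
  shows "prob {\<omega> \<in> space M. \<kappa> < \<bar>Z \<omega>\<bar>} \<le> K / \<kappa> ^ 16"
proof -
  have i: "integrable M (\<lambda>\<omega>. Z \<omega> ^ 16)"
  proof (rule integrable_const_bound[of _ "L ^ 16"])
    show "AE \<omega> in M. norm (Z \<omega> ^ 16) \<le> L ^ 16"
      using power_mono[OF Z abs_ge_zero, where n = 16] by (simp only: real_norm_def power_abs AE_I2)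
  qed measurable
  have "prob {\<omega> \<in> space M. \<kappa> < \<bar>Z \<omega>\<bar>} \<le> prob {\<omega> \<in> space M. \<kappa> ^ 16 \<le> Z \<omega> ^ 16}"
  proof (rule finite_measure_mono)
    have "\<kappa> ^ 16 \<le> z ^ 16" if "\<kappa> < \<bar>z\<bar>" for z
      using power_mono[of \<kappa> "\<bar>z\<bar>" 16] that assms(4) by (simp only: power_even_abs even_numeral less_imp_le)
    then show "{\<omega> \<in> space M. \<kappa> < \<bar>Z \<omega>\<bar>} \<subseteq> {\<omega> \<in> space M. \<kappa> ^ 16 \<le> Z \<omega> ^ 16}" by auto
  qed measurable
  also have "\<dots> \<le> (\<integral>\<omega>. Z \<omega> ^ 16 \<partial>M) / \<kappa> ^ 16"
    using assms(4) i by (intro integral_Markov_inequality_measure[where A = "{}"]) auto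
  also have "\<dots> \<le> K / \<kappa> ^ 16"
    using assms by (intro divide_right_mono) auto
  finally show ?thesis .
qed

lemma X_bounds:
  assumes "0 \<le> t"
  shows "0 \<le> X n k t \<omega>" "X n k t \<omega> \<le> 2 ^ n * t"
proof -
  show "0 \<le> X n k t \<omega>"
    unfolding tent_occupation_def
    by (intro integral_nonneg integrable_continuous_interval continuous_f_C continuous_tent) simp
  show "X n k t \<omega> \<le> 2 ^ n * t"
    using occupation_abs_le[of "tent n k" "2 ^ n" 0 t \<omega>] continuous_tent tent_le[of n k] assms
    unfolding X_eq by (simp add: abs_le_iff)
qed

text \<open>The free parameters serve two regimes: \<open>\<mu> = 1\<close> on a fixed horizon for
  the regularity of the paths, and \<open>\<mu>\<close>, \<open>\<theta>\<close> growing together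
  with the time for the divergence.\<close>

lemma X_space_tail:
  assumes "1 \<le> \<theta>" "0 \<le> t" "t \<le> \<theta> ^ 8" "0 < \<mu>"
  shows "prob {\<omega> \<in> space M. tent_ratio ^ n * \<mu> < \<bar>X n k t \<omega> - X n (k + 1) t \<omega>\<bar>}
    \<le> moment_constant \<theta> * (1 / 8) ^ n / \<mu> ^ 16"
proof -
  have "\<bar>X n k t \<omega> - X n (k + 1) t \<omega>\<bar> \<le> 2 ^ n * t" for \<omega>
    using X_bounds[OF assms(2), of \<omega> n k] X_bounds[OF assms(2), of \<omega> n "k + 1"]
    unfolding abs_le_iff by linarith
  then have "prob {\<omega> \<in> space M. tent_ratio ^ n * \<mu> < \<bar>X n k t \<omega> - X n (k + 1) t \<omega>\<bar>}
      \<le> moment_constant \<theta> * (1 / 16) ^ n / (tent_ratio ^ n * \<mu>) ^ 16"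
    using X_space_moment[OF assms(1-3)] tent_ratio(1) assms(4)
    by (intro sixteenth_moment_tail) auto
  also have "(tent_ratio ^ n * \<mu>) ^ 16 = (1 / 2) ^ n * \<mu> ^ 16"
    unfolding power_mult_distrib tent_ratio_power ..
  also have "moment_constant \<theta> * (1 / 16) ^ n / ((1 / 2) ^ n * \<mu> ^ 16)
      = moment_constant \<theta> * ((1 / 16) ^ n / (1 / 2) ^ n) / \<mu> ^ 16"
    by simp
  also have "(1 / 16) ^ n / (1 / 2) ^ n = (1 / 8 :: real) ^ n"
    unfolding power_divide[symmetric] by simp
  finally show ?thesis .
qed

lemma X_time_tail:
  assumes "0 \<le> s"
  shows "prob {\<omega> \<in> space M. tent_ratio ^ n < \<bar>X n k (s + (1 / 2) ^ n) \<omega> - X n k s \<omega>\<bar>}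
    \<le> moment_constant 1 * (1 / 8) ^ n"
proof -
  define t where "t = s + (1 / 2) ^ n"
  have t: "s \<le> t" "0 \<le> t" "t - s = (1 / 2) ^ n" using assms by (auto simp: t_def)
  have m: "2 ^ n * s \<le> 2 ^ n * t" using t(1) by simp
  have "\<bar>X n k t \<omega> - X n k s \<omega>\<bar> \<le> 2 ^ n * t" for \<omega>
    using X_bounds[OF assms, of \<omega> n k] X_bounds[OF t(2), of \<omega> n k] m
    unfolding abs_le_iff by linarith
  then have "prob {\<omega> \<in> space M. tent_ratio ^ n < \<bar>X n k t \<omega> - X n k s \<omega>\<bar>}
      \<le> moment_constant 1 * (t - s) ^ 8 / (tent_ratio ^ n) ^ 16"
    using X_time_moment[OF assms t(1)] tent_ratio(1)
    by (intro sixteenth_moment_tail) auto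
  also have "(tent_ratio ^ n) ^ 16 = (1 / 2) ^ n"
    by (rule tent_ratio_power)
  also have "moment_constant 1 * (t - s) ^ 8 / (1 / 2) ^ n = moment_constant 1 * (((1 / 2) ^ 8) ^ n / (1 / 2) ^ n)"
    unfolding t(3) by (simp add: power_mult[symmetric] mult.commute)
  also have "((1 / 2) ^ 8) ^ n / (1 / 2) ^ n = (1 / 128 :: real) ^ n"
  proof -
    have "(1 / 2 :: real) ^ 8 / (1 / 2) = 1 / 128"
      by (simp add: power_divide)
    then show ?thesis
      using power_divide[of "(1 / 2 :: real) ^ 8" "1 / 2" n] by (simp only:)
  qed
  also have "moment_constant 1 * (1 / 128) ^ n \<le> moment_constant 1 * (1 / 8) ^ n"
    by (intro mult_left_mono power_mono) (auto simp: moment_constant_def)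
  finally show ?thesis unfolding t_def .
qed

lemma moment_constant_mono: "1 \<le> \<theta> \<Longrightarrow> 0 \<le> moment_constant 1 \<and> moment_constant 1 \<le> moment_constant \<theta>"
  unfolding moment_constant_def by (auto intro!: mult_left_mono power_mono one_le_power)

lemma AE_grid_increments:
  "AE \<omega> in M. \<forall>\<^sub>F n in sequentially. \<forall>k\<in>{- int (N * 2 ^ n)..int (N * 2 ^ n)}. \<forall>j\<in>{..N * 2 ^ n}.
    \<bar>X n k (real j / 2 ^ n) \<omega> - X n (k + 1) (real j / 2 ^ n) \<omega>\<bar> \<le> tent_ratio ^ n \<and>
    \<bar>X n k (real j / 2 ^ n + (1 / 2) ^ n) \<omega> - X n k (real j / 2 ^ n) \<omega>\<bar> \<le> tent_ratio ^ n"
proof -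
  \<comment> \<open>All grid times are at most \<open>N\<close>, hence at most
    \<open>\<theta> ^ 8\<close>, as \<open>X_space_tail\<close> requires.\<close>
  define \<theta> where "\<theta> = real (Suc N)"
  define I where "I = (\<lambda>n. {- int (N * 2 ^ n)..int (N * 2 ^ n)} \<times> {..N * 2 ^ n})"
  define A where "A = (\<lambda>n q. {\<omega> \<in> space M. tent_ratio ^ n * 1 <
      \<bar>X n (fst q) (real (snd q) / 2 ^ n) \<omega> - X n (fst q + 1) (real (snd q) / 2 ^ n) \<omega>\<bar>})"
  define A' where "A' = (\<lambda>n q. {\<omega> \<in> space M. tent_ratio ^ n <
      \<bar>X n (fst q) (real (snd q) / 2 ^ n + (1 / 2) ^ n) \<omega> - X n (fst q) (real (snd q) / 2 ^ n) \<omega>\<bar>})"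
  define E where "E = (\<lambda>n. \<Union>q\<in>I n. A n q \<union> A' n q)"
  have Am: "A n q \<in> sets M" "A' n q \<in> sets M" for n q
    unfolding A_def A'_def by measurable
  have Em: "E n \<in> sets M" for n
    unfolding E_def using Am by (intro sets.finite_UN) (auto simp: I_def)
  have \<theta>: "1 \<le> \<theta>" "real N \<le> \<theta> ^ 8"
  proof -
    show 1: "1 \<le> \<theta>" by (simp add: \<theta>_def)
    have "\<theta> ^ 1 \<le> \<theta> ^ 8" using 1 by (intro power_increasing) auto
    then show "real N \<le> \<theta> ^ 8" by (simp add: \<theta>_def)
  qed
  have le: "prob (A n q \<union> A' n q) \<le> 2 * moment_constant \<theta> * (1 / 8) ^ n" if q: "q \<in> I n" for n q
  proof -
    have "real (snd q) \<le> real (N * 2 ^ n)"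
      using q unfolding I_def by (intro of_nat_mono) auto
    then have "real (snd q) / 2 ^ n \<le> real N"
      by (simp add: field_simps)
    then have "real (snd q) / 2 ^ n \<le> \<theta> ^ 8"
      using \<theta>(2) by simp
    then have "prob (A n q) \<le> moment_constant \<theta> * (1 / 8) ^ n"
      unfolding A_def using X_space_tail[of \<theta> "real (snd q) / 2 ^ n" 1] \<theta>(1) by simp
    moreover have "prob (A' n q) \<le> moment_constant \<theta> * (1 / 8) ^ n"
      unfolding A'_def using X_time_tail[of "real (snd q) / 2 ^ n" n "fst q"]
        mult_right_mono[OF conjunct2[OF moment_constant_mono[OF \<theta>(1)]], of "(1 / 8) ^ n"]
      by (auto intro: order_trans)
    ultimately show ?thesis
      using measure_Un_le[OF Am(1)[of n q] Am(2)[of n q]] by simp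
  qed
  have card: "real (card (I n)) \<le> (3 * \<theta> * 2 ^ n) * (2 * \<theta> * 2 ^ n)" for n
  proof -
    have "real (card (I n)) = (2 * real N * 2 ^ n + 1) * (real N * 2 ^ n + 1)"
      by (simp add: I_def nat_add_distrib algebra_simps)
    also have "\<dots> \<le> (3 * \<theta> * 2 ^ n) * (2 * \<theta> * 2 ^ n)"
    proof -
      have 1: "(1::real) \<le> 2 ^ n" and 2: "0 \<le> real N * 2 ^ n" by simp_all
      have e: "3 * \<theta> * 2 ^ n = 3 * (real N * 2 ^ n) + 3 * 2 ^ n" "2 * \<theta> * 2 ^ n = 2 * (real N * 2 ^ n) + 2 * 2 ^ n"
        by (simp_all add: \<theta>_def algebra_simps)
      show ?thesis
        unfolding e using 1 2 by (intro mult_mono; simp add: mult.assoc; linarith)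
    qed
    finally show ?thesis .
  qed
  have PE: "prob (E n) \<le> 12 * \<theta>\<^sup>2 * moment_constant \<theta> * (1 / 2) ^ n" for n
  proof -
    have "prob (E n) \<le> (\<Sum>q\<in>I n. prob (A n q \<union> A' n q))"
      unfolding E_def using Am by (intro finite_measure_subadditive_finite) (auto simp: I_def)
    also have "\<dots> \<le> (\<Sum>q\<in>I n. 2 * moment_constant \<theta> * (1 / 8) ^ n)"
      by (intro sum_mono le)
    also have "\<dots> = real (card (I n)) * (2 * moment_constant \<theta> * (1 / 8) ^ n)"
      by simp
    also have "\<dots> \<le> ((3 * \<theta> * 2 ^ n) * (2 * \<theta> * 2 ^ n)) * (2 * moment_constant \<theta> * (1 / 8) ^ n)"
      using moment_constant_mono[OF \<theta>(1)] by (intro mult_right_mono card) auto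
    also have "\<dots> = 12 * \<theta>\<^sup>2 * moment_constant \<theta> * (2 ^ n * 2 ^ n * (1 / 8) ^ n)"
      by (simp add: power2_eq_square)
    also have "2 ^ n * 2 ^ n * (1 / 8) ^ n = (1 / 2 :: real) ^ n"
      by (simp add: power_mult_distrib[symmetric])
    finally show ?thesis .
  qed
  have "AE \<omega> in M. eventually (\<lambda>n. \<omega> \<in> space M - E n) sequentially"
  proof (rule borel_cantelli_AE1)
    show "summable (\<lambda>n. prob (E n))"
      by (rule summable_comparison_test'[of "\<lambda>n. 12 * \<theta>\<^sup>2 * moment_constant \<theta> * (1 / 2) ^ n" 0])
        (use PE in \<open>auto intro!: summable_mult summable_geometric\<close>)
  qed (use Em in \<open>auto simp: emeasure_eq_measure\<close>)
  then show ?thesis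
  proof eventually_elim
    case (elim \<omega>)
    then show ?case
    proof eventually_elim
      case (elim n)
      then show ?case
        unfolding E_def A_def A'_def I_def by (fastforce simp: not_less)
    qed
  qed
qed

end

section \<open>Local time of a path with small increments of dyadic occupations\<close>

text \<open>The rate depends only on \<open>\<delta>\<close> and \<open>p\<close>, so it is uniform
  over all sequences with the same increment bound.\<close>

lemma geometric_increments_limit:
  fixes a :: "nat \<Rightarrow> real"
  assumes p: "0 < p" "p < 1" and "0 \<le> \<delta>" and a: "\<And>m. n \<le> m \<Longrightarrow> \<bar>a (Suc m) - a m\<bar> \<le> \<delta> * p ^ m"
  obtains l where "a \<longlonglongrightarrow> l" "\<And>m. n \<le> m \<Longrightarrow> \<bar>a m - l\<bar> \<le> \<delta> * p ^ m / (1 - p)"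
proof -
  have b: "\<bar>a (m + i) - a m\<bar> \<le> \<delta> * p ^ m / (1 - p)" if "n \<le> m" for m i
  proof -
    have "\<bar>a (m + i) - a m\<bar> \<le> (\<Sum>j<i. \<delta> * p ^ (m + j))"
    proof (induction i)
      case (Suc i)
      then show ?case using a[of "m + i"] that by simp
    qed simp
    also have "\<dots> = \<delta> * p ^ m * (\<Sum>j<i. p ^ j)"
      by (simp add: power_add sum_distrib_left mult_ac)
    also have "(\<Sum>j<i. p ^ j) \<le> (\<Sum>j. p ^ j)"
      using p by (intro sum_le_suminf summable_geometric) auto
    also have "(\<Sum>j. p ^ j) = 1 / (1 - p)"
      using p by (intro suminf_geometric) auto
    finally show ?thesis
      using p \<open>0 \<le> \<delta>\<close> by (simp add: mult_left_mono)
  qed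
  have "Cauchy a"
  proof (rule CauchyI')
    fix e :: real assume "0 < e"
    have "(\<lambda>m. \<delta> * p ^ m / (1 - p)) \<longlonglongrightarrow> \<delta> * 0 / (1 - p)"
      using p by (intro tendsto_intros LIMSEQ_power_zero) auto
    then have "\<forall>\<^sub>F m in sequentially. \<delta> * p ^ m / (1 - p) < e"
      by (rule order_tendstoD) (use \<open>0 < e\<close> in simp)
    then obtain m0 where m0: "\<And>m. m0 \<le> m \<Longrightarrow> \<delta> * p ^ m / (1 - p) < e"
      by (auto simp: eventually_sequentially)
    show "\<exists>M. \<forall>m\<ge>M. \<forall>k>m. dist (a m) (a k) < e"
    proof (intro exI allI impI)
      fix m k assume "max m0 n \<le> m" "m < k"
      then show "dist (a m) (a k) < e"
        using b[of m "k - m"] m0[of m] by (simp add: dist_real_def abs_minus_commute)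
    qed
  qed
  then obtain l where l: "a \<longlonglongrightarrow> l"
    using Cauchy_convergent_iff convergent_def by metis
  show ?thesis
  proof (rule that[OF l])
    fix m assume m: "n \<le> m"
    have "(\<lambda>k. \<bar>a m - a k\<bar>) \<longlonglongrightarrow> \<bar>a m - l\<bar>"
      by (intro tendsto_intros l)
    then show "\<bar>a m - l\<bar> \<le> \<delta> * p ^ m / (1 - p)"
    proof (rule LIMSEQ_le_const2, intro exI allI impI)
      fix k assume "m \<le> k"
      then show "\<bar>a m - a k\<bar> \<le> \<delta> * p ^ m / (1 - p)"
        using b[OF m, of "k - m"] by (simp add: abs_minus_commute)
    qed
  qed
qed

section \<open>Convergence of the tent occupations along a fixed path\<close>

locale continuous_path =
  fixes c :: "real \<Rightarrow> real"
  assumes continuous_path: "continuous_on UNIV c"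
begin

abbreviation X :: "nat \<Rightarrow> int \<Rightarrow> real \<Rightarrow> real" where
  "X \<equiv> tent_occupation c"

lemma integrable_tent_path: "(\<lambda>u. tent n k (c u)) integrable_on {a..b}"
  by (intro integrable_continuous_interval continuous_on_compose2[OF continuous_tent[of UNIV]]
      continuous_on_subset[OF continuous_path]) auto

lemma X_nonneg: "0 \<le> X n k t"
  unfolding tent_occupation_def by (intro integral_nonneg integrable_tent_path) simp

lemma X_diff:
  assumes "0 \<le> s" "s \<le> t"
  shows "X n k t - X n k s = integral {s..t} (\<lambda>u. tent n k (c u))"
  using Henstock_Kurzweil_Integration.integral_combine[OF assms integrable_tent_path[of n k]]
  unfolding tent_occupation_def by linarith

lemma X_mono: "0 \<le> s \<Longrightarrow> s \<le> t \<Longrightarrow> X n k s \<le> X n k t"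
  using X_diff[of s t n k] integral_nonneg[OF integrable_tent_path, of s t n k] by simp

lemma X_refine:
  "X n k t = 1 / 4 * X (Suc n) (2 * k - 1) t + 1 / 2 * X (Suc n) (2 * k) t + 1 / 4 * X (Suc n) (2 * k + 1) t"
proof -
  have "((\<lambda>u. 1 / 4 * tent (Suc n) (2 * k - 1) (c u) + 1 / 2 * tent (Suc n) (2 * k) (c u)
        + 1 / 4 * tent (Suc n) (2 * k + 1) (c u)) has_integral
      1 / 4 * X (Suc n) (2 * k - 1) t + 1 / 2 * X (Suc n) (2 * k) t + 1 / 4 * X (Suc n) (2 * k + 1) t) {0..t}"
    unfolding tent_occupation_def
    by (intro has_integral_add has_integral_mult_right integrable_integral integrable_tent_path)
  then show ?thesis
    unfolding tent_refine[symmetric] by (simp add: tent_occupation_def integral_unique)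
qed

abbreviation Y :: "nat \<Rightarrow> real \<Rightarrow> real \<Rightarrow> real" where
  "Y n y t \<equiv> X n \<lfloor>2 ^ n * y\<rfloor> t"

text \<open>The candidate for the local time: the tents sit at the left ends of the dyadic cells
  containing \<open>y\<close>. Convergence is established once the increments are
  controlled.\<close>

definition L :: "real \<Rightarrow> real \<Rightarrow> real" where
  "L y t = lim (\<lambda>n. Y n y t)"

lemma floor_bounds:
  assumes "\<bar>y\<bar> \<le> real N"
  shows "\<lfloor>2 ^ n * y\<rfloor> \<in> {- int (N * 2 ^ n)..int (N * 2 ^ n)}"
proof -
  have "2 ^ n * \<bar>y\<bar> \<le> 2 ^ n * real N"
    using assms by (intro mult_left_mono) auto
  then have "\<bar>2 ^ n * y\<bar> \<le> 2 ^ n * real N"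
    by (simp add: abs_mult)
  then have "2 ^ n * y \<le> of_int (int (N * 2 ^ n))" and 1: "of_int (- int (N * 2 ^ n)) \<le> 2 ^ n * y"
    by (auto simp: abs_le_iff mult.commute)
  then have "of_int \<lfloor>2 ^ n * y\<rfloor> \<le> (of_int (int (N * 2 ^ n)) :: real)"
    by linarith
  moreover have "- int (N * 2 ^ n) \<le> \<lfloor>2 ^ n * y\<rfloor>"
    using 1 by (simp only: le_floor_iff)
  ultimately show ?thesis
    by (simp only: of_int_le_iff atLeastAtMost_iff)
qed

text \<open>The index at the next level is \<open>2 * k\<close> or \<open>2 * k + 1\<close>, while
  \<open>X n k t\<close> is a weighted average of the values at \<open>2 * k - 1\<close>,
  \<open>2 * k\<close> and \<open>2 * k + 1\<close>. For the outer index the deviation is at most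
  \<open>2 * \<delta> / 4 + \<delta> / 2\<close>. The range is enlarged to \<open>Suc N\<close> so
  that it contains \<open>2 * k - 1\<close>.\<close>

lemma Y_Suc:
  assumes y: "\<bar>y\<bar> \<le> real N"
    and d: "\<And>k. k \<in> {- int (Suc N * 2 ^ Suc n)..int (Suc N * 2 ^ Suc n)} \<Longrightarrow> \<bar>X (Suc n) k t - X (Suc n) (k + 1) t\<bar> \<le> \<delta>"
  shows "\<bar>Y (Suc n) y t - Y n y t\<bar> \<le> \<delta>"
proof -
  define k where "k = \<lfloor>2 ^ n * y\<rfloor>"
  have "\<lfloor>2 ^ Suc n * y\<rfloor> = 2 * k \<or> \<lfloor>2 ^ Suc n * y\<rfloor> = 2 * k + 1"
  proof -
    have "2 ^ Suc n * y = 2 * (2 ^ n * y)" by simp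
    then show ?thesis unfolding k_def by linarith
  qed
  moreover
  have k: "k \<in> {- int (N * 2 ^ n)..int (N * 2 ^ n)}"
    unfolding k_def by (rule floor_bounds[OF y])
  have p: "int (Suc N * 2 ^ Suc n) = 2 * int (N * 2 ^ n) + 2 * 2 ^ n" "(1::int) \<le> 2 ^ n"
    by (simp_all add: algebra_simps)
  have "2 * k - 1 \<in> {- int (Suc N * 2 ^ Suc n)..int (Suc N * 2 ^ Suc n)}"
    "2 * k \<in> {- int (Suc N * 2 ^ Suc n)..int (Suc N * 2 ^ Suc n)}"
    using k p(2) unfolding p(1) atLeastAtMost_iff by linarith+
  from d[OF this(1)] d[OF this(2)]
  have "\<bar>X (Suc n) (2 * k - 1) t - X (Suc n) (2 * k) t\<bar> \<le> \<delta>" "\<bar>X (Suc n) (2 * k) t - X (Suc n) (2 * k + 1) t\<bar> \<le> \<delta>"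
    by simp_all
  moreover have "\<bar>X (Suc n) (2 * k) t - X n k t\<bar> \<le> \<delta>" "\<bar>X (Suc n) (2 * k + 1) t - X n k t\<bar> \<le> \<delta>"
    using X_refine[of n k t] calculation(2,3) by linarith+
  ultimately show ?thesis
    unfolding k_def[symmetric] by (metis (no_types))
qed

end

text \<open>The almost sure event as a hypothesis on a single path. The level from which the bounds
  hold may depend on the window size \<open>N\<close>, as Borel-Cantelli provides it.\<close>

locale regular_path = continuous_path +
  assumes grid: "\<And>N. \<forall>\<^sub>F n in sequentially. \<forall>k\<in>{- int (N * 2 ^ n)..int (N * 2 ^ n)}. \<forall>j\<in>{..N * 2 ^ n}.
    \<bar>tent_occupation c n k (real j / 2 ^ n) - tent_occupation c n (k + 1) (real j / 2 ^ n)\<bar> \<le> tent_ratio ^ n \<and>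
    \<bar>tent_occupation c n k (real j / 2 ^ n + (1 / 2) ^ n) - tent_occupation c n k (real j / 2 ^ n)\<bar> \<le> tent_ratio ^ n"
begin

text \<open>Occupations increase in time, so values at arbitrary times are squeezed between those at
  neighbouring grid times; this costs a factor 2. A time step starting at \<open>t\<close> may end
  in the next grid interval, and the neighbour \<open>k + 1\<close> is used too, hence the passage
  to \<open>Suc N\<close>.\<close>

lemma uniform_increments:
  "\<forall>\<^sub>F n in sequentially. \<forall>k\<in>{- int (N * 2 ^ n)..int (N * 2 ^ n)}. \<forall>t\<in>{0..real N}.
    \<bar>X n k t - X n (k + 1) t\<bar> \<le> 2 * tent_ratio ^ n \<and> X n k (t + (1 / 2) ^ n) \<le> X n k t + 2 * tent_ratio ^ n"
  using grid[of "Suc N"]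
proof eventually_elim
  case (elim n)
  show ?case
  proof (intro ballI)
    fix k t assume k: "k \<in> {- int (N * 2 ^ n)..int (N * 2 ^ n)}" and t: "t \<in> {0..real N}"
    define h :: real where "h = (1 / 2) ^ n"
    have h: "0 < h" "h * 2 ^ n = 1" by (simp_all add: h_def power_divide)
    define j where "j = nat \<lfloor>t * 2 ^ n\<rfloor>"
    have jr: "real j = of_int \<lfloor>t * 2 ^ n\<rfloor>"
      using t by (simp add: j_def)
    define s where "s = real j / 2 ^ n"
    have s: "0 \<le> s" "s \<le> t" "t \<le> s + h" "s + h = real (Suc j) / 2 ^ n"
    proof -
      have f: "real j \<le> t * 2 ^ n" "t * 2 ^ n \<le> real j + 1"
        unfolding jr by linarith+
      show "0 \<le> s" by (simp add: s_def)
      show "s \<le> t" unfolding s_def using f(1) by (simp add: divide_le_eq)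
      show e: "s + h = real (Suc j) / 2 ^ n"
        by (simp add: s_def h_def add_divide_distrib power_divide)
      show "t \<le> s + h" unfolding e using f(2) by (simp add: le_divide_eq)
    qed
    have "t * 2 ^ n \<le> real N * 2 ^ n" using t by (intro mult_right_mono) auto
    then have "real_of_int \<lfloor>t * 2 ^ n\<rfloor> \<le> real N * 2 ^ n" by linarith
    then have "real j \<le> real (N * 2 ^ n)" unfolding jr by simp
    then have j: "j \<le> N * 2 ^ n" by (simp only: of_nat_le_iff)
    have "int (N * 2 ^ n) + 2 ^ n = int (Suc N * 2 ^ n)" "(1::int) \<le> 2 ^ n" "(1::nat) \<le> 2 ^ n"
      "N * 2 ^ n + 2 ^ n = Suc N * 2 ^ n"
      by (simp_all add: algebra_simps)
    with k j have k': "k \<in> {- int (Suc N * 2 ^ n)..int (Suc N * 2 ^ n)}" "k + 1 \<in> {- int (Suc N * 2 ^ n)..int (Suc N * 2 ^ n)}"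
      and j': "j \<in> {..Suc N * 2 ^ n}" "Suc j \<in> {..Suc N * 2 ^ n}"
      unfolding atLeastAtMost_iff atMost_iff by linarith+
    have 1: "\<bar>X n k s - X n (k + 1) s\<bar> \<le> tent_ratio ^ n" "\<bar>X n k (s + h) - X n k s\<bar> \<le> tent_ratio ^ n"
      using elim[rule_format, OF k'(1) j'(1)] unfolding s_def h_def by auto
    have 2: "\<bar>X n (k + 1) (s + h) - X n (k + 1) s\<bar> \<le> tent_ratio ^ n"
      using elim[rule_format, OF k'(2) j'(1)] unfolding s_def h_def by auto
    have 3: "\<bar>X n k (s + h + h) - X n k (s + h)\<bar> \<le> tent_ratio ^ n"
      using conjunct2[OF elim[rule_format, OF k'(1) j'(2)]] unfolding s(4)[symmetric] h_def[symmetric] .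
    have m: "X n k s \<le> X n k t" "X n k t \<le> X n k (s + h)" "X n (k + 1) s \<le> X n (k + 1) t"
      "X n (k + 1) t \<le> X n (k + 1) (s + h)" "X n k (t + h) \<le> X n k (s + h + h)"
      using s t h by (auto intro!: X_mono)
    show "\<bar>X n k t - X n (k + 1) t\<bar> \<le> 2 * tent_ratio ^ n \<and> X n k (t + (1 / 2) ^ n) \<le> X n k t + 2 * tent_ratio ^ n"
      using 1 2 3 m unfolding h_def[symmetric] by linarith
  qed
qed

definition D :: real where "D = 2 / (1 - tent_ratio)"

lemma Y_tendsto_L:
  "\<exists>n0. \<forall>n\<ge>n0. \<forall>y t. \<bar>y\<bar> \<le> real N \<and> 0 \<le> t \<and> t \<le> real N \<longrightarrow> \<bar>Y n y t - L y t\<bar> \<le> D * tent_ratio ^ n"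
proof -
  obtain n0 where n0: "\<And>n k t. n0 \<le> n \<Longrightarrow> k \<in> {- int (Suc N * 2 ^ n)..int (Suc N * 2 ^ n)} \<Longrightarrow> t \<in> {0..real (Suc N)} \<Longrightarrow>
      \<bar>X n k t - X n (k + 1) t\<bar> \<le> 2 * tent_ratio ^ n"
    using uniform_increments[of "Suc N"] unfolding eventually_sequentially by blast
  have "\<bar>Y n y t - L y t\<bar> \<le> D * tent_ratio ^ n" if "n0 \<le> n" and y: "\<bar>y\<bar> \<le> real N" and t: "0 \<le> t" "t \<le> real N" for n y t
  proof -
    have st: "\<bar>Y (Suc m) y t - Y m y t\<bar> \<le> 2 * tent_ratio ^ m" if "n0 \<le> m" for m
    proof -
      have "\<bar>Y (Suc m) y t - Y m y t\<bar> \<le> 2 * tent_ratio ^ Suc m"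
        using that t by (intro Y_Suc[OF y] n0) auto
      also have "\<dots> \<le> 2 * tent_ratio ^ m"
        using tent_ratio power_decreasing[of m "Suc m" tent_ratio] by simp
      finally show ?thesis .
    qed
    obtain l where l: "(\<lambda>n. Y n y t) \<longlonglongrightarrow> l"
      and b: "\<And>m. n0 \<le> m \<Longrightarrow> \<bar>Y m y t - l\<bar> \<le> 2 * tent_ratio ^ m / (1 - tent_ratio)"
      by (rule geometric_increments_limit[where n = n0 and \<delta> = 2, OF tent_ratio(1,2) _ st]) auto
    have "l = L y t"
      unfolding L_def using l by (rule limI[symmetric])
    then show ?thesis
      using b[OF \<open>n0 \<le> n\<close>] by (simp add: D_def)
  qed
  then show ?thesis by blast
qed

lemma Y_LIMSEQ: "0 \<le> t \<Longrightarrow> (\<lambda>n. Y n y t) \<longlonglongrightarrow> L y t"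
proof -
  assume t: "0 \<le> t"
  obtain N where N: "\<bar>y\<bar> + t \<le> real N" using real_arch_simple by blast
  obtain n0 where n0: "\<And>n. n0 \<le> n \<Longrightarrow> \<bar>Y n y t - L y t\<bar> \<le> D * tent_ratio ^ n"
  proof -
    have *: "\<bar>y\<bar> \<le> real N" "t \<le> real N" using N t by linarith+
    show ?thesis using Y_tendsto_L[of N] that * t by blast
  qed
  have z: "(\<lambda>n. D * tent_ratio ^ n) \<longlonglongrightarrow> 0"
    using tent_ratio by (intro tendsto_mult_right_zero LIMSEQ_power_zero) auto
  have ev: "\<forall>\<^sub>F n in sequentially. norm (Y n y t - L y t) \<le> D * tent_ratio ^ n"
    using n0 by (intro eventually_sequentiallyI[of n0]) simp
  have "(\<lambda>n. Y n y t - L y t) \<longlonglongrightarrow> 0"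
    by (rule Lim_null_comparison[OF ev z])
  then show ?thesis by (simp add: LIM_zero_iff)
qed

lemma L_nonneg: "0 \<le> t \<Longrightarrow> 0 \<le> L y t"
  by (rule LIMSEQ_le_const[OF Y_LIMSEQ]) (auto intro: X_nonneg)

lemma L_mono: "0 \<le> s \<Longrightarrow> s \<le> t \<Longrightarrow> L y s \<le> L y t"
  by (rule LIMSEQ_le[OF Y_LIMSEQ Y_LIMSEQ]) (auto intro: X_mono)

lemma L_0: "L y 0 = 0"
  by (rule LIMSEQ_unique[OF Y_LIMSEQ]) (simp_all add: tent_occupation_def)

lemma tent_ratio_eventually_less: "0 < e \<Longrightarrow> \<forall>\<^sub>F n in sequentially. K * tent_ratio ^ n < e"
proof -
  assume "0 < e"
  have "(\<lambda>n. K * tent_ratio ^ n) \<longlonglongrightarrow> 0"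
    using tent_ratio by (intro tendsto_mult_right_zero LIMSEQ_power_zero) auto
  then show ?thesis by (rule order_tendstoD) (use \<open>0 < e\<close> in simp)
qed

lemma L_uniformly_continuous:
  assumes "0 < e"
  obtains \<eta> where "0 < \<eta>" "\<And>y y' t t'. \<bar>y\<bar> \<le> real N \<Longrightarrow> \<bar>y'\<bar> \<le> real N \<Longrightarrow> 0 \<le> t \<Longrightarrow> t \<le> real N \<Longrightarrow> 0 \<le> t' \<Longrightarrow> t' \<le> real N \<Longrightarrow>
    \<bar>y - y'\<bar> \<le> \<eta> \<Longrightarrow> \<bar>t - t'\<bar> \<le> \<eta> \<Longrightarrow> \<bar>L y t - L y' t'\<bar> < e"
proof -
  obtain n0 where n0: "\<And>n y t. n0 \<le> n \<Longrightarrow> \<bar>y\<bar> \<le> real N \<Longrightarrow> 0 \<le> t \<Longrightarrow> t \<le> real N \<Longrightarrow> \<bar>Y n y t - L y t\<bar> \<le> D * tent_ratio ^ n"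
    using Y_tendsto_L[of N] by blast
  \<comment> \<open>Replacing \<open>L\<close> by \<open>Y n\<close> at two points costs
    \<open>2 * D\<close>, and one move in space and one in time cost 2 each, all in units of
    \<open>tent_ratio ^ n\<close>.\<close>
  have "\<forall>\<^sub>F n in sequentially. n0 \<le> n \<and> (2 * D + 4) * tent_ratio ^ n < e \<and>
      (\<forall>k\<in>{- int (N * 2 ^ n)..int (N * 2 ^ n)}. \<forall>t\<in>{0..real N}.
    \<bar>X n k t - X n (k + 1) t\<bar> \<le> 2 * tent_ratio ^ n \<and> X n k (t + (1 / 2) ^ n) \<le> X n k t + 2 * tent_ratio ^ n)"
    using eventually_ge_at_top[of n0] tent_ratio_eventually_less[OF \<open>0 < e\<close>, of "2 * D + 4"] uniform_increments[of N]
    by eventually_elim auto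
  then obtain n where n: "n0 \<le> n" "(2 * D + 4) * tent_ratio ^ n < e"
    and inc: "\<And>k t. k \<in> {- int (N * 2 ^ n)..int (N * 2 ^ n)} \<Longrightarrow> t \<in> {0..real N} \<Longrightarrow>
      \<bar>X n k t - X n (k + 1) t\<bar> \<le> 2 * tent_ratio ^ n \<and> X n k (t + (1 / 2) ^ n) \<le> X n k t + 2 * tent_ratio ^ n"
    unfolding eventually_sequentially by blast
  define h :: real where "h = (1 / 2) ^ n"
  have h: "0 < h" "2 ^ n * h = 1" by (simp_all add: h_def power_divide)
  have sp: "\<bar>Y n y t - Y n y' t\<bar> \<le> 2 * tent_ratio ^ n"
    if "y \<le> y'" "y' - y \<le> h" "\<bar>y\<bar> \<le> real N" "t \<in> {0..real N}" for y y' t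
  proof -
    have "2 ^ n * y \<le> 2 ^ n * y'" "2 ^ n * (y' - y) \<le> 2 ^ n * h"
      using that by simp_all
    then have "\<lfloor>2 ^ n * y'\<rfloor> = \<lfloor>2 ^ n * y\<rfloor> \<or> \<lfloor>2 ^ n * y'\<rfloor> = \<lfloor>2 ^ n * y\<rfloor> + 1"
      unfolding h(2) right_diff_distrib by linarith
    then show ?thesis
      using inc[OF floor_bounds[OF that(3)] that(4)] tent_ratio(1) by (elim disjE) auto
  qed
  have tm: "\<bar>Y n y t - Y n y t'\<bar> \<le> 2 * tent_ratio ^ n"
    if "t \<le> t'" "t' - t \<le> h" "\<bar>y\<bar> \<le> real N" "t \<in> {0..real N}" for y t t'
  proof -
    have "Y n y t \<le> Y n y t'" "Y n y t' \<le> Y n y (t + h)"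
      using that by (auto intro!: X_mono)
    then show ?thesis
      using inc[OF floor_bounds[OF that(3)] that(4)] unfolding h_def by linarith
  qed
  show ?thesis
  proof (rule that[OF h(1)])
    fix y y' t t' :: real
    assume *: "\<bar>y\<bar> \<le> real N" "\<bar>y'\<bar> \<le> real N" "0 \<le> t" "t \<le> real N" "0 \<le> t'" "t' \<le> real N"
      "\<bar>y - y'\<bar> \<le> h" "\<bar>t - t'\<bar> \<le> h"
    have 1: "\<bar>Y n y t - Y n y' t\<bar> \<le> 2 * tent_ratio ^ n"
      using sp[of y y' t] sp[of y' y t] * by (cases "y \<le> y'") (auto simp: abs_minus_commute)
    have 2: "\<bar>Y n y' t - Y n y' t'\<bar> \<le> 2 * tent_ratio ^ n"
      using tm[of t t' y'] tm[of t' t y'] * by (cases "t \<le> t'") (auto simp: abs_minus_commute)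
    have "(2 * D + 4) * tent_ratio ^ n = 2 * (D * tent_ratio ^ n) + 4 * tent_ratio ^ n"
      by (simp add: algebra_simps)
    then show "\<bar>L y t - L y' t'\<bar> < e"
      using 1 2 n(2) n0[OF n(1) *(1,3,4)] n0[OF n(1) *(2,5,6)] by linarith
  qed
qed

lemma continuous_L: "continuous_on (UNIV \<times> {0..}) (\<lambda>(y, t). L y t)"
  unfolding continuous_on_iff
proof (intro ballI allI impI)
  fix q e assume q: "q \<in> (UNIV :: real set) \<times> {0 :: real..}" and e: "(0::real) < e"
  obtain y t where yt: "q = (y, t)" "0 \<le> t" using q by auto
  obtain N where N: "\<bar>y\<bar> + t + 1 \<le> real N" using real_arch_simple by blast
  obtain \<eta> where \<eta>: "0 < \<eta>" "\<And>y y' t t'. \<bar>y\<bar> \<le> real N \<Longrightarrow> \<bar>y'\<bar> \<le> real N \<Longrightarrow> 0 \<le> t \<Longrightarrow> t \<le> real N \<Longrightarrow> 0 \<le> t' \<Longrightarrow> t' \<le> real N \<Longrightarrow>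
    \<bar>y - y'\<bar> \<le> \<eta> \<Longrightarrow> \<bar>t - t'\<bar> \<le> \<eta> \<Longrightarrow> \<bar>L y t - L y' t'\<bar> < e"
    using L_uniformly_continuous[OF e, of N] by blast
  show "\<exists>d>0. \<forall>x'\<in>UNIV \<times> {0..}. dist x' q < d \<longrightarrow> dist (case x' of (y, t) \<Rightarrow> L y t) (case q of (y, t) \<Rightarrow> L y t) < e"
  proof (intro exI conjI ballI impI)
    show "0 < min 1 \<eta>" using \<eta>(1) by simp
    fix x' assume x': "x' \<in> (UNIV :: real set) \<times> {0 :: real..}" "dist x' q < min 1 \<eta>"
    obtain y' t' where yt': "x' = (y', t')" "0 \<le> t'" using x' by auto
    have "dist y' y \<le> dist x' q" "dist t' t \<le> dist x' q"
      using dist_fst_le[of x' q] dist_snd_le[of x' q] by (simp_all add: yt yt')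
    then have "\<bar>y' - y\<bar> < 1" "\<bar>t' - t\<bar> < 1" "\<bar>y' - y\<bar> \<le> \<eta>" "\<bar>t' - t\<bar> \<le> \<eta>"
      using x'(2) by (auto simp: dist_real_def)
    then show "dist (case x' of (y, t) \<Rightarrow> L y t) (case q of (y, t) \<Rightarrow> L y t) < e"
    proof -
      assume a: "\<bar>y' - y\<bar> < 1" "\<bar>t' - t\<bar> < 1" "\<bar>y' - y\<bar> \<le> \<eta>" "\<bar>t' - t\<bar> \<le> \<eta>"
      have "\<bar>y'\<bar> \<le> real N" "\<bar>y\<bar> \<le> real N" "t' \<le> real N" "t \<le> real N"
        using a N yt(2) by linarith+
      then show ?thesis
        using \<eta>(2)[of y' y t' t] a(3,4) yt(2) yt'(2) by (simp add: yt yt' dist_real_def)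
    qed
  qed
qed

end

text \<open>A tent of height 1 is the difference of two clipped ramps at distance one cell, so the
  sum telescopes to a trapezoid.\<close>

lemma sum_tent:
  "(\<Sum>i<m. (1 / 2) ^ n * tent n (a + int i) z)
    = min 1 (max 0 (2 ^ n * z - of_int a + 1)) - min 1 (max 0 (2 ^ n * z - of_int a + 1 - real m))"
proof (induction m)
  case (Suc m)
  have "(1 / 2) ^ n * tent n (a + int m) z = max 0 (1 - \<bar>2 ^ n * z - of_int a - real m\<bar>)"
    by (simp add: tent_def power_divide algebra_simps)
  moreover have "max 0 (1 - \<bar>w\<bar>) = min 1 (max 0 (w + 1)) - min 1 (max 0 w)" for w :: real
    unfolding max_def min_def abs_if by (simp split: if_split)
  ultimately have "(1 / 2) ^ n * tent n (a + int m) z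
      = min 1 (max 0 (2 ^ n * z - of_int a - real m + 1)) - min 1 (max 0 (2 ^ n * z - of_int a - real m))"
    by simp
  moreover have "2 ^ n * z - of_int a + 1 - real (Suc m) = 2 ^ n * z - of_int a - real m"
    "2 ^ n * z - of_int a + 1 - real m = 2 ^ n * z - of_int a - real m + 1"
    by simp_all
  ultimately show ?case
    unfolding sum.lessThan_Suc Suc.IH by linarith
qed simp

section \<open>The tent limit as density of the occupation measure\<close>

context continuous_path
begin

text \<open>Half-open in the value, so that its measure is exactly an increment of the distribution
  function of the occupation measure.\<close>

definition window :: "real \<Rightarrow> real \<Rightarrow> real \<Rightarrow> real set" where
  "window t y y' = {u \<in> {0..t}. y \<le> c u \<and> c u < y'}"

lemma borel_measurable_path [measurable]: "c \<in> borel_measurable borel"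
  by (rule borel_measurable_continuous_onI[OF continuous_path])

lemma lmeasurable_path_preimage:
  assumes "S \<in> sets borel"
  shows "{u \<in> {0..t}. c u \<in> S} \<in> lmeasurable"
proof (rule bounded_set_imp_lmeasurable)
  show "bounded {u \<in> {0..t}. c u \<in> S}"
    by (rule bounded_subset[OF bounded_closed_interval]) auto
  have "{0..t} \<inter> c -` S \<in> sets borel"
    using measurable_sets[OF borel_measurable_path assms] by auto
  also have "{0..t} \<inter> c -` S = {u \<in> {0..t}. c u \<in> S}" by auto
  finally show "{u \<in> {0..t}. c u \<in> S} \<in> sets lebesgue"
    by (simp add: sets_completionI_sets)
qed

lemma lmeasurable_window: "window t y y' \<in> lmeasurable"
  using lmeasurable_path_preimage[of "{y..<y'}" t] by (simp add: window_def)

lemma has_integral_window: "(indicat_real (window t y y') has_integral measure lebesgue (window t y y')) {0..t}"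
proof -
  have "window t y y' \<inter> {0..t} = window t y y'" by (auto simp: window_def)
  then show ?thesis
    using lmeasurable_window[of t y y'] unfolding lmeasurable_iff_has_integral
    by (subst has_integral_restrict_UNIV[symmetric])
      (auto simp: indicator_def window_def elim!: has_integral_eq[rotated])
qed

lemma has_integral_sum_tent:
  "((\<lambda>u. \<Sum>i<m. (1 / 2) ^ n * tent n (a + int i) (c u)) has_integral (\<Sum>i<m. (1 / 2) ^ n * X n (a + int i) t)) {0..t}"
  unfolding tent_occupation_def
  by (intro has_integral_sum has_integral_mult_right integrable_integral integrable_tent_path) simp

text \<open>The trapezoid equals 1 between the first and the last centre, and these enclose all
  values taken in the window.\<close>

lemma measure_window_le:
  assumes "of_int a \<le> 2 ^ n * y" "2 ^ n * y' \<le> of_int a + real m - 1"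
    and K: "\<And>i. i < m \<Longrightarrow> X n (a + int i) t \<le> K"
  shows "measure lebesgue (window t y y') \<le> (1 / 2) ^ n * real m * K"
proof -
  have "measure lebesgue (window t y y') \<le> (\<Sum>i<m. (1 / 2) ^ n * X n (a + int i) t)"
  proof (rule has_integral_le[OF has_integral_window has_integral_sum_tent])
    fix u
    show "indicat_real (window t y y') u \<le> (\<Sum>i<m. (1 / 2) ^ n * tent n (a + int i) (c u))"
    proof (cases "u \<in> window t y y'")
      case True
      then have "2 ^ n * y \<le> 2 ^ n * c u" "2 ^ n * c u \<le> 2 ^ n * y'" by (simp_all add: window_def)
      then have "1 \<le> 2 ^ n * c u - of_int a + 1" "2 ^ n * c u - of_int a + 1 - real m \<le> 0"
        using assms by linarith+
      then show ?thesis
        unfolding sum_tent using True by (simp add: min_def max_def)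
    next
      case False
      then show ?thesis by (simp add: sum_nonneg)
    qed
  qed
  also have "\<dots> \<le> (\<Sum>i<m. (1 / 2) ^ n * K)"
    by (intro sum_mono mult_left_mono K) auto
  finally show ?thesis by (simp add: mult_ac)
qed

text \<open>The trapezoid never exceeds 1 and vanishes outside its supporting cells, which lie
  between \<open>y\<close> and \<open>y'\<close>.\<close>

lemma measure_window_ge:
  assumes "2 ^ n * y \<le> of_int a - 1" "of_int a + real m \<le> 2 ^ n * y'"
    and K: "\<And>i. i < m \<Longrightarrow> K \<le> X n (a + int i) t"
  shows "(1 / 2) ^ n * real m * K \<le> measure lebesgue (window t y y')"
proof -
  have "(1 / 2) ^ n * real m * K = (\<Sum>i<m. (1 / 2) ^ n * K)"
    by simp
  also have "\<dots> \<le> (\<Sum>i<m. (1 / 2) ^ n * X n (a + int i) t)"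
    by (intro sum_mono mult_left_mono K) auto
  also have "\<dots> \<le> measure lebesgue (window t y y')"
  proof (rule has_integral_le[OF has_integral_sum_tent has_integral_window])
    fix u assume u: "u \<in> {0..t}"
    show "(\<Sum>i<m. (1 / 2) ^ n * tent n (a + int i) (c u)) \<le> indicat_real (window t y y') u"
    proof (cases "u \<in> window t y y'")
      case True
      then show ?thesis unfolding sum_tent by (simp add: min_def max_def)
    next
      case False
      then consider "c u < y" | "y' \<le> c u" using u by (auto simp: window_def)
      then show ?thesis
      proof cases
        case 1
        then have "2 ^ n * c u \<le> 2 ^ n * y" by simp
        then have "2 ^ n * c u - of_int a + 1 \<le> 0" using assms(1) by linarith
        then show ?thesis unfolding sum_tent by (simp add: min_def max_def)
      next
        case 2
        then have "2 ^ n * y' \<le> 2 ^ n * c u" by simp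
        then have "1 \<le> 2 ^ n * c u - of_int a + 1 - real m" "1 \<le> 2 ^ n * c u - of_int a + 1" using assms(2) by linarith+
        then show ?thesis unfolding sum_tent by (simp add: min_def max_def)
      qed
    qed
  qed
  finally show ?thesis .
qed

end

context regular_path
begin

text \<open>A window is compared with a sum over dyadic cells whose occupations are all within
  \<open>\<delta>\<close> of \<open>L y0 t\<close>. The level \<open>n\<close> tends to infinity
  while the window stays fixed, so the error from rounding its ends disappears and the estimate
  holds for arbitrarily short windows with the same \<open>\<eta>\<close>.\<close>

lemma window_density:
  assumes t: "0 \<le> t" and "0 < \<delta>"
  obtains \<eta> where "0 < \<eta>"
    "\<And>y y'. \<bar>y - y0\<bar> < \<eta> \<Longrightarrow> \<bar>y' - y0\<bar> < \<eta> \<Longrightarrow> y \<le> y' \<Longrightarrow>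
      \<bar>measure lebesgue (window t y y') - (y' - y) * L y0 t\<bar> \<le> \<delta> * (y' - y)"
proof -
  obtain N where N: "\<bar>y0\<bar> + t + 1 \<le> real N" using real_arch_simple by blast
  obtain n0 where n0: "\<And>n y. n0 \<le> n \<Longrightarrow> \<bar>y\<bar> \<le> real N \<Longrightarrow> \<bar>Y n y t - L y t\<bar> \<le> D * tent_ratio ^ n"
  proof -
    have "t \<le> real N" using N by linarith
    then show ?thesis using Y_tendsto_L[of N] that t by blast
  qed
  obtain \<eta>1 where \<eta>1: "0 < \<eta>1" "\<And>y. \<bar>y\<bar> \<le> real N \<Longrightarrow> \<bar>y - y0\<bar> \<le> \<eta>1 \<Longrightarrow> \<bar>L y t - L y0 t\<bar> < \<delta> / 2"
  proof -
    have "0 < \<delta> / 2" using assms(2) by simp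
    then obtain \<eta> where \<eta>: "0 < \<eta>" "\<And>y y' t t'. \<bar>y\<bar> \<le> real N \<Longrightarrow> \<bar>y'\<bar> \<le> real N \<Longrightarrow> 0 \<le> t \<Longrightarrow> t \<le> real N \<Longrightarrow> 0 \<le> t' \<Longrightarrow> t' \<le> real N \<Longrightarrow>
        \<bar>y - y'\<bar> \<le> \<eta> \<Longrightarrow> \<bar>t - t'\<bar> \<le> \<eta> \<Longrightarrow> \<bar>L y t - L y' t'\<bar> < \<delta> / 2"
      using L_uniformly_continuous[of "\<delta> / 2" N] by blast
    have "\<bar>L y t - L y0 t\<bar> < \<delta> / 2" if "\<bar>y\<bar> \<le> real N" "\<bar>y - y0\<bar> \<le> \<eta>" for y
      using \<eta>(2)[of y y0 t t] that N t \<eta>(1) by simp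
    then show ?thesis using that \<eta>(1) by blast
  qed
  \<comment> \<open>The cells may protrude from the window by less than \<open>\<eta>\<close>, so
    values up to \<open>2 * \<eta>\<close> away from \<open>y0\<close> must be controlled.\<close>
  define \<eta> where "\<eta> = min (1 / 2) (\<eta>1 / 2)"
  have \<eta>: "0 < \<eta>" "2 * \<eta> \<le> 1" "2 * \<eta> \<le> \<eta>1" using \<eta>1(1) by (auto simp: \<eta>_def)
  define l where "l = L y0 t"
  have "\<forall>\<^sub>F n in sequentially. (1 / 2 :: real) ^ n < \<eta>"
    by (rule order_tendstoD(2)[OF LIMSEQ_power_zero \<eta>(1)]) simp
  then have "\<forall>\<^sub>F n in sequentially. n0 \<le> n \<and> D * tent_ratio ^ n < \<delta> / 2 \<and> (1 / 2) ^ n < \<eta>"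
    using eventually_ge_at_top[of n0] tent_ratio_eventually_less[of "\<delta> / 2" D] assms(2)
    by (simp add: eventually_conj)
  then obtain n1 where n1: "\<And>n. n1 \<le> n \<Longrightarrow> n0 \<le> n \<and> D * tent_ratio ^ n < \<delta> / 2 \<and> (1 / 2) ^ n < \<eta>"
    unfolding eventually_sequentially by blast
  have Xk: "\<bar>X n k t - l\<bar> \<le> \<delta>" if "n1 \<le> n" "\<bar>of_int k / 2 ^ n - y0\<bar> \<le> 2 * \<eta>" for n k
  proof -
    have b: "\<bar>of_int k / 2 ^ n\<bar> \<le> real N" using that(2) \<eta> N t by linarith
    have "Y n (of_int k / 2 ^ n) t = X n k t" by simp
    then show ?thesis
      using n0[of n "of_int k / 2 ^ n"] n1[OF that(1)] b \<eta>1(2)[OF b] that(2) \<eta>(3) unfolding l_def by linarith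
  qed
  show ?thesis
  proof (rule that[OF \<eta>(1)])
    fix y y' assume y: "\<bar>y - y0\<bar> < \<eta>" "\<bar>y' - y0\<bar> < \<eta>" "y \<le> y'"
    define \<mu> where "\<mu> = measure lebesgue (window t y y')"
    have l0: "0 \<le> l" unfolding l_def by (rule L_nonneg[OF t])
    have pw: "2 ^ n * (1 / 2) ^ n = (1 :: real)" "0 < (1 / 2 :: real) ^ n" for n
      by (simp_all add: power_divide)

    \<comment> \<open>Rounding both ends outwards adds at most three cells.\<close>
    have upper: "\<mu> \<le> ((y' - y) + 3 * (1 / 2) ^ n) * (l + \<delta>)" if n: "n1 \<le> n" for n
    proof -
      define a where "a = \<lfloor>2 ^ n * y\<rfloor>"
      define m where "m = nat (\<lfloor>2 ^ n * y'\<rfloor> + 2 - a)"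
      have "2 ^ n * y \<le> 2 ^ n * y'" using y(3) by simp
      then have "a \<le> \<lfloor>2 ^ n * y'\<rfloor>" unfolding a_def by (rule floor_mono)
      then have m: "int m = \<lfloor>2 ^ n * y'\<rfloor> + 2 - a" "real m = of_int \<lfloor>2 ^ n * y'\<rfloor> + 2 - of_int a"
        by (simp_all add: m_def)
      have "\<mu> \<le> (1 / 2) ^ n * real m * (l + \<delta>)"
        unfolding \<mu>_def
      proof (rule measure_window_le)
        show "of_int a \<le> 2 ^ n * y" unfolding a_def by linarith
        show "2 ^ n * y' \<le> of_int a + real m - 1" unfolding m(2) by linarith
        fix i assume "i < m"
        then have "int i < int m" by simp
        then have k: "a \<le> a + int i" "a + int i \<le> \<lfloor>2 ^ n * y'\<rfloor> + 1" unfolding m(1) by simp_all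
        have "2 ^ n * y - 1 \<le> of_int (a + int i)" using k(1) unfolding a_def by linarith
        moreover have "of_int (a + int i) \<le> 2 ^ n * y' + 1" using k(2) by linarith
        ultimately have "y - (1 / 2) ^ n \<le> of_int (a + int i) / 2 ^ n" "of_int (a + int i) / 2 ^ n \<le> y' + (1 / 2) ^ n"
          using pw(1)[of n] by (simp_all add: le_divide_eq divide_le_eq algebra_simps)
        then have "\<bar>of_int (a + int i) / 2 ^ n - y0\<bar> \<le> 2 * \<eta>"
          using y n1[OF n] by linarith
        from Xk[OF n this] show "X n (a + int i) t \<le> l + \<delta>" by linarith
      qed
      also have "\<dots> \<le> ((y' - y) + 3 * (1 / 2) ^ n) * (l + \<delta>)"
      proof (rule mult_right_mono)
        have "real m \<le> 2 ^ n * y' - 2 ^ n * y + 3" unfolding m(2) a_def by linarith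
        then have "(1 / 2) ^ n * real m \<le> (1 / 2) ^ n * (2 ^ n * y' - 2 ^ n * y + 3)"
          by (intro mult_left_mono) auto
        also have "\<dots> = (y' - y) + 3 * (1 / 2) ^ n"
          using pw(1)[of n] by (simp add: power_divide field_simps)
        finally show "(1 / 2) ^ n * real m \<le> (y' - y) + 3 * (1 / 2) ^ n" .
      qed (use l0 assms(2) in auto)
      finally show ?thesis .
    qed
    \<comment> \<open>Multiplying the count of cells by \<open>l - \<delta>\<close> needs its sign;
      a negative value makes the lower bound trivial and is treated at the end.\<close>
    have lower: "((y' - y) - 3 * (1 / 2) ^ n) * (l - \<delta>) \<le> \<mu>" if n: "n1 \<le> n" and ld: "0 \<le> l - \<delta>" for n
    proof -
      define a where "a = \<lceil>2 ^ n * y\<rceil> + 1"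
      define m where "m = nat (\<lfloor>2 ^ n * y'\<rfloor> - a)"
      have e: "(1 / 2) ^ n * (2 ^ n * y' - 2 ^ n * y - 3) = (y' - y) - 3 * (1 / 2) ^ n"
        using pw(1)[of n] by (simp add: power_divide field_simps)
      show ?thesis
      proof (cases "a \<le> \<lfloor>2 ^ n * y'\<rfloor>")
        case True
        then have m: "int m = \<lfloor>2 ^ n * y'\<rfloor> - a" "real m = of_int \<lfloor>2 ^ n * y'\<rfloor> - of_int a"
          by (simp_all add: m_def)
        have "2 ^ n * y' - 2 ^ n * y - 3 \<le> real m" unfolding m(2) a_def by linarith
        then have "(1 / 2) ^ n * (2 ^ n * y' - 2 ^ n * y - 3) \<le> (1 / 2) ^ n * real m"
          by (intro mult_left_mono) auto
        then have "((y' - y) - 3 * (1 / 2) ^ n) * (l - \<delta>) \<le> (1 / 2) ^ n * real m * (l - \<delta>)"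
          unfolding e using ld by (rule mult_right_mono)
        also have "\<dots> \<le> \<mu>"
          unfolding \<mu>_def
        proof (rule measure_window_ge)
          show "2 ^ n * y \<le> of_int a - 1" unfolding a_def by linarith
          show "of_int a + real m \<le> 2 ^ n * y'" unfolding m(2) by linarith
          fix i assume "i < m"
          then have "int i < int m" by simp
          then have k: "a \<le> a + int i" "a + int i \<le> \<lfloor>2 ^ n * y'\<rfloor>" unfolding m(1) by simp_all
          have "2 ^ n * y \<le> of_int (a + int i)" using k(1) unfolding a_def by linarith
          moreover have "of_int (a + int i) \<le> 2 ^ n * y'" using k(2) by linarith
          ultimately have "y \<le> of_int (a + int i) / 2 ^ n" "of_int (a + int i) / 2 ^ n \<le> y'"
            by (simp_all add: le_divide_eq divide_le_eq algebra_simps)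
          then have "\<bar>of_int (a + int i) / 2 ^ n - y0\<bar> \<le> 2 * \<eta>"
            using y \<eta>(1) by linarith
          from Xk[OF n this] show "l - \<delta> \<le> X n (a + int i) t" by linarith
        qed
        finally show ?thesis .
      next
        case False
        then have "2 ^ n * y' - 2 ^ n * y - 3 \<le> 0" unfolding a_def by linarith
        then have "(1 / 2) ^ n * (2 ^ n * y' - 2 ^ n * y - 3) \<le> 0"
          by (intro mult_nonneg_nonpos) auto
        then have "((y' - y) - 3 * (1 / 2) ^ n) * (l - \<delta>) \<le> 0"
          unfolding e using ld by (intro mult_nonpos_nonneg)
        also have "0 \<le> \<mu>" by (simp add: \<mu>_def)
        finally show ?thesis .
      qed
    qed
    have lim: "(\<lambda>n. ((y' - y) + b * (1 / 2) ^ n) * v) \<longlonglongrightarrow> ((y' - y) + b * 0) * v" for b v :: real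
      by (intro tendsto_mult tendsto_add tendsto_const LIMSEQ_power_zero) simp
    have "\<mu> \<le> (y' - y) * (l + \<delta>)"
      using LIMSEQ_le_const[OF lim[of 3 "l + \<delta>"], of \<mu>] upper by auto
    moreover have "(y' - y) * (l - \<delta>) \<le> \<mu>"
    proof (cases "0 \<le> l - \<delta>")
      case True
      then show ?thesis
        using LIMSEQ_le_const2[OF lim[of "- 3" "l - \<delta>"], of \<mu>] lower by auto
    next
      case False
      then have "(y' - y) * (l - \<delta>) \<le> 0" using y(3) by (intro mult_nonneg_nonpos) auto
      also have "0 \<le> \<mu>" by (simp add: \<mu>_def)
      finally show ?thesis .
    qed
    ultimately show "\<bar>measure lebesgue (window t y y') - (y' - y) * L y0 t\<bar> \<le> \<delta> * (y' - y)"
      unfolding \<mu>_def[symmetric] l_def[symmetric] by (simp add: abs_le_iff algebra_simps)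
  qed
qed

text \<open>By compactness the path keeps a positive distance from \<open>y\<close> during
  \<open>{s..t}\<close>, so all sufficiently fine tents near \<open>y\<close> vanish along
  it.\<close>

lemma L_eq_if_avoids:
  assumes "0 \<le> s" "s \<le> t" and avoid: "\<And>u. u \<in> {s..t} \<Longrightarrow> c u \<noteq> y"
  shows "L y t = L y s"
proof -
  have "compact ((\<lambda>u. \<bar>c u - y\<bar>) ` {s..t})"
    by (intro compact_continuous_image continuous_intros continuous_on_subset[OF continuous_path]) auto
  then obtain u0 where u0: "u0 \<in> {s..t}" "\<And>u. u \<in> {s..t} \<Longrightarrow> \<bar>c u0 - y\<bar> \<le> \<bar>c u - y\<bar>"
    using compact_attains_inf[of "(\<lambda>u. \<bar>c u - y\<bar>) ` {s..t}"] assms(2) by auto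
  define r where "r = \<bar>c u0 - y\<bar>"
  have r: "0 < r" using avoid[OF u0(1)] by (simp add: r_def)
  \<comment> \<open>The distance must exceed two cells: one for the half-width of the tent and one
    for rounding \<open>y\<close> down to the grid.\<close>
  obtain n1 where n1: "2 / r < 2 ^ n1" using real_arch_pow[of 2 "2 / r"] by auto
  have Yn: "Y n y t = Y n y s" if "n1 \<le> n" for n
  proof -
    have "(2::real) ^ n1 \<le> 2 ^ n" using that by (intro power_increasing) auto
    then have "2 / r < 2 ^ n" using n1 by linarith
    then have n: "2 \<le> 2 ^ n * r" using r by (simp add: field_simps)
    have "tent n \<lfloor>2 ^ n * y\<rfloor> (c u) = 0" if "u \<in> {s..t}" for u
    proof -
      have "2 ^ n * r \<le> 2 ^ n * \<bar>c u - y\<bar>" using u0(2)[OF that] by (simp add: r_def)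
      also have "\<dots> = \<bar>2 ^ n * c u - 2 ^ n * y\<bar>" by (simp add: abs_mult right_diff_distrib[symmetric])
      finally have "1 \<le> \<bar>2 ^ n * c u - of_int \<lfloor>2 ^ n * y\<rfloor>\<bar>" using n by linarith
      then show ?thesis by (simp add: tent_def)
    qed
    then have "integral {s..t} (\<lambda>u. tent n \<lfloor>2 ^ n * y\<rfloor> (c u)) = 0"
      using Henstock_Kurzweil_Integration.integral_cong[of "{s..t}" "\<lambda>u. tent n \<lfloor>2 ^ n * y\<rfloor> (c u)" "\<lambda>_. 0"] by simp
    then show ?thesis using X_diff[OF assms(1,2), of n "\<lfloor>2 ^ n * y\<rfloor>"] by simp
  qed
  have "(\<lambda>n. Y n y t) \<longlonglongrightarrow> L y s"
    by (rule Lim_transform_eventually[OF Y_LIMSEQ eventually_sequentiallyI[of n1]]) (use assms Yn in auto)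
  then show ?thesis
    using Y_LIMSEQ[of t y] assms by (intro LIMSEQ_unique) auto
qed

lemma L_eq_0_outside: "0 \<le> t \<Longrightarrow> y \<notin> c ` {0..t} \<Longrightarrow> L y t = 0"
  using L_eq_if_avoids[of 0 t y] L_0[of y] by (metis imageI order_refl)

end

section \<open>Local time, total mass, and the image and area of the brick curve\<close>

context regular_path
begin

lemma continuous_L_compose:
  assumes "continuous_on S f" "continuous_on S g" "\<And>u. u \<in> S \<Longrightarrow> 0 \<le> g u"
  shows "continuous_on S (\<lambda>u. L (f u) (g u))"
  using continuous_on_compose2[OF continuous_L continuous_on_Pair[OF assms(1,2)]] assms(3) by auto

text \<open>The defining sets are symmetric open neighbourhoods of \<open>y\<close>, whereas windows
  are half-open; they are enclosed between windows and the density estimate is applied to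
  these.\<close>

lemma local_time_eq_L:
  assumes t: "0 \<le> t"
  shows "local_time c y t = L y t"
proof -
  define m where "m = (\<lambda>\<epsilon>. measure lebesgue {u \<in> {0..t}. \<bar>c u - y\<bar> < \<epsilon>})"
  have "((\<lambda>\<epsilon>. m \<epsilon> / (2 * \<epsilon>)) \<longlongrightarrow> L y t) (at_right 0)"
  proof (rule tendstoI)
    fix e :: real assume "0 < e"
    then have "0 < e / 2" by simp
    then obtain \<eta> where \<eta>: "0 < \<eta>"
      "\<And>z z'. \<bar>z - y\<bar> < \<eta> \<Longrightarrow> \<bar>z' - y\<bar> < \<eta> \<Longrightarrow> z \<le> z' \<Longrightarrow>
        \<bar>measure lebesgue (window t z z') - (z' - z) * L y t\<bar> \<le> e / 2 * (z' - z)"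
      using window_density[OF t, of "e / 2" y] by blast
    have S: "{u \<in> {0..t}. \<bar>c u - y\<bar> < \<epsilon>} \<in> lmeasurable" for \<epsilon>
      using lmeasurable_path_preimage[of "{y - \<epsilon><..<y + \<epsilon>}" t]
      by (rule back_subst[of "\<lambda>S. S \<in> lmeasurable"]) (auto simp: abs_less_iff)
    have "dist (m \<epsilon> / (2 * \<epsilon>)) (L y t) < e" if \<epsilon>: "0 < \<epsilon>" "\<epsilon> < \<eta>" for \<epsilon>
    proof -
      have "m \<epsilon> \<le> measure lebesgue (window t (y - \<epsilon>) (y + \<epsilon>))"
        unfolding m_def by (rule measure_mono_fmeasurable[OF _ fmeasurableD[OF S] lmeasurable_window]) (auto simp: window_def)
      also have "\<dots> \<le> (2 * \<epsilon>) * (L y t + e / 2)"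
        using \<eta>(2)[of "y - \<epsilon>" "y + \<epsilon>"] \<epsilon> by (simp add: algebra_simps abs_le_iff)
      finally have up: "m \<epsilon> / (2 * \<epsilon>) \<le> L y t + e / 2"
        using \<epsilon>(1) by (simp add: divide_le_eq mult.commute)
      \<comment> \<open>The window from \<open>y - \<epsilon>\<close> would include the excluded
        left end, so the inner window starts at \<open>y - \<epsilon>'\<close>, and afterwards
        \<open>\<epsilon>'\<close> increases to \<open>\<epsilon>\<close>.\<close>
      have "(\<epsilon> + \<epsilon>') * (L y t - e / 2) \<le> m \<epsilon>" if "0 < \<epsilon>'" "\<epsilon>' < \<epsilon>" for \<epsilon>'
      proof -
        have "(\<epsilon> + \<epsilon>') * (L y t - e / 2) \<le> measure lebesgue (window t (y - \<epsilon>') (y + \<epsilon>))"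
        proof -
          have "\<bar>measure lebesgue (window t (y - \<epsilon>') (y + \<epsilon>)) - (y + \<epsilon> - (y - \<epsilon>')) * L y t\<bar>
              \<le> e / 2 * (y + \<epsilon> - (y - \<epsilon>'))"
            using \<epsilon> that by (intro \<eta>(2)) auto
          moreover have "y + \<epsilon> - (y - \<epsilon>') = \<epsilon> + \<epsilon>'" by simp
          moreover have "(\<epsilon> + \<epsilon>') * (L y t - e / 2) = (\<epsilon> + \<epsilon>') * L y t - e / 2 * (\<epsilon> + \<epsilon>')"
            by (simp add: algebra_simps)
          ultimately show ?thesis by (simp only: abs_le_iff) linarith
        qed
        also have "\<dots> \<le> m \<epsilon>"
          unfolding m_def
          by (rule measure_mono_fmeasurable[OF _ fmeasurableD[OF lmeasurable_window] S]) (use that in \<open>auto simp: window_def\<close>)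
        finally show ?thesis .
      qed
      then have ev: "\<forall>\<^sub>F \<epsilon>' in at_left \<epsilon>. (\<epsilon> + \<epsilon>') * (L y t - e / 2) \<le> m \<epsilon>"
        using eventually_at_left[of 0 \<epsilon>] \<epsilon>(1) by blast
      have "((\<lambda>\<epsilon>'. (\<epsilon> + \<epsilon>') * (L y t - e / 2)) \<longlongrightarrow> (\<epsilon> + \<epsilon>) * (L y t - e / 2)) (at_left \<epsilon>)"
        by (intro tendsto_intros)
      from tendsto_upperbound[OF this ev] have "(\<epsilon> + \<epsilon>) * (L y t - e / 2) \<le> m \<epsilon>" by simp
      then have "L y t - e / 2 \<le> m \<epsilon> / (2 * \<epsilon>)"
        using \<epsilon>(1) by (simp add: le_divide_eq algebra_simps)
      with up \<open>0 < e\<close> show ?thesis unfolding dist_real_def by linarith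
    qed
    then show "\<forall>\<^sub>F \<epsilon> in at_right 0. dist (m \<epsilon> / (2 * \<epsilon>)) (L y t) < e"
      using eventually_at_right[of 0 "\<eta>"] \<eta>(1) by blast
  qed
  then show ?thesis
    unfolding local_time_def m_def by (intro tendsto_Lim) auto
qed

text \<open>The distribution function \<open>G\<close> of the occupation measure has the continuous
  derivative \<open>L y t\<close>. It rises from 0 to \<open>t\<close> across an interval containing
  the range of the path, and \<open>L\<close> vanishes outside.\<close>

lemma has_bochner_integral_L:
  assumes t: "0 \<le> t"
  shows "has_bochner_integral lborel (\<lambda>y. L y t) t"
proof -
  define G where "G = (\<lambda>y. measure lebesgue {u \<in> {0..t}. c u < y})"
  have G: "{u \<in> {0..t}. c u < y} \<in> lmeasurable" for y
    using lmeasurable_path_preimage[of "{..<y}" t] by simp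
  have Gd: "G y' - G y = measure lebesgue (window t y y')" if "y \<le> y'" for y y'
  proof -
    have "window t y y' = {u \<in> {0..t}. c u < y'} - {u \<in> {0..t}. c u < y}"
      by (auto simp: window_def)
    then show ?thesis
      unfolding G_def using measurable_measure_Diff[OF G[of y'] fmeasurableD[OF G[of y]]] that by force
  qed
  have deriv: "(G has_real_derivative L y t) (at y)" for y
    unfolding has_field_derivative_def has_derivative_at_alt
  proof (intro conjI allI impI)
    fix e :: real assume "0 < e"
    then obtain \<eta> where \<eta>: "0 < \<eta>"
      "\<And>z z'. \<bar>z - y\<bar> < \<eta> \<Longrightarrow> \<bar>z' - y\<bar> < \<eta> \<Longrightarrow> z \<le> z' \<Longrightarrow>
        \<bar>measure lebesgue (window t z z') - (z' - z) * L y t\<bar> \<le> e * (z' - z)"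
      using window_density[OF t, of e y] by blast
    have "norm (G z - G y - L y t * (z - y)) \<le> e * norm (z - y)" if "norm (z - y) < \<eta>" for z
    proof (cases "y \<le> z")
      case True
      then show ?thesis using \<eta>(2)[of y z] Gd[OF True] that \<eta>(1) by (simp add: mult.commute)
    next
      case False
      then have zy: "z \<le> y" by simp
      have "\<bar>(G y - G z) - (y - z) * L y t\<bar> \<le> e * (y - z)"
        unfolding Gd[OF zy] using \<eta>(2)[of z y] that \<eta>(1) zy by simp
      moreover have "G z - G y - L y t * (z - y) = - ((G y - G z) - (y - z) * L y t)"
        by (simp add: algebra_simps)
      ultimately show ?thesis using zy by (simp add: abs_minus_commute)
    qed
    then show "\<exists>d>0. \<forall>z. norm (z - y) < d \<longrightarrow> norm (G z - G y - L y t * (z - y)) \<le> e * norm (z - y)"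
      using \<eta>(1) by blast
  qed (rule bounded_linear_mult_right)
  have "bounded (c ` {0..t})"
    by (intro compact_imp_bounded compact_continuous_image continuous_on_subset[OF continuous_path]) auto
  then obtain R where R: "0 < R" "\<And>u. u \<in> {0..t} \<Longrightarrow> \<bar>c u\<bar> < R"
    unfolding bounded_pos_less by auto
  have Rb: "- R < c u \<and> c u < R" if "u \<in> {0..t}" for u
    using R(2)[OF that] by linarith
  have R1: "{u \<in> {0..t}. c u < R} = {0..t}" using Rb by auto
  have R2: "{u \<in> {0..t}. c u < - R} = {}" using Rb by fastforce
  have GR: "G R = t" "G (- R) = 0"
    unfolding G_def R1 R2 using t by simp_all
  have "isCont (\<lambda>y. L y t) y" for y
  proof -
    have "continuous_on UNIV (\<lambda>y. L y t)"
      by (rule continuous_L_compose[OF continuous_on_id continuous_on_const]) (use t in simp)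
    then show ?thesis by (simp add: continuous_on_eq_continuous_at)
  qed
  then have "has_bochner_integral lborel (\<lambda>y. L y t * indicator {- R..R} y) (G R - G (- R))"
    using R(1) deriv by (intro has_bochner_integral_FTC_Icc_real) auto
  moreover have "L y t * indicator {- R..R} y = L y t" for y
  proof (cases "y \<in> {- R..R}")
    case False
    then have "y \<notin> c ` {0..t}" using R(2) by fastforce
    then show ?thesis using L_eq_0_outside[OF t] by simp
  qed simp
  ultimately show ?thesis using GR by simp
qed

text \<open>Allows visits at the endpoints, as needed when an endpoint is a first or last visit:
  \<open>L y\<close> is constant on the open interval and continuous up to its ends.\<close>

lemma L_eq_if_avoids_open:
  assumes "0 \<le> a" "a \<le> b" and avoid: "\<And>u. u \<in> {a<..<b} \<Longrightarrow> c u \<noteq> y"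
  shows "L y a = L y b"
proof (cases "a = b")
  case False
  then have ab: "a < b" using assms(2) by simp
  have 1: "L y u = L y ((a + b) / 2)" if "u \<in> {a<..<b}" for u
  proof (cases "u \<le> (a + b) / 2")
    case True
    then show ?thesis using that assms(1) ab
      by (intro L_eq_if_avoids[symmetric] avoid) auto
  next
    case False
    then show ?thesis using that assms(1) ab
      by (intro L_eq_if_avoids avoid) auto
  qed
  have cl: "closure {a<..<b} = {a..b}"
    using ab by (rule closure_greaterThanLessThan)
  have cont: "continuous_on {a..b} (\<lambda>u. L y u)"
    by (rule continuous_L_compose[OF continuous_on_const continuous_on_id]) (use assms(1) in simp)
  have "L y u = L y ((a + b) / 2)" if "u \<in> {a..b}" for u
    by (rule continuous_constant_on_closure[of "{a<..<b}" "\<lambda>u. L y u", unfolded cl, OF cont 1 that])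
  from this[of a] this[of b] show ?thesis using ab by simp
qed simp

text \<open>The intermediate value theorem gives a time \<open>u\<close> with
  \<open>L y u = s\<close>, at which the path need not be at \<open>y\<close>. Since
  \<open>L y\<close> is constant between visits, \<open>u\<close> can be moved to a visit without
  changing the height: to the last visit before \<open>u\<close>, or to the first one after
  \<open>u\<close> if there is none before.\<close>

lemma image_bricks:
  assumes t: "0 \<le> t"
  shows "(\<lambda>u. (c u, L (c u) u)) ` {0..t} = {(y, s). y \<in> c ` {0..t} \<and> s \<in> {0..L y t}}"
proof (intro equalityI subsetI)
  fix q assume "q \<in> (\<lambda>u. (c u, L (c u) u)) ` {0..t}"
  then obtain u where u: "q = (c u, L (c u) u)" "u \<in> {0..t}" by blast
  then have "0 \<le> L (c u) u" "L (c u) u \<le> L (c u) t"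
    using L_nonneg[of u "c u"] L_mono[of u t "c u"] by simp_all
  then show "q \<in> {(y, s). y \<in> c ` {0..t} \<and> s \<in> {0..L y t}}"
    using u by simp
next
  fix q assume "q \<in> {(y, s). y \<in> c ` {0..t} \<and> s \<in> {0..L y t}}"
  then obtain y s where q: "q = (y, s)" "y \<in> c ` {0..t}" "0 \<le> s" "s \<le> L y t" by auto
  have contL: "continuous_on {0..t} (\<lambda>u. L y u)"
    by (rule continuous_L_compose[OF continuous_on_const continuous_on_id]) simp
  have "\<exists>u. 0 \<le> u \<and> u \<le> t \<and> L y u = s"
    using IVT'[of "\<lambda>u. L y u" 0 s t] q(3,4) t contL L_0[of y] by auto
  then obtain u where u: "0 \<le> u" "u \<le> t" "L y u = s" by blast
  have hits: "compact ({a..b} \<inter> c -` {y})" for a b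
    unfolding compact_eq_bounded_closed
    by (intro conjI bounded_subset[OF bounded_closed_interval[of a b]] Int_lower1
        continuous_closed_preimage continuous_on_subset[OF continuous_path]) auto
  have "\<exists>v. 0 \<le> v \<and> v \<le> t \<and> c v = y \<and> L y v = s"
  proof (cases "{0..u} \<inter> c -` {y} = {}")
    case False
    then obtain v where v: "v \<in> {0..u} \<inter> c -` {y}" "\<And>w. w \<in> {0..u} \<inter> c -` {y} \<Longrightarrow> w \<le> v"
      using compact_attains_sup[OF hits] by blast
    have "L y v = L y u"
    proof (rule L_eq_if_avoids_open)
      fix w assume "w \<in> {v<..<u}"
      then show "c w \<noteq> y" using v(2)[of w] v(1) by auto
    qed (use v in auto)
    then show ?thesis using v(1) u by (intro exI[of _ v]) auto
  next
    \<comment> \<open>Here \<open>y\<close> has not been reached by time \<open>u\<close>;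
      membership of \<open>y\<close> in the image up to \<open>t\<close> provides a later
      visit.\<close>
    case True
    obtain w where w: "0 \<le> w" "w \<le> t" "c w = y" using q(2) by auto
    have "u \<le> w"
    proof (rule ccontr)
      assume "\<not> u \<le> w"
      then have "w \<in> {0..u} \<inter> c -` {y}" using w by simp
      with True show False by blast
    qed
    then have "w \<in> {u..t} \<inter> c -` {y}" using w by simp
    then have "{u..t} \<inter> c -` {y} \<noteq> {}" by blast
    then obtain v where v: "v \<in> {u..t} \<inter> c -` {y}" "\<And>w. w \<in> {u..t} \<inter> c -` {y} \<Longrightarrow> v \<le> w"
      using compact_attains_inf[OF hits] by blast
    have "L y u = L y v"
    proof (rule L_eq_if_avoids_open)
      fix w assume "w \<in> {u<..<v}"
      then show "c w \<noteq> y" using v(2)[of w] v(1) by auto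
    qed (use v u in auto)
    then show ?thesis using v(1) u by (intro exI[of _ v]) auto
  qed
  then obtain v where "0 \<le> v" "v \<le> t" "c v = y" "L y v = s" by blast
  then show "q \<in> (\<lambda>u. (c u, L (c u) u)) ` {0..t}"
    using q(1) by (intro image_eqI[of _ _ v]) simp_all
qed

lemma continuous_brick_curve:
  "continuous_on {0..} (\<lambda>u. (\<alpha> * c u, \<beta> * L (c u) u))"
  by (intro continuous_intros continuous_L_compose continuous_on_subset[OF continuous_path]) auto

text \<open>Fubini over vertical slices: over a visited level \<open>\<alpha> * y\<close> the slice
  is an interval of length \<open>\<beta> * L y t\<close>, over an unvisited one it is empty and
  \<open>L y t\<close> is 0. Measurability of the set comes from its compactness, and the
  substitution \<open>x = \<alpha> * y\<close> supplies \<open>\<bar>\<alpha>\<bar>\<close>.\<close>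

lemma emeasure_bricks:
  assumes t: "0 \<le> t" and \<alpha>: "\<alpha> \<noteq> 0" and \<beta>: "0 < \<beta>"
  shows "emeasure lebesgue ((\<lambda>u. (\<alpha> * c u, \<beta> * L (c u) u)) ` {0..t}) = ennreal (\<bar>\<alpha>\<bar> * \<beta> * t)"
proof -
  define S where "S = (\<lambda>u. (\<alpha> * c u, \<beta> * L (c u) u)) ` {0..t}"
  have "compact S"
    unfolding S_def by (intro compact_continuous_image continuous_on_subset[OF continuous_brick_curve]) auto
  then have S: "S \<in> sets borel" by (rule borel_compact)
  have "S = (\<lambda>(y, s). (\<alpha> * y, \<beta> * s)) ` (\<lambda>u. (c u, L (c u) u)) ` {0..t}"
    unfolding S_def image_image by simp
  also have "\<dots> = (\<lambda>(y, s). (\<alpha> * y, \<beta> * s)) ` {(y, s). y \<in> c ` {0..t} \<and> s \<in> {0..L y t}}"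
    by (simp only: image_bricks[OF t])
  finally have S2: "S = (\<lambda>(y, s). (\<alpha> * y, \<beta> * s)) ` {(y, s). y \<in> c ` {0..t} \<and> s \<in> {0..L y t}}" .
  have slice: "emeasure lborel (Pair (\<alpha> * y) -` S) = ennreal (\<beta> * L y t)" for y
  proof (cases "y \<in> c ` {0..t}")
    case True
    have "Pair (\<alpha> * y) -` S = {0..\<beta> * L y t}"
    proof (intro equalityI subsetI)
      fix s assume "s \<in> Pair (\<alpha> * y) -` S"
      then show "s \<in> {0..\<beta> * L y t}" unfolding S2 using \<alpha> \<beta> by auto
    next
      fix s assume "s \<in> {0..\<beta> * L y t}"
      then have "s / \<beta> \<in> {0..L y t}" "\<beta> * (s / \<beta>) = s" using \<beta> by (auto simp: field_simps)
      then show "s \<in> Pair (\<alpha> * y) -` S" unfolding S2 using True by force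
    qed
    then show ?thesis using L_nonneg[OF t] \<beta> by simp
  next
    case False
    then have "Pair (\<alpha> * y) -` S = {}" unfolding S2 using \<alpha> by auto
    then show ?thesis using L_eq_0_outside[OF t False] by simp
  qed
  have Sm: "S \<in> sets (lborel \<Otimes>\<^sub>M lborel)"
    using S by (simp only: lborel_prod sets_lborel)
  have m: "(\<lambda>x. emeasure lborel (Pair x -` S)) \<in> borel_measurable lborel"
    using lborel.measurable_emeasure_Pair[OF Sm] by simp
  have "emeasure lebesgue S = emeasure lborel S"
    using S by (simp add: emeasure_completion)
  also have "\<dots> = emeasure (lborel \<Otimes>\<^sub>M lborel) S"
    by (simp add: lborel_prod)
  also have "\<dots> = (\<integral>\<^sup>+ x. emeasure lborel (Pair x -` S) \<partial>lborel)"
    using Sm by (rule lborel.emeasure_pair_measure_alt)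
  also have "\<dots> = ennreal \<bar>\<alpha>\<bar> * (\<integral>\<^sup>+ y. emeasure lborel (Pair (0 + \<alpha> * y) -` S) \<partial>lborel)"
    using m \<alpha> by (intro nn_integral_real_affine) auto
  also have "\<dots> = ennreal \<bar>\<alpha>\<bar> * (\<integral>\<^sup>+ y. ennreal (\<beta> * L y t) \<partial>lborel)"
    using slice by simp
  also have "(\<integral>\<^sup>+ y. ennreal (\<beta> * L y t) \<partial>lborel) = ennreal (\<beta> * t)"
    using has_bochner_integral_mult_right[OF has_bochner_integral_L[OF t], of \<beta>] L_nonneg[OF t] \<beta>
    by (subst nn_integral_eq_integral) (auto simp: has_bochner_integral_iff)
  finally show ?thesis
    unfolding S_def[symmetric] using t \<beta> by (simp add: ennreal_mult[symmetric] mult.assoc)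
qed

lemma brick_curve_range:
  assumes unbounded: "\<And>y K. \<exists>t\<ge>0. K \<le> L y t" and \<alpha>: "\<alpha> \<noteq> 0" and \<beta>: "0 < \<beta>"
  shows "(\<lambda>u. (\<alpha> * c u, \<beta> * L (c u) u)) ` {0..} = UNIV \<times> {0..}"
proof (intro equalityI subsetI)
  fix q assume "q \<in> (UNIV :: real set) \<times> {0 :: real..}"
  then obtain y s where q: "q = (y, s)" "0 \<le> s" by auto
  \<comment> \<open>The extra 1 makes the local time positive even for \<open>s = 0\<close>, so that
    the level has been visited by time \<open>t\<close>.\<close>
  obtain t where t: "0 \<le> t" "s / \<beta> + 1 \<le> L (y / \<alpha>) t" using unbounded by blast
  have s: "0 \<le> s / \<beta>" using q(2) \<beta> by simp
  have "y / \<alpha> \<in> c ` {0..t}"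
    using L_eq_0_outside[OF t(1), of "y / \<alpha>"] t(2) s by (cases "y / \<alpha> \<in> c ` {0..t}") auto
  then have "(y / \<alpha>, s / \<beta>) \<in> {(y, s). y \<in> c ` {0..t} \<and> s \<in> {0..L y t}}"
    using t(2) s by auto
  then obtain u where "u \<in> {0..t}" "c u = y / \<alpha>" "L (c u) u = s / \<beta>"
    unfolding image_bricks[OF t(1), symmetric] by auto
  then show "q \<in> (\<lambda>u. (\<alpha> * c u, \<beta> * L (c u) u)) ` {0..}"
    using \<alpha> \<beta> q(1) by (intro image_eqI[of _ _ u]) auto
next
  fix q assume "q \<in> (\<lambda>u. (\<alpha> * c u, \<beta> * L (c u) u)) ` {0..}"
  then obtain u where "q = (\<alpha> * c u, \<beta> * L (c u) u)" "0 \<le> u" by auto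
  then show "q \<in> UNIV \<times> {0..}" using \<beta> L_nonneg[of u "c u"] by simp
qed

end

section \<open>Divergence of the local time\<close>

lemma kac_shift: "kac (\<lambda>z. f (x + z)) n r y = kac f n r (x + y)"
proof (induction n arbitrary: r y)
  case (Suc n)
  have "(\<integral>z. heat u (z - y) * f (x + z) * kac f n (r - u) (x + z) \<partial>lborel)
      = (\<integral>z. heat u (z - (x + y)) * f z * kac f n (r - u) z \<partial>lborel)" for u
    using lborel_integral_real_affine[of 1 "\<lambda>z. heat u (z - (x + y)) * f z * kac f n (r - u) z" x] by simp
  then show ?case
    unfolding kac.simps kac_step_def Suc.IH by simp
qed simp

lemma (in prob_space) sums_expectation:
  fixes a :: "nat \<Rightarrow> 'a \<Rightarrow> real"
  assumes [measurable]: "\<And>n. a n \<in> borel_measurable M" and b: "\<And>n \<omega>. \<bar>a n \<omega>\<bar> \<le> b n" "summable b"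
  shows "(\<lambda>n. \<integral>\<omega>. a n \<omega> \<partial>M) sums (\<integral>\<omega>. (\<Sum>n. a n \<omega>) \<partial>M)"
proof (rule sums_integral)
  show i: "integrable M (a n)" for n
    by (rule integrable_const_bound[of _ "b n"]) (use b in auto)
  show "AE \<omega> in M. summable (\<lambda>n. norm (a n \<omega>))"
    by (intro AE_I2 summable_comparison_test'[OF b(2)]) (use b in auto)
  show "summable (\<lambda>n. \<integral>\<omega>. norm (a n \<omega>) \<partial>M)"
  proof (rule summable_comparison_test'[OF b(2)])
    show "norm (\<integral>\<omega>. norm (a n \<omega>) \<partial>M) \<le> b n" for n
      using b integrable_norm[OF i] by (auto intro!: integral_le_const)
  qed
qed

lemma summable_exp_bound: "summable (\<lambda>n. K * (R ^ n / fact n))" for K R :: real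
  using summable_exp[of R] by (intro summable_mult) (simp add: field_simps)

lemma exp_suminf: "(\<Sum>n. z ^ n / fact n) = exp z" for z :: real
  unfolding exp_def by (simp add: scaleR_conv_of_real field_simps)

section \<open>Laplace transform of the occupation near the origin\<close>

context continuous_brownian_motion
begin

lemma occupation_bounds:
  assumes "continuous_on UNIV f" "\<And>x. 0 \<le> f x" "\<And>x. f x \<le> 1" "s \<le> t"
  shows "0 \<le> occupation f s t \<omega>" "occupation f s t \<omega> \<le> t - s"
proof -
  show "0 \<le> occupation f s t \<omega>"
    unfolding occupation_def using assms(2)
    by (intro integral_nonneg integrable_continuous_interval continuous_f_C[OF assms(1)])
  show "occupation f s t \<omega> \<le> t - s"
    using occupation_abs_le[OF assms(1), of 1 s t \<omega>] assms by (simp add: abs_le_iff)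
qed

text \<open>An arbitrary starting point is realised by the given motion from 0 and a translated
  \<open>f\<close>, which keeps all expectations on the same space.\<close>

lemma kac_eq_moment:
  assumes f: "continuous_on UNIV f" "\<And>x. 0 \<le> f x" "\<And>x. f x \<le> 1" "integrable lborel f" and "0 \<le> r"
  shows "kac f n r x = (\<integral>\<omega>. occupation (\<lambda>z. f (x + z)) 0 r \<omega> ^ n \<partial>M) / fact n"
proof -
  define g where "g = (\<lambda>z. f (x + z))"
  have g: "continuous_on UNIV g" "\<And>z. \<bar>g z\<bar> \<le> 1" "integrable lborel g"
    unfolding g_def using f lborel_integrable_real_affine[of f 1 x]
    by (auto intro!: continuous_on_compose2[OF f(1)] continuous_intros)
  have "(\<integral>\<omega>. occupation g 0 r \<omega> ^ n \<partial>M) = fact n * (\<integral>\<omega>. kac g n r (C 0 \<omega>) \<partial>M)"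
    using moment_formula[OF g past_1 \<open>0 \<le> r\<close>, of n] by simp
  also have "(\<integral>\<omega>. kac g n r (C 0 \<omega>) \<partial>M) = kac f n r x"
    by (simp add: C_0 prob_space kac_shift g_def)
  finally show ?thesis by (simp add: g_def)
qed

text \<open>The Markov property for an exponential functional of the whole future follows from
  \<open>moment_formula\<close> by expanding the exponential. As \<open>0 \<le> f \<le> 1\<close>,
  occupations are bounded by the elapsed time, and all series converge uniformly.\<close>

lemma laplace_markov:
  assumes f: "continuous_on UNIV f" "\<And>x. 0 \<le> f x" "\<And>x. f x \<le> 1" "integrable lborel f"
    and \<Phi>: "past s \<Phi>" and st: "s \<le> t" and \<kappa>: "0 \<le> \<kappa>"
  shows "(\<integral>\<omega>. \<Phi> \<omega> * exp (- \<kappa> * occupation f s t \<omega>) \<partial>M)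
    = (\<integral>\<omega>. \<Phi> \<omega> * (\<integral>\<omega>'. exp (- \<kappa> * occupation (\<lambda>z. f (C s \<omega> + z)) 0 (t - s) \<omega>') \<partial>M) \<partial>M)"
proof -
  define r where "r = t - s"
  let ?O = "\<lambda>x. occupation (\<lambda>z. f (x + z)) 0 r"
  let ?a = "\<lambda>n \<omega>. \<Phi> \<omega> * ((- \<kappa> * occupation f s t \<omega>) ^ n / fact n)"
  let ?b = "\<lambda>n \<omega>. \<Phi> \<omega> * ((- \<kappa>) ^ n * kac f n r (C s \<omega>))"
  have r: "0 \<le> r" using st by (simp add: r_def)
  obtain K where K: "\<And>\<omega>. \<bar>\<Phi> \<omega>\<bar> \<le> K" using past_bounded[OF \<Phi>] by blast
  then have K0: "0 \<le> K" using abs_ge_zero order_trans by blast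
  note past_measurable[OF \<Phi>, measurable]
  have [measurable]: "f \<in> borel_measurable borel"
    by (rule borel_measurable_continuous_onI[OF f(1)])
  have fx: "continuous_on UNIV (\<lambda>z. f (x + z))" for x
    by (rule continuous_on_compose2[OF f(1)]) (auto intro!: continuous_intros)
  have zb: "\<bar>(- \<kappa> * z) ^ n / fact n\<bar> \<le> (\<kappa> * r) ^ n / fact n" if "0 \<le> z" "z \<le> r" for z n
    using that \<kappa> by (auto simp: abs_divide power_abs abs_mult intro!: divide_right_mono power_mono mult_left_mono)
  have o1: "0 \<le> occupation f s t \<omega>" "occupation f s t \<omega> \<le> r" for \<omega>
    using occupation_bounds[OF f(1-3) st] unfolding r_def by auto
  have o2: "0 \<le> ?O x \<omega>" "?O x \<omega> \<le> r" for x \<omega>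
    using occupation_bounds[OF fx[of x] f(2,3) r] by auto
  have H: "(\<lambda>n. (- \<kappa>) ^ n * kac f n r x) sums (\<integral>\<omega>'. exp (- \<kappa> * ?O x \<omega>') \<partial>M)" for x
  proof -
    have [measurable]: "?O x \<in> borel_measurable M"
      using fx by measurable
    have "(\<lambda>n. \<integral>\<omega>'. (- \<kappa> * ?O x \<omega>') ^ n / fact n \<partial>M)
        sums (\<integral>\<omega>'. (\<Sum>n. (- \<kappa> * ?O x \<omega>') ^ n / fact n) \<partial>M)"
      by (rule sums_expectation[where b = "\<lambda>n. 1 * ((\<kappa> * r) ^ n / fact n)"])
        (measurable, use zb o2 in simp, rule summable_exp_bound)
    moreover have "(\<integral>\<omega>'. (- \<kappa> * ?O x \<omega>') ^ n / fact n \<partial>M) = (- \<kappa>) ^ n * kac f n r x" for n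
      unfolding kac_eq_moment[OF f r] power_mult_distrib by simp
    ultimately show ?thesis
      unfolding exp_suminf by simp
  qed
  \<comment> \<open>The kernel bound \<open>kac_abs_le\<close> has no factorial; reading
    \<open>kac\<close> as a moment gives the factor \<open>1 / fact n\<close> that makes the series
    converge for every \<open>\<kappa>\<close>.\<close>
  have kb: "\<bar>(- \<kappa>) ^ n * kac f n r x\<bar> \<le> (\<kappa> * r) ^ n / fact n" for n x
  proof -
    have [measurable]: "?O x \<in> borel_measurable M"
      using fx by measurable
    have p: "?O x \<omega> ^ n \<le> r ^ n" for \<omega>
      by (intro power_mono o2)
    have "(\<integral>\<omega>. ?O x \<omega> ^ n \<partial>M) \<le> r ^ n"
    proof (rule integral_le_const)
      show "integrable M (\<lambda>\<omega>. ?O x \<omega> ^ n)"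
        by (rule integrable_const_bound[of _ "r ^ n"]) (use p o2 in auto)
    qed (use p in auto)
    moreover have "0 \<le> (\<integral>\<omega>. ?O x \<omega> ^ n \<partial>M)"
      using o2 by (intro Bochner_Integration.integral_nonneg) auto
    ultimately have "0 \<le> kac f n r x" "kac f n r x \<le> r ^ n / fact n"
      unfolding kac_eq_moment[OF f r] by (auto intro: divide_right_mono)
    then show ?thesis
      using \<kappa> mult_left_mono[of "kac f n r x" "r ^ n / fact n" "\<kappa> ^ n"]
      by (simp add: abs_mult power_abs power_mult_distrib)
  qed
  have [measurable]: "occupation f s t \<in> borel_measurable M"
    using f(1) by measurable
  have "(\<lambda>n. \<integral>\<omega>. ?a n \<omega> \<partial>M)
      sums (\<integral>\<omega>. (\<Sum>n. ?a n \<omega>) \<partial>M)"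
  proof (rule sums_expectation[where b = "\<lambda>n. K * ((\<kappa> * r) ^ n / fact n)"])
    show "\<bar>?a n \<omega>\<bar> \<le> K * ((\<kappa> * r) ^ n / fact n)" for n \<omega>
      unfolding abs_mult[of "\<Phi> \<omega>"] using K K0 zb[OF o1] by (intro mult_mono) auto
  qed (measurable, rule summable_exp_bound)
  moreover have "(\<Sum>n. ?a n \<omega>) = \<Phi> \<omega> * exp (- \<kappa> * occupation f s t \<omega>)" for \<omega>
    using summable_exp_bound[of 1 "- \<kappa> * occupation f s t \<omega>"] unfolding exp_suminf[symmetric]
    by (intro suminf_mult) simp
  moreover have "(\<integral>\<omega>. ?a n \<omega> \<partial>M)
      = (\<integral>\<omega>. ?b n \<omega> \<partial>M)" for n
  proof -
    have "(\<integral>\<omega>. ?a n \<omega> \<partial>M)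
        = (\<integral>\<omega>. (- \<kappa>) ^ n / fact n * (\<Phi> \<omega> * occupation f s t \<omega> ^ n) \<partial>M)"
      unfolding power_mult_distrib by (intro Bochner_Integration.integral_cong) auto
    also have "\<dots> = (- \<kappa>) ^ n / fact n * (fact n * (\<integral>\<omega>. \<Phi> \<omega> * kac f n r (C s \<omega>) \<partial>M))"
      using moment_formula[OF f(1) _ f(4) \<Phi> st, of 1 n] f(2,3) by (simp add: r_def)
    also have "\<dots> = (\<integral>\<omega>. (- \<kappa>) ^ n * (\<Phi> \<omega> * kac f n r (C s \<omega>)) \<partial>M)"
      by simp
    finally show ?thesis by (simp add: mult_ac)
  qed
  ultimately have 1: "(\<lambda>n. \<integral>\<omega>. ?b n \<omega> \<partial>M)
      sums (\<integral>\<omega>. \<Phi> \<omega> * exp (- \<kappa> * occupation f s t \<omega>) \<partial>M)"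
    by simp
  have "(\<lambda>n. \<integral>\<omega>. ?b n \<omega> \<partial>M)
      sums (\<integral>\<omega>. (\<Sum>n. ?b n \<omega>) \<partial>M)"
  proof (rule sums_expectation[where b = "\<lambda>n. K * ((\<kappa> * r) ^ n / fact n)"])
    show "\<bar>?b n \<omega>\<bar> \<le> K * ((\<kappa> * r) ^ n / fact n)" for n \<omega>
      unfolding abs_mult[of "\<Phi> \<omega>"] using K K0 kb by (intro mult_mono) auto
  qed (measurable, rule summable_exp_bound)
  moreover have "(\<Sum>n. ?b n \<omega>)
      = \<Phi> \<omega> * (\<integral>\<omega>'. exp (- \<kappa> * ?O (C s \<omega>) \<omega>') \<partial>M)" for \<omega>
    using sums_unique[OF sums_mult[OF H[of "C s \<omega>"], of "\<Phi> \<omega>"]] by simp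
  ultimately show ?thesis
    using sums_unique2[OF 1] unfolding r_def by simp
qed

end

text \<open>Equal to 1 on \<open>{- 1..1}\<close> and supported in \<open>{- 2..2}\<close>, it
  dominates the unit tent translated by at most 1.\<close>

definition wide_tent :: "real \<Rightarrow> real" where
  "wide_tent z = tent 0 (- 1) z + tent 0 0 z + tent 0 1 z"

lemma tent_shift_le_wide_tent:
  assumes "\<bar>x\<bar> \<le> 1"
  shows "tent 0 0 (x + z) \<le> wide_tent z"
  using assms unfolding wide_tent_def tent_def max_def abs_if by (auto split: if_splits)

text \<open>The exponential is at least \<open>7 / 8\<close> here and \<open>sqrt (2 * pi)\<close>
  at most 3, and \<open>7 / 24\<close> exceeds \<open>1 / 4\<close>.\<close>

lemma heat_ge:
  assumes "1 \<le> s" "\<bar>z\<bar> \<le> 1 / 2"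
  shows "1 / (4 * sqrt s) \<le> heat s z"
proof -
  have s: "0 < s" "1 \<le> sqrt s" using assms by auto
  have "(z / sqrt s)\<^sup>2 = z\<^sup>2 / s" using s by (simp add: power_divide)
  also have "\<dots> \<le> (1 / 2)\<^sup>2 / 1"
    using assms power_mono[of "\<bar>z\<bar>" "1 / 2" 2] by (intro frac_le) (simp_all del: power_divide add: power2_abs)
  finally have "1 - 1 / 8 \<le> 1 + - ((z / sqrt s)\<^sup>2 / 2)"
    by (simp add: power_divide mult.commute)
  also have "\<dots> \<le> exp (- ((z / sqrt s)\<^sup>2 / 2))"
    by (rule exp_ge_add_one_self)
  finally have e: "7 / 8 \<le> exp (- ((z / sqrt s)\<^sup>2 / 2))" by simp
  have "sqrt (2 * pi) \<le> 3"
    using pi_less_4 by (intro real_le_lsqrt) auto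
  then have "7 / 8 / (3 * sqrt s) \<le> exp (- ((z / sqrt s)\<^sup>2 / 2)) / (sqrt (2 * pi) * sqrt s)"
    using e s by (intro frac_le mult_right_mono mult_pos_pos) auto
  moreover have "1 / (4 * sqrt s) \<le> 7 / 8 / (3 * sqrt s)"
    using s by (simp add: field_simps)
  ultimately show ?thesis
    unfolding heat_eq[OF s(1)] by linarith
qed

context continuous_brownian_motion
begin

text \<open>On \<open>{- 1 / 2..1 / 2}\<close> the kernel is at least
  \<open>1 / (4 * sqrt s)\<close> and the tent at least \<open>1 / 2\<close>.\<close>

lemma expectation_tent_ge:
  assumes "1 \<le> s"
  shows "1 / (8 * sqrt s) \<le> (\<integral>\<omega>. tent 0 0 (C s \<omega>) \<partial>M)"
proof -
  have s: "0 < s" using assms by simp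
  have m: "(\<integral>\<omega>. tent 0 0 (C s \<omega>) \<partial>M) = (\<integral>z. heat s z * tent 0 0 z \<partial>lborel)"
    using markov[OF past_1 s measurable_tent, of 0 0 1] tent_le[of 0 0]
    by (simp add: C_0 prob_space)
  have i: "has_bochner_integral lborel (\<lambda>z. 1 / (8 * sqrt s) * indicator {- 1 / 2..1 / 2 :: real} z) (1 / (8 * sqrt s) * measure lborel {- 1 / 2..1 / 2 :: real})"
    by (intro has_bochner_integral_mult_right has_bochner_integral_real_indicator) (auto simp: emeasure_lborel_Icc_eq)
  then have "1 / (8 * sqrt s) = (\<integral>z. 1 / (8 * sqrt s) * indicator {- 1 / 2..1 / 2 :: real} z \<partial>lborel)"
    by (simp add: has_bochner_integral_iff)
  also have "\<dots> \<le> (\<integral>z. heat s z * tent 0 0 z \<partial>lborel)"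
  proof (rule integral_mono)
    show "integrable lborel (\<lambda>z. 1 / (8 * sqrt s) * indicator {- 1 / 2..1 / 2 :: real} z)"
      using i by (simp only: has_bochner_integral_iff)
    show "integrable lborel (\<lambda>z. heat s z * tent 0 0 z)"
      using integrable_heat[OF s, of 0]
      by (rule Bochner_Integration.integrable_bound)
        (use tent_le[of 0 0] in \<open>auto simp: abs_mult intro!: AE_I2 mult_left_le\<close>)
    show "1 / (8 * sqrt s) * indicator {- 1 / 2..1 / 2 :: real} z \<le> heat s z * tent 0 0 z" for z
    proof (cases "\<bar>z\<bar> \<le> 1 / 2")
      case True
      then have "1 / 2 \<le> tent 0 0 z" by (simp add: tent_def)
      with heat_ge[OF assms True] have "1 / (4 * sqrt s) * (1 / 2) \<le> heat s z * tent 0 0 z"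
        using s by (intro mult_mono) auto
      then show ?thesis by (simp add: indicator_def)
    next
      case False
      then have "z \<notin> {- 1 / 2..1 / 2}" by (auto simp: abs_le_iff)
      then show ?thesis by simp
    qed
  qed
  finally show ?thesis unfolding m .
qed

text \<open>The quantity \<open>E\<close> bounds itself. By the chain rule
  \<open>1 - exp (- \<kappa> * occupation f 0 t \<omega>)\<close> is the integral over
  \<open>s\<close> of \<open>\<kappa> * f (C s \<omega>) * exp (- \<kappa> * occupation f s t
  \<omega>)\<close>. Where \<open>f (C s \<omega>)\<close> is positive the path is within distance 1
  of the origin, so the future occupation of \<open>f\<close> is dominated by a fresh occupation of
  \<open>wide_tent\<close>, and the conditional expectation of the exponential is at least
  \<open>E\<close>. Thus \<open>E\<close> times the expected occupation is at most
  \<open>1 / \<kappa>\<close>.\<close>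

lemma laplace_occupation_le:
  assumes t: "2 \<le> t" and \<kappa>: "0 < \<kappa>"
  shows "(\<integral>\<omega>. exp (- \<kappa> * occupation wide_tent 0 t \<omega>) \<partial>M) \<le> 16 / (\<kappa> * sqrt t)"
proof -
  define f where "f = tent 0 0"
  let ?W = "occupation wide_tent 0 t"
  let ?O = "\<lambda>s x. occupation (\<lambda>z. f (x + z)) 0 (t - s)"
  define E where "E = (\<integral>\<omega>. exp (- \<kappa> * ?W \<omega>) \<partial>M)"
  let ?g = "\<lambda>s \<omega>. f (C s \<omega>) * (\<kappa> * exp (- \<kappa> * occupation f s t \<omega>))"
  let ?H = "\<lambda>s x. \<integral>\<omega>'. exp (- \<kappa> * ?O s x \<omega>') \<partial>M"
  have f: "continuous_on UNIV f" "\<And>x. 0 \<le> f x" "\<And>x. f x \<le> 1" "integrable lborel f"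
    using tent_le[of 0 0] by (auto simp: f_def continuous_tent integrable_tent)
  have [measurable]: "f \<in> borel_measurable borel"
    by (simp add: f_def)
  have fx: "continuous_on UNIV (\<lambda>z. f (x + z))" for x
    by (rule continuous_on_compose2[OF f(1)]) (auto intro!: continuous_intros)
  have w: "continuous_on UNIV wide_tent"
    unfolding wide_tent_def by (intro continuous_intros continuous_tent)
  have w0: "0 \<le> wide_tent z" for z by (simp add: wide_tent_def)
  have [measurable]: "?W \<in> borel_measurable M"
    using w by measurable
  have wocc: "0 \<le> occupation wide_tent 0 r \<omega>" for r \<omega>
    unfolding occupation_def using w0
    by (intro integral_nonneg integrable_continuous_interval continuous_f_C[OF w])
  have E0: "0 \<le> E" unfolding E_def by (intro Bochner_Integration.integral_nonneg) simp
  have pathwise: "(\<integral>s. indicator {0<..<t} s * ?g s \<omega> \<partial>lborel) \<le> 1" for \<omega>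
  proof -
    have "((\<lambda>x. - exp (- \<kappa> * x)) has_real_derivative \<kappa> * exp (- \<kappa> * x)) (at x)" for x
      by (auto intro!: derivative_eq_intros)
    from integral_chain_rule[OF _ continuous_f_C[OF f(1)] this, of 0 t \<omega>] t
    have "integral {0..t} (\<lambda>s. ?g s \<omega>) = 1 - exp (- \<kappa> * occupation f 0 t \<omega>)"
      by (simp add: occupation_def)
    moreover have "continuous_on {0..t} (\<lambda>u. occupation f u t \<omega>)"
      unfolding occupation_def
      by (rule DERIV_continuous_on[OF integral_has_real_derivative'[OF continuous_f_C[OF f(1)]]])
    then have "integral {0..t} (\<lambda>s. ?g s \<omega>)
        = (\<integral>s. indicator {0<..<t} s * ?g s \<omega> \<partial>lborel)"
      by (intro integral_Icc_eq_lborel continuous_intros continuous_f_C[OF f(1)])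
    ultimately show ?thesis
      using exp_gt_zero[of "- \<kappa> * occupation f 0 t \<omega>"] by linarith
  qed
  have at: "1 / (8 * sqrt t) * E \<le> (\<integral>\<omega>. f (C s \<omega>) * exp (- \<kappa> * occupation f s t \<omega>) \<partial>M)"
    if s: "1 \<le> s" "s < t" for s
  proof -
    have "past s (\<lambda>\<omega>. 1 * f (C s \<omega>))"
      by (rule past_mult[OF past_const, of s s f 1]) (use s f in auto)
    then have \<Phi>: "past s (\<lambda>\<omega>. f (C s \<omega>))" by simp
    have le: "f (C s \<omega>) * E \<le> f (C s \<omega>) * ?H s (C s \<omega>)" for \<omega>
    proof (cases "\<bar>C s \<omega>\<bar> \<le> 1")
      case True
      define x where "x = C s \<omega>"
      have [measurable]: "?O s x \<in> borel_measurable M"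
        using fx by measurable
      have o: "0 \<le> ?O s x \<omega>'" for \<omega>'
        using occupation_bounds(1)[OF fx f(2,3)] s by simp
      have le: "?O s x \<omega>' \<le> ?W \<omega>'" for \<omega>'
      proof -
        have "?O s x \<omega>' \<le> occupation wide_tent 0 (t - s) \<omega>'"
          unfolding occupation_def f_def using True tent_shift_le_wide_tent[of x] fx
          by (intro integral_le integrable_continuous_interval continuous_f_C[OF w] continuous_f_C[OF fx[unfolded f_def]])
            (auto simp: x_def)
        also have "\<dots> \<le> ?W \<omega>'"
          unfolding occupation_def using s w0
          by (intro integral_subset_le integrable_continuous_interval continuous_f_C[OF w]) auto
        finally show ?thesis .
      qed
      have "E \<le> ?H s x"
        unfolding E_def
      proof (rule integral_mono)
        show "integrable M (\<lambda>\<omega>. exp (- \<kappa> * ?W \<omega>))"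
          by (rule integrable_const_bound[of _ 1]) (use wocc \<kappa> in auto)
        show "integrable M (\<lambda>\<omega>. exp (- \<kappa> * ?O s x \<omega>))"
          by (rule integrable_const_bound[of _ 1]) (use o \<kappa> in auto)
        show "exp (- \<kappa> * ?W \<omega>) \<le> exp (- \<kappa> * ?O s x \<omega>)" for \<omega>
          using le \<kappa> by simp
      qed
      then show ?thesis
        unfolding x_def by (rule mult_left_mono) (rule f(2))
    next
      case False
      then have "f (C s \<omega>) = 0" by (simp add: f_def tent_def)
      then show ?thesis by simp
    qed
    have fxm: "(\<lambda>\<omega>. \<integral>\<omega>'. exp (- \<kappa> * occupation (\<lambda>z. f (C s \<omega> + z)) 0 (t - s) \<omega>') \<partial>M) \<in> borel_measurable M"
    proof -
      show ?thesis
        unfolding occupation_eq_lborel[OF fx] by measurable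
    qed
    have "1 / (8 * sqrt t) \<le> 1 / (8 * sqrt s)"
      using s by (intro divide_left_mono) auto
    also have "\<dots> \<le> (\<integral>\<omega>. f (C s \<omega>) \<partial>M)"
      unfolding f_def by (rule expectation_tent_ge[OF s(1)])
    finally have "1 / (8 * sqrt t) * E \<le> (\<integral>\<omega>. f (C s \<omega>) * E \<partial>M)"
      using E0 mult_right_mono[of "1 / (8 * sqrt t)" "\<integral>\<omega>. f (C s \<omega>) \<partial>M" E] by simp
    also have "\<dots> \<le> (\<integral>\<omega>. f (C s \<omega>) * ?H s (C s \<omega>) \<partial>M)"
    proof (rule integral_mono[OF _ _ le])
      show "integrable M (\<lambda>\<omega>. f (C s \<omega>) * E)"
        by (rule integrable_const_bound[of _ E]) (use f(2,3) E0 in \<open>auto simp: abs_mult intro!: AE_I2 mult_left_le_one_le\<close>)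
      have b: "\<bar>\<integral>\<omega>'. exp (- \<kappa> * ?O s x \<omega>') \<partial>M\<bar> \<le> 1" for x
      proof -
        have [measurable]: "?O s x \<in> borel_measurable M"
          using fx by measurable
        have o: "exp (- \<kappa> * ?O s x \<omega>') \<le> 1" for \<omega>'
          using occupation_bounds(1)[OF fx f(2,3), of 0 "t - s"] s \<kappa> by simp
        have "?H s x \<le> 1"
          by (rule integral_le_const) (use o in \<open>auto intro!: integrable_const_bound[of _ 1]\<close>)
        moreover have "0 \<le> ?H s x"
          by (intro Bochner_Integration.integral_nonneg) simp
        ultimately show ?thesis by simp
      qed
      show "integrable M (\<lambda>\<omega>. f (C s \<omega>) * ?H s (C s \<omega>))"
      proof (rule integrable_const_bound[of _ "1 * 1"])
        show "AE \<omega> in M. norm (f (C s \<omega>) * ?H s (C s \<omega>)) \<le> 1 * 1"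
          unfolding real_norm_def abs_mult using f(2,3) b by (intro AE_I2 mult_mono) auto
      qed (use fxm in measurable)
    qed
    also have "\<dots> = (\<integral>\<omega>. f (C s \<omega>) * exp (- \<kappa> * occupation f s t \<omega>) \<partial>M)"
      using laplace_markov[OF f \<Phi>, of t \<kappa>] s \<kappa> by simp
    finally show ?thesis .
  qed
  have m: "(\<lambda>(s, \<omega>). ?g s \<omega>) \<in> borel_measurable (borel \<Otimes>\<^sub>M M)"
    using f(1) by measurable
  have bd: "\<bar>?g s \<omega>\<bar> \<le> 1 * (\<kappa> * 1)" if "0 < s" "s < t" for s \<omega>
    unfolding abs_mult using f(2,3) occupation_bounds(1)[OF f(1-3), of s t \<omega>] that \<kappa>
    by (intro mult_mono) auto
  \<comment> \<open>Only times in \<open>{1<..<t}\<close> are retained, where the lower bound for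
    the tent is available; \<open>2 \<le> t\<close> then turns \<open>t - 1\<close> into at least
    \<open>t / 2\<close>.\<close>
  have "\<kappa> * (1 / (8 * sqrt t) * E) * (t - 1) = (\<integral>s. indicator {1<..<t} s * (\<kappa> * (1 / (8 * sqrt t) * E)) \<partial>lborel)"
    using t by simp
  also have "\<dots> \<le> (\<integral>s. indicator {0<..<t} s * (\<integral>\<omega>. ?g s \<omega> \<partial>M) \<partial>lborel)"
  proof (rule integral_mono)
    show "integrable lborel (\<lambda>s. indicator {1<..<t} s * (\<kappa> * (1 / (8 * sqrt t) * E)))"
      by (intro integrable_mult_left integrable_real_indicator emeasure_bounded_finite) auto
    have ib: "has_bochner_integral lborel (\<lambda>s. indicator {0<..<t} s * \<kappa>) (measure lborel {0<..<t} * \<kappa>)"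
      by (intro has_bochner_integral_mult_left has_bochner_integral_real_indicator emeasure_bounded_finite) auto
    have mm: "(\<lambda>s. \<integral>\<omega>. ?g s \<omega> \<partial>M) \<in> borel_measurable borel"
      using m by (rule borel_measurable_lebesgue_integral)
    show "integrable lborel (\<lambda>s. indicator {0<..<t} s * (\<integral>\<omega>. ?g s \<omega> \<partial>M))"
    proof (rule abs_integral_le(2)[OF ib])
      have "\<bar>\<integral>\<omega>. ?g s \<omega> \<partial>M\<bar> \<le> \<kappa>" if s: "0 < s" "s < t" for s
      proof -
        have "has_bochner_integral M (\<lambda>_. \<kappa>) \<kappa>"
          using has_bochner_integral_integrable[of M "\<lambda>_. \<kappa>"] by (simp add: prob_space)
        moreover have "(\<lambda>\<omega>. ?g s \<omega>) \<in> borel_measurable M"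
          using f(1) by measurable
        ultimately show ?thesis
          by (rule abs_integral_le(1)) (use bd[OF s] in simp)
      qed
      then show "\<bar>indicator {0<..<t} s * (\<integral>\<omega>. ?g s \<omega> \<partial>M)\<bar> \<le> indicator {0<..<t} s * \<kappa>" for s
        by (simp add: indicator_def)
    qed (use mm in measurable)
    fix s :: real
    have e: "(\<integral>\<omega>. ?g s \<omega> \<partial>M)
        = \<kappa> * (\<integral>\<omega>. f (C s \<omega>) * exp (- \<kappa> * occupation f s t \<omega>) \<partial>M)" for s
    proof -
      have "(\<integral>\<omega>. ?g s \<omega> \<partial>M)
          = (\<integral>\<omega>. \<kappa> * (f (C s \<omega>) * exp (- \<kappa> * occupation f s t \<omega>)) \<partial>M)"
        by (intro Bochner_Integration.integral_cong) (auto simp: mult_ac)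
      then show ?thesis by simp
    qed
    have "0 \<le> \<kappa> * (\<integral>\<omega>. f (C s \<omega>) * exp (- \<kappa> * occupation f s t \<omega>) \<partial>M)"
      using \<kappa> f(2) by (intro mult_nonneg_nonneg Bochner_Integration.integral_nonneg) auto
    moreover have "1 < s \<and> s < t \<Longrightarrow> \<kappa> * (1 / (8 * sqrt t) * E) \<le> \<kappa> * (\<integral>\<omega>. f (C s \<omega>) * exp (- \<kappa> * occupation f s t \<omega>) \<partial>M)"
      using at[of s] \<kappa> by (intro mult_left_mono) auto
    ultimately show "indicator {1<..<t} s * (\<kappa> * (1 / (8 * sqrt t) * E))
        \<le> indicator {0<..<t} s * (\<integral>\<omega>. ?g s \<omega> \<partial>M)"
      unfolding e indicator_def by (cases "1 < s \<and> s < t") auto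
  qed
  also have "\<dots> = (\<integral>\<omega>. (\<integral>s. indicator {0<..<t} s * ?g s \<omega> \<partial>lborel) \<partial>M)"
    by (rule integral_time_swap[OF m bd, symmetric])
  also have "\<dots> \<le> 1"
  \<comment> \<open>A non-integrable function has Bochner integral 0 by convention, so the bound
    holds in either case.\<close>
  proof (cases "integrable M (\<lambda>\<omega>. \<integral>s. indicator {0<..<t} s * ?g s \<omega> \<partial>lborel)")
    case True
    then show ?thesis using pathwise by (intro integral_le_const) auto
  next
    case False
    then show ?thesis by (simp add: not_integrable_integral_eq)
  qed
  finally have "\<kappa> * (1 / (8 * sqrt t) * E) * (t - 1) \<le> 1" .
  moreover have "\<kappa> * (1 / (8 * sqrt t) * E) * (t / 2) \<le> \<kappa> * (1 / (8 * sqrt t) * E) * (t - 1)"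
    using t \<kappa> E0 by (intro mult_left_mono) auto
  ultimately have "\<kappa> * (1 / (8 * sqrt t) * E) * (t / 2) \<le> 1" by linarith
  moreover have "\<kappa> * (1 / (8 * v) * E) * ((v * v) / 2) = E * (\<kappa> * v) / 16" if "0 < v" for v
    using that by simp
  from this[of "sqrt t"] have "\<kappa> * (1 / (8 * sqrt t) * E) * (t / 2) = E * (\<kappa> * sqrt t) / 16"
    using t by simp
  ultimately have "E * (\<kappa> * sqrt t) \<le> 16"
    by linarith
  then show ?thesis
    unfolding E_def[symmetric] using \<kappa> t by (simp add: le_divide_eq)
qed

end

text \<open>Start from the occupation at the origin on level 0, walk through unit cells to the cell
  of \<open>y\<close>, and then refine through all levels. The increments are controlled at every
  level, so convergence of \<open>Y\<close> at this time follows from the hypothesis itself.\<close>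

lemma (in continuous_path) L_ge:
  assumes inc: "\<And>n k. k \<in> {- int (Suc N * 2 ^ n)..int (Suc N * 2 ^ n)} \<Longrightarrow> \<bar>X n k t - X n (k + 1) t\<bar> \<le> tent_ratio ^ n * q"
    and q: "0 \<le> q" and y: "\<bar>y\<bar> \<le> real N"
  shows "X 0 0 t - (real N + 1) * q - q / (1 - tent_ratio) \<le> L y t"
proof -
  have st: "\<bar>Y (Suc m) y t - Y m y t\<bar> \<le> q * tent_ratio ^ m" for m
  proof -
    have "\<bar>Y (Suc m) y t - Y m y t\<bar> \<le> tent_ratio ^ Suc m * q"
      by (intro Y_Suc[OF y] inc) auto
    also have "\<dots> \<le> tent_ratio ^ m * q"
      using tent_ratio q by (intro mult_right_mono power_decreasing) auto
    finally show ?thesis by (simp add: mult.commute)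
  qed
  obtain l where l: "(\<lambda>n. Y n y t) \<longlonglongrightarrow> l"
    and b: "\<And>m. 0 \<le> m \<Longrightarrow> \<bar>Y m y t - l\<bar> \<le> q * tent_ratio ^ m / (1 - tent_ratio)"
    by (rule geometric_increments_limit[where n = 0 and \<delta> = q, OF tent_ratio(1,2) q st]) auto
  have "l = L y t"
    unfolding L_def using l by (rule limI[symmetric])
  then have 1: "\<bar>Y 0 y t - L y t\<bar> \<le> q / (1 - tent_ratio)"
    using b[of 0] by simp
  have pos: "\<bar>X 0 (int i) t - X 0 0 t\<bar> \<le> real i * q" if "i \<le> Suc N" for i
    using that
  proof (induction i)
    case (Suc i)
    have "\<bar>X 0 (int i) t - X 0 (int i + 1) t\<bar> \<le> tent_ratio ^ 0 * q"
      by (rule inc) (use Suc.prems in auto)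
    then show ?case using Suc by (simp add: algebra_simps add.commute)
  qed simp
  have neg: "\<bar>X 0 (- int i) t - X 0 0 t\<bar> \<le> real i * q" if "i \<le> Suc N" for i
    using that
  proof (induction i)
    case (Suc i)
    have "\<bar>X 0 (- int (Suc i)) t - X 0 (- int (Suc i) + 1) t\<bar> \<le> tent_ratio ^ 0 * q"
      by (rule inc) (use Suc.prems in auto)
    then show ?case using Suc by (simp add: algebra_simps)
  qed simp
  define k where "k = \<lfloor>2 ^ 0 * y\<rfloor>"
  have k: "k \<in> {- int N..int N}"
    using floor_bounds[OF y, of 0] by (simp add: k_def)
  have "\<bar>X 0 k t - X 0 0 t\<bar> \<le> real (nat \<bar>k\<bar>) * q"
    using pos[of "nat \<bar>k\<bar>"] neg[of "nat \<bar>k\<bar>"] k by (cases "0 \<le> k") auto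
  also have "\<dots> \<le> (real N + 1) * q"
    using k q by (intro mult_right_mono) auto
  finally show ?thesis
    using 1 unfolding k_def[symmetric] by linarith
qed

section \<open>Unboundedness of the local time at every level\<close>

context continuous_brownian_motion
begin

sublocale path: continuous_path "\<lambda>u. C u \<omega>" for \<omega>
  by unfold_locales (rule continuous_C)

abbreviation Loc :: "real \<Rightarrow> real \<Rightarrow> 'w \<Rightarrow> real" where
  "Loc y t \<omega> \<equiv> continuous_path.L (\<lambda>u. C u \<omega>) y t"

lemma occupation_wide_tent: "occupation wide_tent 0 t \<omega> = X 0 (- 1) t \<omega> + X 0 0 t \<omega> + X 0 1 t \<omega>"
proof -
  have "((\<lambda>u. wide_tent (C u \<omega>)) has_integral X 0 (- 1) t \<omega> + X 0 0 t \<omega> + X 0 1 t \<omega>) {0..t}"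
    unfolding tent_occupation_def wide_tent_def
    by (intro has_integral_add integrable_integral path.integrable_tent_path)
  then show ?thesis by (simp add: occupation_def integral_unique)
qed

text \<open>Exponential Markov inequality with \<open>\<kappa> = 1 / a\<close>: an occupation of at
  most \<open>a\<close> makes the exponential at least \<open>exp (- 1)\<close>. The constant is 16
  times an upper bound 3 for \<open>exp 1\<close>.\<close>

lemma occupation_wide_tent_tail:
  assumes t: "2 \<le> t" and a: "0 < a"
  shows "prob {\<omega> \<in> space M. occupation wide_tent 0 t \<omega> \<le> a} \<le> 48 * a / sqrt t"
proof -
  have w: "continuous_on UNIV wide_tent"
    unfolding wide_tent_def by (intro continuous_intros continuous_tent)
  have [measurable]: "occupation wide_tent 0 t \<in> borel_measurable M"
    using w by measurable
  have w0: "0 \<le> occupation wide_tent 0 t \<omega>" for \<omega>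
    unfolding occupation_wide_tent using t by (intro add_nonneg_nonneg X_bounds) auto
  have "prob {\<omega> \<in> space M. occupation wide_tent 0 t \<omega> \<le> a}
      \<le> prob {\<omega> \<in> space M. exp (- 1) \<le> exp (- (1 / a) * occupation wide_tent 0 t \<omega>)}"
  proof (rule finite_measure_mono)
    show "{\<omega> \<in> space M. occupation wide_tent 0 t \<omega> \<le> a}
        \<subseteq> {\<omega> \<in> space M. exp (- 1) \<le> exp (- (1 / a) * occupation wide_tent 0 t \<omega>)}"
      using a by (auto simp: divide_le_eq)
  qed measurable
  also have "\<dots> \<le> (\<integral>\<omega>. exp (- (1 / a) * occupation wide_tent 0 t \<omega>) \<partial>M) / exp (- 1)"
  proof (rule integral_Markov_inequality_measure[where A = "{}"])
    show "integrable M (\<lambda>\<omega>. exp (- (1 / a) * occupation wide_tent 0 t \<omega>))"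
      by (rule integrable_const_bound[of _ 1]) (use w0 a in auto)
  qed auto
  also have "\<dots> \<le> (16 / (1 / a * sqrt t)) / exp (- 1)"
    using laplace_occupation_le[OF t, of "1 / a"] a by (intro divide_right_mono) auto
  also have "\<dots> = 16 * a / sqrt t * exp 1"
    by (simp add: exp_minus field_simps)
  also have "\<dots> \<le> 16 * a / sqrt t * 3"
    using exp_le a t by (intro mult_left_mono) auto
  finally show ?thesis by (simp add: mult_ac)
qed

text \<open>
  At time \<open>Q ^ 16\<close> the local time near the origin is typically of order \<open>Q ^ 8\<close>, while its
  oscillation over a fixed interval exceeds \<open>Q ^ 7\<close> only with small probability.
\<close>

lemma L_large_probability:
  obtains K where "\<And>Q. 2 \<le> Q \<Longrightarrow> \<exists>A\<in>sets M. prob A \<le> K / real Q \<and>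
    (\<forall>\<omega>\<in>space M - A. \<forall>y. \<bar>y\<bar> \<le> real N \<longrightarrow> real Q \<le> Loc y (real Q ^ 16) \<omega>)"
proof -
  \<comment> \<open>Two neighbour increments replace the occupation of \<open>wide_tent\<close> by
    three copies of the central one, at the cost of 2. Then \<open>(m - 2) / 3\<close> must cover
    the loss \<open>real N + 1 + 1 / (1 - tent_ratio)\<close> in \<open>L_ge\<close> and still leave
    one multiple of \<open>q ^ 7\<close>.\<close>
  define m where "m = 3 * (real N + 2 + 1 / (1 - tent_ratio)) + 2"
  have m: "0 < m" using tent_ratio unfolding m_def by (intro add_nonneg_pos mult_nonneg_nonneg add_nonneg_nonneg) auto
  define R where "R = 3 * real (Suc N) * moment_constant 1"
  have mc: "0 \<le> moment_constant 1" by (simp add: moment_constant_def)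
  define K where "K = 48 * m + R * 2"
  show ?thesis
  proof (rule that[of K])
    fix Q :: nat assume Q: "2 \<le> Q"
    define q where "q = real Q"
    have q: "2 \<le> q" using Q by (simp add: q_def)
    define t where "t = q ^ 16"
    have t: "2 \<le> t" "0 \<le> t"
      using power_increasing[of 1 16 q] q by (auto simp: t_def)
    have st: "sqrt t = q ^ 8"
      unfolding t_def using q by (intro real_sqrt_unique) (auto simp: power_mult[symmetric])
    define W where "W = {\<omega> \<in> space M. occupation wide_tent 0 t \<omega> \<le> m * q ^ 7}"
    define I where "I = (\<lambda>n. {- int (Suc N * 2 ^ n)..int (Suc N * 2 ^ n)})"
    define S where "S = (\<lambda>n k. {\<omega> \<in> space M. tent_ratio ^ n * q ^ 7 < \<bar>X n k t \<omega> - X n (k + 1) t \<omega>\<bar>})"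
    define T where "T = (\<lambda>n. \<Union>k\<in>I n. S n k)"
    have w: "continuous_on UNIV wide_tent"
      unfolding wide_tent_def by (intro continuous_intros continuous_tent)
    have [measurable]: "occupation wide_tent 0 t \<in> borel_measurable M"
      using w by measurable
    have Wm: "W \<in> sets M" and Sm: "S n k \<in> sets M" for n k
      unfolding W_def S_def by measurable
    have Tm: "T n \<in> sets M" for n
      unfolding T_def using Sm by (intro sets.finite_UN) (auto simp: I_def)
    have PW: "prob W \<le> 48 * m / q"
    proof -
      have "prob W \<le> 48 * (m * q ^ 7) / q ^ 8"
        unfolding W_def st[symmetric] using m q t by (intro occupation_wide_tent_tail) auto
      also have "\<dots> = 48 * m / q"
        using q by (simp add: field_simps power_numeral_reduce)
      finally show ?thesis .
    qed
    have PS: "prob (S n k) \<le> moment_constant 1 * (1 / 8) ^ n / q" for n k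
    proof -
      \<comment> \<open>The horizon \<open>q ^ 16\<close> corresponds to
        \<open>\<theta> = q\<^sup>2\<close>. The moment constant then grows like
        \<open>q ^ 96\<close> and the threshold contributes \<open>q ^ 112\<close>; of the surplus
        \<open>q ^ 16\<close> a single factor suffices.\<close>
      have t8: "t \<le> (q ^ 2) ^ 8" by (simp add: t_def power_mult[symmetric])
      have "prob (S n k) \<le> moment_constant (q ^ 2) * (1 / 8) ^ n / (q ^ 7) ^ 16"
        unfolding S_def using q t(2) t8 by (intro X_space_tail) (auto intro!: one_le_power)
      also have "moment_constant (q ^ 2) = moment_constant 1 * q ^ 96"
        unfolding moment_constant_def by (simp add: power_mult_distrib power_mult[symmetric])
      also have "moment_constant 1 * q ^ 96 * (1 / 8) ^ n / (q ^ 7) ^ 16 = moment_constant 1 * (1 / 8) ^ n / q ^ 16"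
      proof -
        have e: "(q ^ 7) ^ 16 = q ^ 96 * q ^ 16" by (simp add: power_mult[symmetric] power_add[symmetric])
        have cancel: "a * u * b / (u * v) = a * b / v" if "0 < u" for a b u v :: real
          using that by simp
        show ?thesis unfolding e by (rule cancel) (use q in simp)
      qed
      also have "\<dots> \<le> moment_constant 1 * (1 / 8) ^ n / q"
        using mc q power_increasing[of 1 16 q] by (intro divide_left_mono mult_nonneg_nonneg) auto
      finally show ?thesis .
    qed
    have PT: "prob (T n) \<le> R / q * (1 / 2) ^ n" for n
    proof -
      have "prob (T n) \<le> (\<Sum>k\<in>I n. prob (S n k))"
        unfolding T_def using Sm by (intro finite_measure_subadditive_finite) (auto simp: I_def)
      also have "\<dots> \<le> (\<Sum>k\<in>I n. moment_constant 1 * (1 / 8) ^ n / q)"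
        by (intro sum_mono PS)
      also have "\<dots> = real (card (I n)) * (moment_constant 1 * (1 / 8) ^ n / q)"
        by simp
      also have "\<dots> \<le> (3 * real (Suc N) * 2 ^ n) * (moment_constant 1 * (1 / 8) ^ n / q)"
      proof (rule mult_right_mono)
        have "(1::real) \<le> real (Suc N) * 2 ^ n"
          using mult_mono[of 1 "real (Suc N)" 1 "2 ^ n :: real"] by simp
        moreover have "real (card (I n)) = 2 * (real (Suc N) * 2 ^ n) + 1"
          by (simp add: I_def nat_add_distrib algebra_simps)
        ultimately show "real (card (I n)) \<le> 3 * real (Suc N) * 2 ^ n" by linarith
      qed (use mc q in auto)
      also have "\<dots> = R / q * (2 ^ n * (1 / 8) ^ n)"
        by (simp add: R_def)
      also have "2 ^ n * (1 / 8) ^ n = (1 / 4 :: real) ^ n"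
        by (simp add: power_mult_distrib[symmetric])
      also have "R / q * (1 / 4) ^ n \<le> R / q * (1 / 2) ^ n"
        using mc q by (intro mult_left_mono power_mono) (auto simp: R_def)
      finally show ?thesis .
    qed
    have sum2: "(\<lambda>n. R / q * (1 / 2) ^ n) sums (R / q * 2)"
      using sums_mult[OF geometric_sums[of "1 / 2 :: real"], of "R / q"] by simp
    have summT: "summable (\<lambda>n. prob (T n))"
      by (rule summable_comparison_test'[OF sums_summable[OF sum2], of 0]) (use PT in auto)
    have "prob (\<Union>n. T n) \<le> (\<Sum>n. prob (T n))"
      using Tm by (intro finite_measure_subadditive_countably summT) auto
    also have "\<dots> \<le> R / q * 2"
      using suminf_le[OF PT summT sums_summable[OF sum2]] sums_unique[OF sum2] by simp
    finally have PU: "prob (\<Union>n. T n) \<le> R / q * 2" .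
    have Um: "(\<Union>n. T n) \<in> sets M" using Tm by (intro sets.countable_UN) auto
    show "\<exists>A\<in>sets M. prob A \<le> K / real Q \<and>
        (\<forall>\<omega>\<in>space M - A. \<forall>y. \<bar>y\<bar> \<le> real N \<longrightarrow> real Q \<le> Loc y (real Q ^ 16) \<omega>)"
    proof (intro bexI[of _ "W \<union> (\<Union>n. T n)"] conjI ballI allI impI)
      show "W \<union> (\<Union>n. T n) \<in> sets M" using Wm Um by (rule sets.Un)
      have "prob (W \<union> (\<Union>n. T n)) \<le> 48 * m / q + R / q * 2"
        using measure_Un_le[OF Wm Um] PW PU by linarith
      then show "prob (W \<union> (\<Union>n. T n)) \<le> K / real Q"
        by (simp add: K_def q_def add_divide_distrib)
      fix \<omega> y assume \<omega>: "\<omega> \<in> space M - (W \<union> (\<Union>n. T n))" and y: "\<bar>y\<bar> \<le> real N"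
      have inc: "\<bar>X n k t \<omega> - X n (k + 1) t \<omega>\<bar> \<le> tent_ratio ^ n * q ^ 7"
        if "k \<in> {- int (Suc N * 2 ^ n)..int (Suc N * 2 ^ n)}" for n k
      proof -
        have "k \<in> I n" using that by (simp only: I_def)
        then have "\<omega> \<notin> S n k" using \<omega> by (auto simp: T_def)
        then show ?thesis using \<omega> by (simp add: S_def not_less)
      qed
      have "m * q ^ 7 < occupation wide_tent 0 t \<omega>"
        using \<omega> by (auto simp: W_def not_le)
      moreover have "\<bar>X 0 (- 1) t \<omega> - X 0 (- 1 + 1) t \<omega>\<bar> \<le> tent_ratio ^ 0 * q ^ 7"
        "\<bar>X 0 0 t \<omega> - X 0 (0 + 1) t \<omega>\<bar> \<le> tent_ratio ^ 0 * q ^ 7"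
        by (rule inc; simp)+
      ultimately have 1: "(m - 2) * q ^ 7 \<le> 3 * X 0 0 t \<omega>"
        unfolding occupation_wide_tent by (simp add: algebra_simps)
      have 2: "(m - 2) * q ^ 7 = 3 * (q ^ 7 + (real N + 1) * q ^ 7 + q ^ 7 / (1 - tent_ratio))"
        by (simp add: m_def algebra_simps)
      have 3: "X 0 0 t \<omega> - (real N + 1) * q ^ 7 - q ^ 7 / (1 - tent_ratio) \<le> Loc y t \<omega>"
        using q by (intro path.L_ge[OF inc _ y]) auto
      have 4: "q \<le> q ^ 7"
        using power_increasing[of 1 7 q] q by simp
      have "q ^ 7 + (real N + 1) * q ^ 7 + q ^ 7 / (1 - tent_ratio) \<le> X 0 0 t \<omega>"
        using 1 unfolding 2 by (simp only: mult_le_cancel_left_pos zero_less_numeral)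
      then have "q \<le> Loc y t \<omega>"
        using 3 4 by linarith
      then show "real Q \<le> Loc y (real Q ^ 16) \<omega>"
        unfolding q_def[symmetric] t_def[symmetric] .
    qed
  qed
qed

text \<open>The probability \<open>K / real Q\<close> is not summable in \<open>Q\<close>, so
  Borel-Cantelli does not apply. It suffices that good values of \<open>Q\<close> occur arbitrarily
  late, which can fail only on an intersection of bad events.\<close>

lemma AE_L_unbounded: "AE \<omega> in M. \<forall>y K. \<exists>t\<ge>0. K \<le> Loc y t \<omega>"
proof -
  have "AE \<omega> in M. \<exists>Q\<ge>Q0. \<forall>y. \<bar>y\<bar> \<le> real N \<longrightarrow> real Q \<le> Loc y (real Q ^ 16) \<omega>" for N Q0 :: nat
  proof -
    obtain K where K: "\<And>Q. 2 \<le> Q \<Longrightarrow> \<exists>A\<in>sets M. prob A \<le> K / real Q \<and>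
        (\<forall>\<omega>\<in>space M - A. \<forall>y. \<bar>y\<bar> \<le> real N \<longrightarrow> real Q \<le> Loc y (real Q ^ 16) \<omega>)"
      using L_large_probability[of N] by blast
    then obtain A where A: "\<And>Q. 2 \<le> Q \<Longrightarrow> A Q \<in> sets M" "\<And>Q. 2 \<le> Q \<Longrightarrow> prob (A Q) \<le> K / real Q"
      "\<And>Q \<omega> y. 2 \<le> Q \<Longrightarrow> \<omega> \<in> space M - A Q \<Longrightarrow> \<bar>y\<bar> \<le> real N \<Longrightarrow> real Q \<le> Loc y (real Q ^ 16) \<omega>"
      by metis
    \<comment> \<open>All bad events from \<open>Q0\<close> on; its probability is at most
      \<open>K / real Q\<close> for every large \<open>Q\<close>, hence 0.\<close>
    define Z where "Z = (\<Inter>Q\<in>{max 2 Q0..}. A Q)"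
    have Zm: "Z \<in> sets M"
      unfolding Z_def using A(1) by (intro sets.countable_INT) auto
    have "prob Z \<le> K / real Q" if "max 2 Q0 \<le> Q" for Q
    proof -
      have "prob Z \<le> prob (A Q)"
        using that A(1) by (intro finite_measure_mono) (auto simp: Z_def)
      then show ?thesis using A(2)[of Q] that by simp
    qed
    moreover have "(\<lambda>Q. K / real Q) \<longlonglongrightarrow> 0"
      by (rule lim_const_over_n)
    ultimately have "prob Z \<le> 0"
      by (intro LIMSEQ_le_const[where X = "\<lambda>Q. K / real Q"] exI[of _ "max 2 Q0"]) auto
    then have "Z \<in> null_sets M"
      using Zm by (auto simp: null_sets_def emeasure_eq_measure measure_le_0_iff)
    then show ?thesis
    proof (rule AE_I', intro subsetI)
      fix \<omega> assume \<omega>: "\<omega> \<in> {\<omega> \<in> space M. \<not> (\<exists>Q\<ge>Q0. \<forall>y. \<bar>y\<bar> \<le> real N \<longrightarrow> real Q \<le> Loc y (real Q ^ 16) \<omega>)}"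
      show "\<omega> \<in> Z"
        unfolding Z_def
      proof
        fix Q assume Q: "Q \<in> {max 2 Q0..}"
        show "\<omega> \<in> A Q"
        proof (rule ccontr)
          assume "\<omega> \<notin> A Q"
          then have "\<forall>y. \<bar>y\<bar> \<le> real N \<longrightarrow> real Q \<le> Loc y (real Q ^ 16) \<omega>"
            using A(3)[of Q \<omega>] \<omega> Q by auto
          then show False using \<omega> Q by auto
        qed
      qed
    qed
  qed
  then have "AE \<omega> in M. \<forall>N Q0 :: nat. \<exists>Q\<ge>Q0. \<forall>y. \<bar>y\<bar> \<le> real N \<longrightarrow> real Q \<le> Loc y (real Q ^ 16) \<omega>"
    by (simp add: AE_all_countable)
  then show ?thesis
  proof eventually_elim
    case (elim \<omega>)
    show ?case
    proof (intro allI)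
      fix y K :: real
      obtain N where N: "\<bar>y\<bar> \<le> real N" using real_arch_simple by blast
      obtain Q0 where Q0: "K \<le> real Q0" using real_arch_simple by blast
      obtain Q where "Q0 \<le> Q" "real Q \<le> Loc y (real Q ^ 16) \<omega>" using elim N by blast
      then show "\<exists>t\<ge>0. K \<le> Loc y t \<omega>"
        using Q0 by (intro exI[of _ "real Q ^ 16"]) auto
    qed
  qed
qed

section \<open>From the almost sure event to single paths\<close>

lemma AE_regular_path: "AE \<omega> in M. regular_path (\<lambda>u. C u \<omega>)"
proof -
  have "AE \<omega> in M. \<forall>N. \<forall>\<^sub>F n in sequentially. \<forall>k\<in>{- int (N * 2 ^ n)..int (N * 2 ^ n)}. \<forall>j\<in>{..N * 2 ^ n}.
    \<bar>X n k (real j / 2 ^ n) \<omega> - X n (k + 1) (real j / 2 ^ n) \<omega>\<bar> \<le> tent_ratio ^ n \<and>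
    \<bar>X n k (real j / 2 ^ n + (1 / 2) ^ n) \<omega> - X n k (real j / 2 ^ n) \<omega>\<bar> \<le> tent_ratio ^ n"
    unfolding AE_all_countable using AE_grid_increments by blast
  then show ?thesis
  proof eventually_elim
    case (elim \<omega>)
    then show ?case
      by unfold_locales blast
  qed
qed

end

text \<open>Collects everything the deterministic part uses, so that all claims hold on one event.
  The path \<open>c\<close> lives on the whole line, while \<open>b\<close> agrees with it only at
  nonnegative times.\<close>

definition is_regular_version :: "(real \<Rightarrow> real) \<Rightarrow> (real \<Rightarrow> real) \<Rightarrow> bool" where
  "is_regular_version b c \<longleftrightarrow> regular_path c \<and> (\<forall>y K. \<exists>t\<ge>0. K \<le> continuous_path.L c y t) \<and>
    (\<forall>u\<ge>0. b u = c u) \<and> (\<forall>t\<ge>0. \<forall>y. local_time b y t = continuous_path.L c y t)"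

lemma AE_regular_version:
  assumes "standard_brownian_motion M B"
  shows "AE \<omega> in M. \<exists>c. is_regular_version (\<lambda>u. B u \<omega>) c"
proof -
  interpret standard_brownian_motion M B by fact
  obtain C where "continuous_brownian_motion M B C" by (rule continuous_version)
  then interpret continuous_brownian_motion M B C .
  show ?thesis
    using AE_regular_path AE_L_unbounded C_eq
  proof eventually_elim
    case (elim \<omega>)
    interpret r: regular_path "\<lambda>u. C u \<omega>" by fact
    have "local_time (\<lambda>u. B u \<omega>) y t = continuous_path.L (\<lambda>u. C u \<omega>) y t" if "0 \<le> t" for y t
    proof -
      \<comment> \<open>The sets in the definition of local time involve only times in
        \<open>{0..t}\<close>, where both paths agree, so the quotients coincide for every
        \<epsilon>.\<close>
      have "{u \<in> {0..t}. \<bar>B u \<omega> - y\<bar> < \<epsilon>} = {u \<in> {0..t}. \<bar>C u \<omega> - y\<bar> < \<epsilon>}" for \<epsilon>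
        using elim(3) by auto
      then have "local_time (\<lambda>u. B u \<omega>) y t = local_time (\<lambda>u. C u \<omega>) y t"
        by (simp only: local_time_def)
      then show ?thesis using r.local_time_eq_L[OF that] by simp
    qed
    then show ?case
      using elim unfolding is_regular_version_def by (intro exI[of _ "\<lambda>u. C u \<omega>"]) auto
  qed
qed

lemma regular_version_bricks:
  assumes "is_regular_version b c"
  shows "0 \<le> t \<Longrightarrow> bricklayer b ` {0..t} = {(y, s). y \<in> b ` {0..t} \<and> s \<in> {0..local_time b y t}}"
    and "0 \<le> t \<Longrightarrow> has_bochner_integral lborel (\<lambda>y. local_time b y t) t"
    and "continuous_on {0..} (\<lambda>t. (\<alpha> * b t, \<beta> * local_time b (b t) t))"
    and "\<alpha> \<noteq> 0 \<Longrightarrow> 0 < \<beta> \<Longrightarrow> (\<lambda>t. (\<alpha> * b t, \<beta> * local_time b (b t) t)) ` {0..} = UNIV \<times> {0..}"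
    and "0 \<le> t \<Longrightarrow> \<alpha> \<noteq> 0 \<Longrightarrow> 0 < \<beta> \<Longrightarrow>
      emeasure lebesgue ((\<lambda>t. (\<alpha> * b t, \<beta> * local_time b (b t) t)) ` {0..t}) = ennreal (\<bar>\<alpha>\<bar> * \<beta> * t)"
proof -
  have c: "regular_path c" and unbounded: "\<forall>y K. \<exists>t\<ge>0. K \<le> continuous_path.L c y t"
    and b: "\<forall>u\<ge>0. b u = c u"
    and lt: "\<forall>t\<ge>0. \<forall>y. local_time b y t = continuous_path.L c y t"
    using assms unfolding is_regular_version_def by blast+
  interpret regular_path c by fact
  have curve: "(\<alpha> * b u, \<beta> * local_time b (b u) u) = (\<alpha> * c u, \<beta> * L (c u) u)" if "0 \<le> u" for u
    using that by (simp add: b lt)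
  have image: "(\<lambda>t. (\<alpha> * b t, \<beta> * local_time b (b t) t)) ` S = (\<lambda>t. (\<alpha> * c t, \<beta> * L (c t) t)) ` S"
    if "S \<subseteq> {0..}" for S
    using that curve by (intro image_cong) auto
  show "bricklayer b ` {0..t} = {(y, s). y \<in> b ` {0..t} \<and> s \<in> {0..local_time b y t}}" if "0 \<le> t"
  proof -
    have "bricklayer b ` {0..t} = (\<lambda>u. (c u, L (c u) u)) ` {0..t}"
      by (intro image_cong) (auto simp: bricklayer_def b lt)
    moreover have "b ` {0..t} = c ` {0..t}"
      by (intro image_cong) (auto simp: b)
    ultimately show ?thesis
      using image_bricks[OF that] by (simp only: lt that)
  qed
  show "has_bochner_integral lborel (\<lambda>y. local_time b y t) t" if "0 \<le> t"
    using has_bochner_integral_L[OF that] by (simp only: lt that)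
  show "continuous_on {0..} (\<lambda>t. (\<alpha> * b t, \<beta> * local_time b (b t) t))"
    by (rule continuous_on_eq[OF continuous_brick_curve[of \<alpha> \<beta>]]) (simp add: curve)
  show "(\<lambda>t. (\<alpha> * b t, \<beta> * local_time b (b t) t)) ` {0..} = UNIV \<times> {0..}" if "\<alpha> \<noteq> 0" "0 < \<beta>"
    using brick_curve_range[OF _ that] unbounded by (simp only: image order_refl)
  show "emeasure lebesgue ((\<lambda>t. (\<alpha> * b t, \<beta> * local_time b (b t) t)) ` {0..t}) = ennreal (\<bar>\<alpha>\<bar> * \<beta> * t)"
    if "0 \<le> t" "\<alpha> \<noteq> 0" "0 < \<beta>"
  proof -
    have "{0..t} \<subseteq> {0..}" by auto
    from image[OF this] show ?thesis using emeasure_bricks[OF that] by simp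
  qed
qed

theorem mainTheorem2:
  fixes M :: "'w measure" and B :: "real \<Rightarrow> 'w \<Rightarrow> real"
  assumes "standard_brownian_motion M B"
  shows
    "(AE \<omega> in M. \<forall>t\<ge>0. let b = (\<lambda>u. B u \<omega>) in
        bricklayer b ` {0..t} = {(y, s). y \<in> b ` {0..t} \<and> s \<in> {0..local_time b y t}} \<and>
        emeasure lebesgue (bricklayer b ` {0..t}) =
          ennreal (\<integral>y. local_time b y t \<partial>lborel) \<and>
        has_bochner_integral lborel (\<lambda>y. local_time b y t) t) \<and>
     (\<forall>c d :: real. c \<noteq> 0 \<and> d > 0 \<longrightarrow>
        (AE \<omega> in M. let b = (\<lambda>u. B u \<omega>); \<gamma> = (\<lambda>t. (c * b t, d * local_time b (b t) t)) in
           continuous_on {0..} \<gamma> \<and> \<gamma> ` {0..} = UNIV \<times> {0..}) \<and>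
        (AE \<omega> in M. \<forall>t\<ge>0. let b = (\<lambda>u. B u \<omega>); \<gamma> = (\<lambda>u. (c * b u, d * local_time b (b u) u)) in
           emeasure lebesgue (\<gamma> ` {0..t}) = ennreal (\<bar>c\<bar> * d * t)))"
proof -
  \<comment> \<open>The event does not depend on the time or on the scaling factors; on it every
    claim is deterministic.\<close>
  note path = AE_regular_version[OF assms]
  have 1: "AE \<omega> in M. \<forall>t\<ge>0. let b = (\<lambda>u. B u \<omega>) in
        bricklayer b ` {0..t} = {(y, s). y \<in> b ` {0..t} \<and> s \<in> {0..local_time b y t}} \<and>
        emeasure lebesgue (bricklayer b ` {0..t}) =
          ennreal (\<integral>y. local_time b y t \<partial>lborel) \<and>
        has_bochner_integral lborel (\<lambda>y. local_time b y t) t"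
    using path
  proof eventually_elim
    case (elim \<omega>)
    then obtain p where "is_regular_version (\<lambda>u. B u \<omega>) p" by blast
    note conclusions = regular_version_bricks[OF this]
    have "emeasure lebesgue (bricklayer (\<lambda>u. B u \<omega>) ` {0..t}) = ennreal (\<integral>y. local_time (\<lambda>u. B u \<omega>) y t \<partial>lborel)"
      if "0 \<le> t" for t
      \<comment> \<open>The bricklayer is the scaled curve with both factors equal to 1.\<close>
      using conclusions(5)[OF that, of 1 1] conclusions(2)[OF that]
      by (simp add: bricklayer_def[abs_def] has_bochner_integral_iff)
    then show ?case
      using conclusions(1,2) by (simp add: Let_def)
  qed
  have 2: "AE \<omega> in M. let b = (\<lambda>u. B u \<omega>); \<gamma> = (\<lambda>t. (c * b t, d * local_time b (b t) t)) in
           continuous_on {0..} \<gamma> \<and> \<gamma> ` {0..} = UNIV \<times> {0..}" if "c \<noteq> 0" "0 < d" for c d :: real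
    using path
  proof eventually_elim
    case (elim \<omega>)
    then obtain p where "is_regular_version (\<lambda>u. B u \<omega>) p" by blast
    note conclusions = regular_version_bricks[OF this]
    show ?case
      using conclusions(3)[of c d] conclusions(4)[OF that] by (simp add: Let_def)
  qed
  have 3: "AE \<omega> in M. \<forall>t\<ge>0. let b = (\<lambda>u. B u \<omega>); \<gamma> = (\<lambda>u. (c * b u, d * local_time b (b u) u)) in
           emeasure lebesgue (\<gamma> ` {0..t}) = ennreal (\<bar>c\<bar> * d * t)" if "c \<noteq> 0" "0 < d" for c d :: real
    using path
  proof eventually_elim
    case (elim \<omega>)
    then obtain p where "is_regular_version (\<lambda>u. B u \<omega>) p" by blast
    note conclusions = regular_version_bricks[OF this]
    show ?case
      using conclusions(5)[OF _ that] by (simp add: Let_def)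
  qed
  show ?thesis
    using 1 2 3 by blast
qed

end
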